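(* Assume the following conjecture of Cilleruelo and Granville: for every $\epsilon$ with $0<\epsilon<1$ there is a constant $B_\epsilon>0$ such that, for every $\lambda$ with $\lambda^2$ a positive integer, any arc of length less than $\lambda^{1-\epsilon}$ on the circle $\{x\in\mathbb{R}^2:|x|=\lambda\}$ contains at most $B_\epsilon$ points of $\mathbb{Z}^2$. Then for every $\varepsilon>0$ there are $\delta>0$ and $\lambda(\varepsilon)>0$ such that the following holds. Let $\varphi$ be a (nonzero, real-valued) eigenfunction of the Laplacian on $\mathbb{T}^2$ with eigenvalue $E=\lambda^2$ (in the normalization of the context), where $\lambda>\lambda(\varepsilon)$. Let $\{C_\alpha\}$ be a collection of disjoint regular arcs contained in the nodal set $\mathcal{N}_\varphi$ satisfying $$w(C_\alpha)>\lambda^{-1+\varepsilon}\quad\text{for each }\alpha.$$ Then $$\sum_\alpha \operatorname{length}(C_\alpha)<\lambda^{1-\delta}.$$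
   Context: $\mathbb{T}^2=\mathbb{R}^2/\mathbb{Z}^2$ is the standard flat torus and $e(t)=\exp(2\pi i t)$. An eigenfunction with eigenvalue $E=\lambda^2$ (the Laplace eigenvalue is actually $4\pi^2E$; $E$ is an integer which is a sum of two squares) is a nonzero real-valued function $\varphi(x)=\sum_{\xi\in\mathbb{Z}^2,\ |\xi|^2=E}a_\xi\, e(x\cdot\xi)$ with $\overline{a_\xi}=a_{-\xi}$. Its nodal set is $\mathcal{N}_\varphi=\{x\in\mathbb{T}^2:\varphi(x)=0\}$. Regular arc: an arc $C\subset\mathbb{T}^2$ is regular if it admits an arc-length parametrization $\gamma:[0,\ell]\to C$, $0<\ell<1$, which is $C^2$ and such that for some $\kappa>0$ one has $\kappa<|\ddot\gamma|<2\kappa$ pointwise and $2\kappa\ell<1$. Width: for a convex curve $C$ in the plane, the width $w(C)$ is the minimal distance between a pair of parallel supporting lines of the curve. A regular arc in $\mathbb{T}^2$ is viewed as a planar (convex) arc by lifting to $\mathbb{R}^2$. *)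

theory Defs
  imports "HOL-Analysis.Analysis"
begin

definition int_lattice :: "(real^2) set" where
  "int_lattice = {x. \<forall>i. x $ i \<in> \<int>}"

text \<open>Points of the torus are cosets of the integer lattice.\<close>

definition torus_proj :: "real^2 \<Rightarrow> (real^2) set" where
  "torus_proj x = {y. y - x \<in> int_lattice}"

definition lattice_circle :: "real \<Rightarrow> (real^2) set" where
  "lattice_circle E = {\<xi> \<in> int_lattice. (norm \<xi>)\<^sup>2 = E}"

text \<open>An eigenfunction is given as a periodic function on the plane. Since it is nonzero,
  \<open>lattice_circle E\<close> is nonempty, so \<open>E\<close> is automatically an integer and a sum of two squares.\<close>

definition torus_eigenfunction :: "real \<Rightarrow> (real^2 \<Rightarrow> real) \<Rightarrow> bool" where
  "torus_eigenfunction E \<phi> \<longleftrightarrow>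
     (\<exists>a :: real^2 \<Rightarrow> complex.
        (\<forall>\<xi>\<in>lattice_circle E. cnj (a \<xi>) = a (- \<xi>)) \<and>
        (\<forall>x. complex_of_real (\<phi> x) =
               (\<Sum>\<xi>\<in>lattice_circle E. a \<xi> * exp (2 * of_real pi * \<i> * of_real (x \<bullet> \<xi>))))) \<and>
     (\<exists>x. \<phi> x \<noteq> 0)"

definition nodal_set :: "(real^2 \<Rightarrow> real) \<Rightarrow> (real^2) set set" where
  "nodal_set \<phi> = torus_proj ` {x. \<phi> x = 0}"

text \<open>\<open>C\<close> is a regular arc of length \<open>L\<close> in the torus, and \<open>\<gamma>\<close> on \<open>{0..L}\<close> is a lift to the plane
  of an arc-length parametrization of \<open>C\<close>. Derivatives at the end points are one-sided.
  Injectivity of the parametrization is not required separately: the total turning of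
  \<open>\<gamma>\<close> is less than \<open>2 * \<kappa> * L < 1\<close>, so \<open>\<gamma>\<close> is injective on \<open>{0..L}\<close>, and as \<open>L < 1\<close> no two of
  its points differ by a nonzero lattice vector.\<close>

definition regular_arc_lift ::
    "(real \<Rightarrow> real^2) \<Rightarrow> real \<Rightarrow> (real^2) set set \<Rightarrow> bool" where
  "regular_arc_lift \<gamma> L C \<longleftrightarrow>
     0 < L \<and> L < 1 \<and> C = torus_proj ` \<gamma> ` {0..L} \<and>
     (\<exists>\<gamma>' \<gamma>''.
        (\<forall>t\<in>{0..L}. (\<gamma> has_vector_derivative \<gamma>' t) (at t within {0..L})) \<and>
        (\<forall>t\<in>{0..L}. (\<gamma>' has_vector_derivative \<gamma>'' t) (at t within {0..L})) \<and>
        continuous_on {0..L} \<gamma>'' \<and>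
        (\<forall>t\<in>{0..L}. norm (\<gamma>' t) = 1) \<and>
        (\<exists>\<kappa>>0. (\<forall>t\<in>{0..L}. \<kappa> < norm (\<gamma>'' t) \<and> norm (\<gamma>'' t) < 2 * \<kappa>) \<and> 2 * \<kappa> * L < 1))"

text \<open>The lines \<open>u \<bullet> x = a\<close> and \<open>u \<bullet> x = b\<close> are the two supporting lines of \<open>K\<close> with unit
  normal \<open>u\<close>; their distance is \<open>b - a\<close>. For compact nonempty \<open>K\<close> the infimum is a minimum.\<close>

definition width :: "(real^2) set \<Rightarrow> real" where
  "width K = Inf {b - a | a b. \<exists>u. norm u = 1 \<and>
     (\<forall>x\<in>K. a \<le> u \<bullet> x \<and> u \<bullet> x \<le> b) \<and> (\<exists>x\<in>K. u \<bullet> x = a) \<and> (\<exists>x\<in>K. u \<bullet> x = b)}"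

text \<open>For \<open>s \<le> t\<close> with \<open>t - s < 2 * pi\<close> this is an arc of length \<open>r * (t - s)\<close>. In the conjecture
  below \<open>r \<ge> 1\<close>, so the length bound already forces \<open>t - s < 1\<close>. Closed arcs suffice, as an
  arc and its closure have the same length.\<close>

definition circle_arc :: "real \<Rightarrow> real \<Rightarrow> real \<Rightarrow> (real^2) set" where
  "circle_arc r s t = (\<lambda>\<theta>. vector [r * cos \<theta>, r * sin \<theta>]) ` {s..t}"

definition cilleruelo_granville :: bool where
  "cilleruelo_granville \<longleftrightarrow>
     (\<forall>\<epsilon>::real. 0 < \<epsilon> \<and> \<epsilon> < 1 \<longrightarrow>
        (\<exists>B::real. B > 0 \<and>
           (\<forall>r s t. 0 < r \<and> r\<^sup>2 \<in> \<int> \<and> s \<le> t \<and> r * (t - s) < r powr (1 - \<epsilon>) \<longrightarrow>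
              real (card (circle_arc r s t \<inter> int_lattice)) \<le> B)))"

end

theory Submission
  imports Defs
begin

text \<open>Write \<open>e(t) = exp (2 \<pi> i t)\<close> and let \<open>F\<close> be the set of lattice points on the circle of radius \<open>\<lambda>\<close>,
so that \<open>\<phi> = \<Sum> a(\<xi>) e(x \<bullet> \<xi>)\<close> over \<open>\<xi> \<in> F\<close>. Let \<open>\<xi>\<^sub>0\<close> carry the largest coefficient, of modulus \<open>A\<close>.
The conjecture enters twice: \<open>F\<close> has at most \<open>\<lambda>\<close> to an arbitrarily small power many points
(\<open>cg_total\<close>), and a neighbourhood of \<open>\<xi>\<^sub>0\<close> of size slightly smaller than \<open>\<lambda>\<close> contains boundedly many
(\<open>cg_close\<close>). A pigeonhole over concentric rings around \<open>\<xi>\<^sub>0\<close> then gives a bounded cluster \<open>J\<close> around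
\<open>\<xi>\<^sub>0\<close>, of diameter \<open>O(\<lambda> powr (1 - \<epsilon>/2))\<close>, all of whose points have distance at least
\<open>\<lambda> powr (1 - \<epsilon>/2)\<close> from the rest of \<open>F\<close> (\<open>isolated_cluster\<close>). Let \<open>\<psi>\<close> be the part of the sum with
frequencies in \<open>J\<close>.

On a regular arc of width more than \<open>\<lambda> powr (- 1 + \<epsilon>)\<close> the curvature makes \<open>e(\<gamma>(t) \<bullet> (\<xi> - \<eta>))\<close> oscillate
whenever \<open>\<bar>\<xi> - \<eta>\<bar> \<ge> \<lambda> powr (1 - \<epsilon>/2)\<close>, with a power saving over the trivial bound
(\<open>arc_oscillation\<close>, by van der Corput's method). As \<open>\<phi>\<close> vanishes on the arc, \<open>\<psi>\<close> equals there minus the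
remaining part of the sum; multiplying by the conjugate of \<open>\<psi>\<close> and integrating shows that the mean
square of \<open>\<psi>\<close> along the arc is smaller than \<open>A\<^sup>2\<close> by a power of \<open>\<lambda>\<close>. So on at least half of every arc
\<open>\<psi>\<close> is smaller than \<open>A\<close> by a power of \<open>\<lambda>\<close> (\<open>cluster_small_half\<close>).

It remains to bound the length of the part of the nodal set on which \<open>\<psi>\<close> is small. By projecting to
the axes (\<open>crofton_bound\<close>) this amounts to counting the zeros of \<open>\<phi>\<close> with \<open>\<psi>\<close> small on lines parallel
to an axis. Cut the unit segment of such a line into about \<open>2 \<lambda>\<close> cells. Two facts suffice.
First, a cell contains at most \<open>2 card F\<close> zeros of \<open>\<phi>\<close>: this is Rolle's theorem applied to the
operators \<open>D\<^sup>2 + \<omega>\<^sup>2\<close>, each of which removes the frequencies \<open>\<plusminus>\<omega>\<close> and loses two zeros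
(\<open>exp_sum_zeros\<close>). Secondly, \<open>\<bar>\<psi>\<bar>\<close> is nearly constant on a cell, and an exponential sum with boundedly
many terms and one large coefficient is small at only a proportion \<open>\<lambda> powr (- c)\<close> of equally spaced
points; here a frequency is removed by taking the difference of two translates, the translation
being chosen so that the set of small values is met by many of its translates
(\<open>discrete_sublevel\<close>). A coefficient of the restriction of \<open>\<psi>\<close> to a line can be small because two
frequencies \<open>(m, n)\<close> and \<open>(- m, n)\<close> coincide on the line, but this happens only for a small set of
lines (\<open>line_coeff_small\<close>). The total length is thus at most
\<open>card F * \<lambda> * \<lambda> powr (- c)\<close> up to a constant, and \<open>card F\<close> is smaller than \<open>\<lambda> powr (c/2)\<close> times a
constant.\<close>

section \<open>Characters of the line\<close>

definition ee :: "real \<Rightarrow> complex" where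
  "ee t = exp (\<i> * of_real (2 * pi * t))"

lemma ee_add: "ee (s + t) = ee s * ee t"
  by (simp add: ee_def exp_add [symmetric] algebra_simps)

lemma ee_0 [simp]: "ee 0 = 1"
  by (simp add: ee_def)

lemma norm_ee [simp]: "norm (ee t) = 1"
  unfolding ee_def by (rule norm_exp_i_times)

lemma ee_minus: "ee (- t) = cnj (ee t)"
  by (simp add: ee_def exp_cnj)

lemma ee_diff: "ee (s - t) = ee s * cnj (ee t)"
  using ee_add [of s "- t"] by (simp add: ee_minus)

lemma Re_ee: "Re (ee t) = cos (2 * pi * t)" and Im_ee: "Im (ee t) = sin (2 * pi * t)"
  unfolding ee_def cis_conv_exp [symmetric] by simp_all

lemma ee_int: "t \<in> \<int> \<Longrightarrow> ee t = 1"
  by (simp add: complex_eq_iff Re_ee Im_ee cos_integer_2pi sin_integer_2pi)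

lemma norm_ee_minus_1: "norm (ee t - 1) = 2 * \<bar>sin (pi * t)\<bar>"
  using dist_exp_i_1 [of "2 * pi * t"] by (simp add: ee_def)

lemma norm_ee_minus_1_le: "norm (ee t - 1) \<le> 7 * \<bar>t\<bar>"
proof -
  have "2 * \<bar>sin (pi * t)\<bar> \<le> 2 * \<bar>pi * t\<bar>"
    using abs_sin_x_le_abs_x by simp
  also have "\<dots> = (2 * pi) * \<bar>t\<bar>" by (simp add: abs_mult)
  also have "\<dots> \<le> 7 * \<bar>t\<bar>"
    using pi_less_4 pi_approx by (intro mult_right_mono) auto
  finally show ?thesis by (simp add: norm_ee_minus_1)
qed

lemma sin_ge_half:
  fixes z :: real assumes "0 \<le> z" "z \<le> pi / 2" shows "z / 2 \<le> sin z"
proof (cases "z = 0")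
  case False
  have c: "sqrt 2 / 2 \<le> cos y" if "0 \<le> y" "y \<le> pi / 4" for y
    using cos_monotone_0_pi_le [of y "pi/4"] that by (simp add: cos_45)
  have "\<exists>y>0. y < z/2 \<and> sin (z/2) - sin 0 = (z/2 - 0) * cos y"
    using assms False by (intro MVT2) (auto intro!: derivative_eq_intros)
  then obtain y where y: "0 < y" "y < z/2" "sin (z/2) = (z/2) * cos y" by auto
  have "z / 2 = 2 * ((z/2) * (sqrt 2 / 2)) * (sqrt 2 / 2)" by simp
  also have "\<dots> \<le> 2 * ((z/2) * cos y) * cos (z/2)"
    using assms y c [of y] c [of "z/2"]
    by (intro mult_mono mult_left_mono mult_nonneg_nonneg) (auto intro: order_trans [of 0 "sqrt 2/2"])
  also have "\<dots> = sin z"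
    using sin_double [of "z/2"] y by simp
  finally show ?thesis .
qed simp

text \<open>With \<open>k\<close> the nearest integer, chord and arc are comparable. This turns the smallness of \<open>e(t) - 1\<close>
into a condition on \<open>t\<close> modulo 1 whose solutions can be counted or measured.\<close>

lemma norm_ee_minus_1_ge: "\<exists>k::int. \<bar>t - of_int k\<bar> \<le> norm (ee t - 1) / 3 \<and> \<bar>t - of_int k\<bar> \<le> 1/2"
proof -
  define k where "k = round t"
  define y where "y = \<bar>t - of_int k\<bar>"
  have y: "0 \<le> y" "y \<le> 1/2"
    using of_int_round_abs_le [of t] by (auto simp: y_def k_def abs_minus_commute)
  have "pi * y / 2 \<le> sin (pi * y)"
    using y by (intro sin_ge_half) auto
  moreover have "3 * y \<le> pi * y"
    using y pi_gt3 by (intro mult_right_mono) auto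
  ultimately have *: "3 * y \<le> 2 * \<bar>sin (pi * y)\<bar>" by linarith
  have "ee (t - of_int k) = ee t"
    using ee_diff [of t "of_int k"] ee_int [of "of_int k"] by simp
  then have "norm (ee t - 1) = 2 * \<bar>sin (pi * (t - of_int k))\<bar>"
    by (metis norm_ee_minus_1)
  also have "\<bar>sin (pi * (t - of_int k))\<bar> = \<bar>sin (pi * y)\<bar>"
    by (cases "t - of_int k \<ge> 0") (auto simp: y_def abs_if right_diff_distrib sin_diff)
  finally show ?thesis
    using * y by (intro exI [of _ k]) (auto simp: y_def)
qed

lemma continuous_on_ee [continuous_intros]:
  "continuous_on S f \<Longrightarrow> continuous_on S (\<lambda>x. ee (f x))"
  unfolding ee_def by (intro continuous_intros)

lemma has_vector_derivative_ee:
  fixes f :: "real \<Rightarrow> real"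
  assumes "(f has_vector_derivative f') (at t within S)"
  shows "((\<lambda>x. ee (f x)) has_vector_derivative (2 * pi * \<i> * f' * ee (f t))) (at t within S)"
proof -
  have "((\<lambda>x. of_real (2 * pi * f x)) has_vector_derivative of_real (2 * pi * f')) (at t within S)"
    using assms unfolding has_real_derivative_iff_has_vector_derivative [symmetric]
    by (intro has_vector_derivative_of_real DERIV_cmult)
  then have "((\<lambda>x. \<i> * of_real (2 * pi * f x)) has_vector_derivative \<i> * of_real (2 * pi * f')) (at t within S)"
    by (intro has_vector_derivative_mult_right)
  from field_vector_diff_chain_within [OF this, of exp "exp (\<i> * of_real (2 * pi * f t))"]
  show ?thesis unfolding ee_def o_def
    by (simp add: DERIV_exp has_field_derivative_at_within algebra_simps)
qed

section \<open>Oscillatory integrals\<close>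

text \<open>Integration by parts, with \<open>e(f) / (2 \<pi> i f')\<close> as approximate primitive. Monotonicity of \<open>f'\<close> would
remove the second term, but some power saving is all that is needed later, and this form applies
without any information on the sign of \<open>f''\<close>.\<close>

lemma osc_first:
  fixes f f' f'' :: "real \<Rightarrow> real"
  assumes ab: "a \<le> b"
    and df: "\<And>t. t \<in> {a..b} \<Longrightarrow> (f has_vector_derivative f' t) (at t within {a..b})"
    and df': "\<And>t. t \<in> {a..b} \<Longrightarrow> (f' has_vector_derivative f'' t) (at t within {a..b})"
    and cont: "continuous_on {a..b} f''"
    and mu: "\<mu> > 0" "\<And>t. t \<in> {a..b} \<Longrightarrow> \<mu> \<le> \<bar>f' t\<bar>"
    and Q: "\<And>t. t \<in> {a..b} \<Longrightarrow> \<bar>f'' t\<bar> \<le> Q"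
  shows "norm (integral {a..b} (\<lambda>t. ee (f t))) \<le> 1 / \<mu> + Q * (b - a) / \<mu>\<^sup>2"
proof -
  have cf: "continuous_on {a..b} f" "continuous_on {a..b} f'"
    using df df' has_vector_derivative_continuous continuous_on_eq_continuous_within by blast+
  have nz: "f' t \<noteq> 0" if "t \<in> {a..b}" for t using mu that by force
  have Q0: "Q \<ge> 0" using Q [of a] ab by fastforce
  define G where "G t = ee (f t) / (2 * pi * \<i> * f' t)" for t
  define H where "H t = ee (f t) * (f'' t / (2 * pi * \<i> * (f' t)\<^sup>2))" for t
  have dG: "(G has_vector_derivative ee (f t) - H t) (at t within {a..b})" if t: "t \<in> {a..b}" for t
  proof -
    have 1: "((\<lambda>x. inverse (f' x)) has_vector_derivative (- f'' t / (f' t)\<^sup>2)) (at t within {a..b})"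
      using df' [OF t] nz [OF t] unfolding has_real_derivative_iff_has_vector_derivative [symmetric]
      by (auto intro!: derivative_eq_intros simp: power2_eq_square field_simps)
    have 2: "((\<lambda>x. ee (f x) * of_real (inverse (f' x))) has_vector_derivative
          ee (f t) * of_real (- f'' t / (f' t)\<^sup>2) + 2 * pi * \<i> * f' t * ee (f t) * of_real (inverse (f' t)))
          (at t within {a..b})"
      by (rule has_vector_derivative_mult [OF has_vector_derivative_ee [OF df [OF t]] has_vector_derivative_of_real [OF 1 [folded has_real_derivative_iff_has_vector_derivative]]])
    have 3: "((\<lambda>x. 1 / (2 * pi * \<i>) * (ee (f x) * of_real (inverse (f' x)))) has_vector_derivative
        1 / (2 * pi * \<i>) *
          (ee (f t) * of_real (- f'' t / (f' t)\<^sup>2) + 2 * pi * \<i> * f' t * ee (f t) * of_real (inverse (f' t))))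
          (at t within {a..b})"
      by (rule has_vector_derivative_mult_right [OF 2])
    have e1: "(\<lambda>x. 1 / (2 * pi * \<i>) * (ee (f x) * of_real (inverse (f' x)))) = G"
      by (rule ext) (simp add: G_def field_simps of_real_inverse)
    have e2: "1 / (2 * pi * \<i>) *
          (ee (f t) * of_real (- f'' t / (f' t)\<^sup>2) + 2 * pi * \<i> * f' t * ee (f t) * of_real (inverse (f' t)))
       = ee (f t) - H t"
      using nz [OF t] by (simp add: H_def field_simps of_real_inverse)
    show ?thesis using 3 unfolding e1 e2 .
  qed
  have cH: "continuous_on {a..b} H"
    unfolding H_def using nz cf cont by (intro continuous_intros) auto
  have iH: "H integrable_on {a..b}" by (rule integrable_continuous_interval [OF cH])
  have "((\<lambda>t. ee (f t) - H t) has_integral (G b - G a)) {a..b}"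
    by (rule fundamental_theorem_of_calculus [OF ab dG])
  then have "((\<lambda>t. (ee (f t) - H t) + H t) has_integral ((G b - G a) + integral {a..b} H)) {a..b}"
    by (intro has_integral_add integrable_integral iH)
  then have eq: "integral {a..b} (\<lambda>t. ee (f t)) = (G b - G a) + integral {a..b} H"
    by (simp add: integral_unique)
  have nG: "norm (G t) \<le> 1 / (2 * \<mu>)" if "t \<in> {a..b}" for t
  proof -
    have "norm (G t) = 1 / (2 * pi * \<bar>f' t\<bar>)" by (simp add: G_def norm_divide norm_mult)
    also have "\<dots> \<le> 1 / (2 * \<mu>)"
      using mu(1) mu(2) [OF that] pi_gt3
      by (intro divide_left_mono mult_mono) (auto intro!: mult_pos_pos)
    finally show ?thesis .
  qed
  have nH: "norm (H t) \<le> Q / \<mu>\<^sup>2" if "t \<in> {a..b}" for t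
  proof -
    have "norm (H t) = \<bar>f'' t\<bar> / (2 * pi * (f' t)\<^sup>2)" by (simp add: H_def norm_divide norm_mult norm_power)
    also have "\<dots> \<le> Q / (1 * \<mu>\<^sup>2)"
    proof (intro frac_le mult_mono)
      show "\<mu>\<^sup>2 \<le> (f' t)\<^sup>2" using mu(1) mu(2) [OF that] by (metis abs_le_square_iff abs_of_pos)
      show "1 \<le> 2 * pi" using pi_gt3 by linarith
    qed (use Q [OF that] Q0 mu in auto)
    finally show ?thesis by simp
  qed
  have "norm (integral {a..b} H) \<le> Q / \<mu>\<^sup>2 * (b - a)"
    using integral_bound [OF ab cH] nH by blast
  moreover have "norm (G b - G a) \<le> 1 / (2 * \<mu>) + 1 / (2 * \<mu>)"
    using norm_triangle_ineq4 [of "G b" "G a"] nG [of b] nG [of a] ab by fastforce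
  ultimately show ?thesis
    unfolding eq using norm_triangle_ineq [of "G b - G a" "integral {a..b} H"] by (simp add: field_simps)
qed

text \<open>Where \<open>\<bar>f'\<bar>\<close> is minimal, say at \<open>t0\<close>, the lower bound on \<open>\<bar>f''\<bar>\<close> forces \<open>\<bar>f' t\<bar> \<ge> m \<bar>t - t0\<bar>\<close>. The
\<open>w\<close>-neighbourhood of \<open>t0\<close> is estimated trivially, the rest by the previous lemma.\<close>

lemma osc_second:
  fixes f f' f'' :: "real \<Rightarrow> real"
  assumes ab: "a \<le> b"
    and df: "\<And>t. t \<in> {a..b} \<Longrightarrow> (f has_vector_derivative f' t) (at t within {a..b})"
    and df': "\<And>t. t \<in> {a..b} \<Longrightarrow> (f' has_vector_derivative f'' t) (at t within {a..b})"
    and cont: "continuous_on {a..b} f''"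
    and m: "m > 0" "\<And>t. t \<in> {a..b} \<Longrightarrow> m \<le> \<bar>f'' t\<bar>"
    and Q: "\<And>t. t \<in> {a..b} \<Longrightarrow> \<bar>f'' t\<bar> \<le> Q"
    and w: "w > 0"
  shows "norm (integral {a..b} (\<lambda>t. ee (f t))) \<le> 2 * w + 2 / (m * w) + Q * (b - a) / (m * w)\<^sup>2"
proof -
  have cf: "continuous_on {a..b} f" "continuous_on {a..b} f'"
    using df df' has_vector_derivative_continuous continuous_on_eq_continuous_within by blast+
  have Q0: "Q \<ge> 0" using Q [of a] ab by fastforce
  obtain t0 where t0: "t0 \<in> {a..b}" "\<And>t. t \<in> {a..b} \<Longrightarrow> \<bar>f' t0\<bar> \<le> \<bar>f' t\<bar>"
    using continuous_attains_inf [of "{a..b}" "\<lambda>t. \<bar>f' t\<bar>"] continuous_on_rabs [OF cf(2)] ab by auto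
  have mvt: "m * \<bar>t - s\<bar> \<le> \<bar>f' t - f' s\<bar>" if "s \<in> {a..b}" "t \<in> {a..b}" "s < t" for s t
  proof -
    have "\<exists>z\<in>{s<..<t}. f' t - f' s = (t - s) * f'' z"
    proof -
      have "\<And>x. s \<le> x \<Longrightarrow> x \<le> t \<Longrightarrow> (f' has_derivative (*) (f'' x)) (at x within {s..t})"
        using df' that unfolding has_real_derivative_iff_has_vector_derivative [symmetric] has_field_derivative_def
        by (metis (full_types) atLeastAtMost_iff atLeastatMost_subset_iff has_derivative_subset order_trans)
      from mvt_simple [OF that(3) this] show ?thesis
        by (auto simp: mult.commute)
    qed
    then obtain z where z: "z \<in> {s<..<t}" "f' t - f' s = (t - s) * f'' z" by blast
    with that m(2) [of z] have "m * \<bar>t - s\<bar> \<le> \<bar>f'' z\<bar> * \<bar>t - s\<bar>"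
      by (intro mult_right_mono) auto
    then show ?thesis using z by (simp add: abs_mult mult.commute)
  qed
  have mvt': "m * \<bar>t - s\<bar> \<le> \<bar>f' t - f' s\<bar>" if "s \<in> {a..b}" "t \<in> {a..b}" for s t
    using mvt [of s t] mvt [of t s] that by (cases s t rule: linorder_cases) (auto simp: abs_minus_commute)
  have low: "m * \<bar>t - t0\<bar> \<le> \<bar>f' t\<bar>" if t: "t \<in> {a..b}" for t
  proof -
    \<comment> \<open>The values at \<open>t\<close> and \<open>t0\<close> have the same sign, or else \<open>f'\<close> has a zero, which is then at \<open>t0\<close>.\<close>
    have "\<bar>f' t - f' t0\<bar> \<le> \<bar>f' t\<bar>"
    proof (cases "f' t0 = 0 \<or> f' t * f' t0 \<ge> 0")
      case True
      then show ?thesis using t0(2) [OF t] by (auto simp: abs_if zero_le_mult_iff split: if_splits)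
    next
      case False
      have "\<exists>z\<in>{a..b}. f' z = 0"
      proof -
        have conn: "connected (f' ` {a..b})" using cf(2) by (intro connected_continuous_image) auto
        have "f' t \<in> f' ` {a..b}" "f' t0 \<in> f' ` {a..b}" using t t0 by auto
        moreover have "f' t \<le> 0 \<and> 0 \<le> f' t0 \<or> f' t0 \<le> 0 \<and> 0 \<le> f' t"
          using False by (auto simp: zero_le_mult_iff)
        ultimately have "0 \<in> f' ` {a..b}"
          using conn connectedD_interval by metis
        then show ?thesis by force
      qed
      then show ?thesis using t0(2) False by fastforce
    qed
    then show ?thesis using mvt' [OF t0(1) t] by linarith
  qed
  have int: "(\<lambda>t. ee (f t)) integrable_on {c..d}" if "{c..d} \<subseteq> {a..b}" for c d
    using that cf by (intro integrable_continuous_interval continuous_on_ee) (auto intro: continuous_on_subset)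
  define c where "c = max a (t0 - w)"
  define d where "d = min b (t0 + w)"
  have ord: "a \<le> c" "c \<le> d" "d \<le> b" using t0 w ab by (auto simp: c_def d_def)
  have mw: "m * w > 0" using m w by simp
  have piece: "norm (integral {u..v} (\<lambda>t. ee (f t))) \<le> 1 / (m * w) + Q * (v - u) / (m * w)\<^sup>2"
    if uv: "a \<le> u" "u \<le> v" "v \<le> b" and far: "\<And>t. t \<in> {u..v} \<Longrightarrow> w \<le> \<bar>t - t0\<bar>" for u v
  proof (rule osc_first [where f' = f' and f'' = f''])
    fix t assume t: "t \<in> {u..v}"
    then have tt: "t \<in> {a..b}" using uv by auto
    show "(f has_vector_derivative f' t) (at t within {u..v})" "(f' has_vector_derivative f'' t) (at t within {u..v})"
      using uv by (auto intro: has_vector_derivative_within_subset [OF df [OF tt]] has_vector_derivative_within_subset [OF df' [OF tt]])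
    show "m * w \<le> \<bar>f' t\<bar>" using low [OF tt] far [OF t] m
      by (meson mult_le_cancel_left_pos order_trans)
    show "\<bar>f'' t\<bar> \<le> Q" using Q [OF tt] .
  qed (use uv mw in \<open>auto intro: continuous_on_subset [OF cont]\<close>)
  have p1: "norm (integral {a..c} (\<lambda>t. ee (f t))) \<le> 1 / (m * w) + Q * (c - a) / (m * w)\<^sup>2"
  proof (cases "a = c")
    case True then show ?thesis using mw by (simp add: less_imp_le)
  next
    case False
    then show ?thesis using ord by (intro piece) (auto simp: c_def max_def split: if_splits)
  qed
  have p3: "norm (integral {d..b} (\<lambda>t. ee (f t))) \<le> 1 / (m * w) + Q * (b - d) / (m * w)\<^sup>2"
  proof (cases "d = b")
    case True then show ?thesis using mw by (simp add: less_imp_le)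
  next
    case False
    then show ?thesis using ord by (intro piece) (auto simp: d_def min_def split: if_splits)
  qed
  have p2: "norm (integral {c..d} (\<lambda>t. ee (f t))) \<le> 1 * (d - c)"
    using cf ord by (intro integral_bound continuous_on_ee) (auto intro: continuous_on_subset)
  have dc: "d - c \<le> 2 * w" by (auto simp: c_def d_def)
  have "integral {a..b} (\<lambda>t. ee (f t)) =
      integral {a..c} (\<lambda>t. ee (f t)) + (integral {c..d} (\<lambda>t. ee (f t)) + integral {d..b} (\<lambda>t. ee (f t)))"
    using ord by (subst Henstock_Kurzweil_Integration.integral_combine)
       (auto intro!: Henstock_Kurzweil_Integration.integral_combine [symmetric] int
             simp: Henstock_Kurzweil_Integration.integral_combine)
  then have "norm (integral {a..b} (\<lambda>t. ee (f t))) \<le>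
      (1 / (m * w) + Q * (c - a) / (m * w)\<^sup>2) + (2 * w + (1 / (m * w) + Q * (b - d) / (m * w)\<^sup>2))"
    using p1 p2 p3 dc
    by (smt (verit) norm_triangle_ineq)
  also have "\<dots> = 2 * w + 2 / (m * w) + Q * ((c - a) + (b - d)) / (m * w)\<^sup>2"
    by (simp add: add_divide_distrib ring_distribs)
  also have "\<dots> \<le> 2 * w + 2 / (m * w) + Q * (b - a) / (m * w)\<^sup>2"
    using ord Q0 by (intro add_left_mono divide_right_mono mult_left_mono) auto
  finally show ?thesis .
qed

section \<open>Curved arcs in the plane\<close>

text \<open>In the plane, \<open>u\<close> and \<open>v\<close> span the two directions, so this is the theorem of Pythagoras. It says that
the first and the second derivative of a phase \<open>\<gamma> \<bullet> \<eta>\<close> cannot both be small.\<close>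

lemma perp_component:
  fixes \<eta> u v :: "real^2"
  assumes "norm u = 1" "u \<bullet> v = 0"
  shows "(\<eta> \<bullet> v)\<^sup>2 = (norm v)\<^sup>2 * ((norm \<eta>)\<^sup>2 - (\<eta> \<bullet> u)\<^sup>2)"
proof -
  have u: "(u$1)\<^sup>2 + (u$2)\<^sup>2 = 1"
    using assms(1) by (simp add: norm_eq_1 inner_vec_def sum_2 power2_eq_square)
  have uv: "u$1 * v$1 + u$2 * v$2 = 0"
    using assms(2) by (simp add: inner_vec_def sum_2)
  define w where "w = v$1 * u$2 - v$2 * u$1"
  have "v$1 = w * u$2" "v$2 = - w * u$1"
    using u uv unfolding w_def by algebra+
  moreover have "(norm x)\<^sup>2 = (x$1)\<^sup>2 + (x$2)\<^sup>2" for x :: "real^2"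
    unfolding power2_norm_eq_inner by (simp add: inner_vec_def sum_2 power2_eq_square)
  moreover have "\<eta> \<bullet> x = \<eta>$1 * x$1 + \<eta>$2 * x$2" for x
    by (simp add: inner_vec_def sum_2)
  moreover have "(e1 * (w * u$2) - e2 * (w * u$1))\<^sup>2 =
      ((w * u$2)\<^sup>2 + (- w * u$1)\<^sup>2) * (e1\<^sup>2 + e2\<^sup>2 - (e1 * u$1 + e2 * u$2)\<^sup>2)" for e1 e2
    using u by algebra
  ultimately show ?thesis by simp
qed

lemma unit_speed_perp:
  fixes \<gamma>' :: "real \<Rightarrow> real^2"
  assumes "L > 0" and t: "t \<in> {0..L}"
    and d: "(\<gamma>' has_vector_derivative v) (at t within {0..L})"
    and u: "\<And>t. t \<in> {0..L} \<Longrightarrow> norm (\<gamma>' t) = 1"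
  shows "\<gamma>' t \<bullet> v = 0"
proof -
  have "((\<lambda>s. \<gamma>' s \<bullet> \<gamma>' s) has_real_derivative (\<gamma>' t \<bullet> v + v \<bullet> \<gamma>' t)) (at t within {0..L})"
    using bounded_bilinear.has_vector_derivative [OF bounded_bilinear_inner d d]
    by (simp add: has_real_derivative_iff_has_vector_derivative)
  then have "((\<lambda>s. \<gamma>' s \<bullet> \<gamma>' s) has_vector_derivative (\<gamma>' t \<bullet> v + v \<bullet> \<gamma>' t)) (at t within {0..L})"
    by (simp add: has_real_derivative_iff_has_vector_derivative)
  moreover have "((\<lambda>s. \<gamma>' s \<bullet> \<gamma>' s) has_vector_derivative 0) (at t within {0..L})"
    by (rule has_vector_derivative_transform [OF t _ has_vector_derivative_const [of 1]])
       (simp add: u norm_eq_1 [symmetric])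
  ultimately have "\<gamma>' t \<bullet> v + v \<bullet> \<gamma>' t = 0"
    using assms(1) t vector_derivative_unique_within [of t "{0..L}"]
      trivial_limit_within islimpt_Icc by metis
  then show ?thesis by (simp add: inner_commute)
qed

lemma vector_derivative_bound:
  fixes f f' :: "real \<Rightarrow> 'a::euclidean_space"
  assumes d: "\<And>t. t \<in> {0..L} \<Longrightarrow> (f has_vector_derivative f' t) (at t within {0..L})"
    and b: "\<And>t. t \<in> {0..L} \<Longrightarrow> norm (f' t) \<le> B"
    and st: "s \<in> {0..L}" "t \<in> {0..L}"
  shows "norm (f t - f s) \<le> B * \<bar>t - s\<bar>"
proof -
  have "norm (f t - f s) \<le> B * norm (t - s)"
    using d b st unfolding has_vector_derivative_def
    by (intro differentiable_bound [of "{0..L}" f "\<lambda>t x. x *\<^sub>R f' t"])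
       (auto intro!: onorm_le simp: mult.commute [of B] mult_left_mono)
  then show ?thesis by simp
qed

text \<open>The arc is cut into four pieces, on each of which the tangent turns by at most a quarter. On a piece
either the phase \<open>\<gamma> \<bullet> \<eta>\<close> has derivative at least \<open>norm \<eta> / 4\<close> throughout, or its derivative is at most
\<open>norm \<eta> / 2\<close> throughout, and then its second derivative is at least \<open>\<kappa> norm \<eta> / 2\<close>. The bound is
stated in terms of \<open>\<kappa> L\<^sup>2\<close>, which is comparable to the width of the arc.\<close>

lemma arc_oscillation:
  fixes \<gamma> \<gamma>' \<gamma>'' :: "real \<Rightarrow> real^2"
  assumes L: "L > 0"
    and d: "\<And>t. t \<in> {0..L} \<Longrightarrow> (\<gamma> has_vector_derivative \<gamma>' t) (at t within {0..L})"
    and d': "\<And>t. t \<in> {0..L} \<Longrightarrow> (\<gamma>' has_vector_derivative \<gamma>'' t) (at t within {0..L})"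
    and cont: "continuous_on {0..L} \<gamma>''"
    and unit: "\<And>t. t \<in> {0..L} \<Longrightarrow> norm (\<gamma>' t) = 1"
    and \<kappa>: "\<kappa> > 0" "\<And>t. t \<in> {0..L} \<Longrightarrow> \<kappa> < norm (\<gamma>'' t)" "\<And>t. t \<in> {0..L} \<Longrightarrow> norm (\<gamma>'' t) < 2 * \<kappa>"
    and turn: "2 * \<kappa> * L < 1"
    and \<eta>: "\<eta> \<noteq> 0"
  shows "norm (integral {0..L} (\<lambda>t. ee (\<gamma> t \<bullet> \<eta>))) \<le> 40 * L * (\<kappa> * L\<^sup>2 * norm \<eta>) powr (-1/4)"
proof -
  define M where "M = norm \<eta>"
  have M: "M > 0" using \<eta> by (simp add: M_def)
  define X where "X = \<kappa> * L\<^sup>2 * M"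
  have X: "X > 0" using \<kappa> L M by (simp add: X_def)
  have XL: "X \<le> L * M / 2"
  proof -
    have "X = (2 * \<kappa> * L) * (L * M / 2)" by (simp add: X_def power2_eq_square)
    also have "\<dots> \<le> 1 * (L * M / 2)" using turn L M by (intro mult_right_mono) auto
    finally show ?thesis by simp
  qed
  define f where "f t = \<gamma> t \<bullet> \<eta>" for t
  define f' where "f' t = \<gamma>' t \<bullet> \<eta>" for t
  define f'' where "f'' t = \<gamma>'' t \<bullet> \<eta>" for t
  have df: "(f has_vector_derivative f' t) (at t within {0..L})"
   and df': "(f' has_vector_derivative f'' t) (at t within {0..L})" if "t \<in> {0..L}" for t
    unfolding f_def f'_def f''_def using bounded_linear.has_vector_derivative [OF bounded_linear_inner_left]
      d d' that by blast+
  have cf: "continuous_on {0..L} f"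
    using df has_vector_derivative_continuous continuous_on_eq_continuous_within by blast
  have cf'': "continuous_on {0..L} f''" unfolding f''_def by (intro continuous_intros cont)
  have Q: "\<bar>f'' t\<bar> \<le> 2 * \<kappa> * M" if "t \<in> {0..L}" for t
  proof -
    have "\<bar>f'' t\<bar> \<le> norm (\<gamma>'' t) * norm \<eta>" unfolding f''_def by (rule Cauchy_Schwarz_ineq2)
    also have "\<dots> \<le> 2 * \<kappa> * M" using \<kappa>(3) [OF that] M by (simp add: M_def)
    finally show ?thesis .
  qed
  have var: "\<bar>f' t - f' s\<bar> \<le> 2 * \<kappa> * M * \<bar>t - s\<bar>" if "s \<in> {0..L}" "t \<in> {0..L}" for s t
    using vector_derivative_bound [of L f' f'' "2 * \<kappa> * M", OF df'] Q that by auto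
  have big: "\<kappa> * M / 2 \<le> \<bar>f'' t\<bar>" if t: "t \<in> {0..L}" and small: "\<bar>f' t\<bar> \<le> M / 2" for t
  proof -
    have "(f'' t)\<^sup>2 = (norm (\<gamma>'' t))\<^sup>2 * (M\<^sup>2 - (f' t)\<^sup>2)"
      using perp_component [OF unit [OF t] unit_speed_perp [OF L t d' [OF t] unit], of \<eta>]
      by (simp add: f''_def f'_def M_def inner_commute)
    moreover have "(norm (\<gamma>'' t))\<^sup>2 * (M\<^sup>2 - (f' t)\<^sup>2) \<ge> \<kappa>\<^sup>2 * (M\<^sup>2 - (M/2)\<^sup>2)"
    proof (intro mult_mono diff_left_mono)
      show "(f' t)\<^sup>2 \<le> (M / 2)\<^sup>2" using small M by (metis abs_le_square_iff abs_of_pos half_gt_zero)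
      show "0 \<le> M\<^sup>2 - (M / 2)\<^sup>2" by (simp add: power2_eq_square)
      show "\<kappa>\<^sup>2 \<le> (norm (\<gamma>'' t))\<^sup>2" using \<kappa>(2) [OF t] \<kappa>(1) by (intro power_mono) auto
    qed (use \<kappa> in auto)
    moreover have "(\<kappa> * M / 2)\<^sup>2 \<le> \<kappa>\<^sup>2 * (M\<^sup>2 - (M/2)\<^sup>2)"
      using \<kappa> M by (simp add: power2_eq_square field_simps)
    ultimately have "(\<kappa> * M / 2)\<^sup>2 \<le> (f'' t)\<^sup>2" by linarith
    then show ?thesis using \<kappa> M by (metis abs_le_square_iff abs_of_pos half_gt_zero mult_pos_pos)
  qed
  have int: "(\<lambda>t. ee (f t)) integrable_on {a..b}" if "{a..b} \<subseteq> {0..L}" for a b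
    using that cf by (intro integrable_continuous_interval continuous_on_ee) (auto intro: continuous_on_subset)
  \<comment> \<open>For \<open>X < 1\<close> the claim is weaker than the trivial bound \<open>L\<close>.\<close>
  show ?thesis
  proof (cases "X < 1")
    case True
    have "norm (integral {0..L} (\<lambda>t. ee (f t))) \<le> 1 * (L - 0)"
      using cf L by (intro integral_bound continuous_on_ee) auto
    moreover have "1 \<le> X powr (-1/4)"
      using True X powr_mono2' [of "-1/4" X 1] by simp
    then have "L * 1 \<le> L * X powr (-1/4)" using L by (intro mult_left_mono) auto
    then have "1 * (L - 0) \<le> 40 * L * X powr (-1/4)" using L by simp
    ultimately show ?thesis unfolding f_def X_def M_def by linarith
  next
    case False
    define Y where "Y = X powr (1/4)"
    have Y: "Y \<ge> 1" using False by (simp add: Y_def ge_one_powr_ge_zero)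
    have YX: "X = Y ^ 4" using X by (simp add: Y_def powr_powr flip: powr_realpow)
    have iY: "X powr (-1/4) = 1 / Y" by (simp add: Y_def powr_minus_divide)
    \<comment> \<open>The terms of the second derivative bound are at most of order \<open>L / Y\<close> for this \<open>w\<close>.\<close>
    define w where "w = L / Y"
    have w: "w > 0" using L Y by (simp add: w_def)
    have piece: "norm (integral {a..b} (\<lambda>t. ee (f t))) \<le> 10 * L / Y"
      if ab: "0 \<le> a" "a \<le> b" "b \<le> L" "b - a \<le> L / 4" for a b
    proof -
      have sub: "{a..b} \<subseteq> {0..L}" using ab by auto
      have var': "\<bar>f' t - f' s\<bar> \<le> M / 4" if "s \<in> {a..b}" "t \<in> {a..b}" for s t
      proof -
        have "\<bar>f' t - f' s\<bar> \<le> 2 * \<kappa> * M * \<bar>t - s\<bar>" using var that sub by blast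
        also have "\<dots> \<le> 2 * \<kappa> * M * (L / 4)"
        proof (rule mult_left_mono)
          show "\<bar>t - s\<bar> \<le> L / 4" using that ab unfolding atLeastAtMost_iff by linarith
        qed (use \<kappa> M in auto)
        also have "\<dots> = (2 * \<kappa> * L) * M / 4" by simp
        also have "\<dots> \<le> 1 * M / 4" using turn M by (intro divide_right_mono mult_right_mono) auto
        finally show ?thesis by simp
      qed
      have dd: "(f has_vector_derivative f' t) (at t within {a..b})"
        "(f' has_vector_derivative f'' t) (at t within {a..b})" "\<bar>f'' t\<bar> \<le> 2 * \<kappa> * M"
        if "t \<in> {a..b}" for t
      proof -
        have t: "t \<in> {0..L}" using that sub by blast
        show "(f has_vector_derivative f' t) (at t within {a..b})"
          by (rule has_vector_derivative_within_subset [OF df [OF t] sub])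
        show "(f' has_vector_derivative f'' t) (at t within {a..b})"
          by (rule has_vector_derivative_within_subset [OF df' [OF t] sub])
        show "\<bar>f'' t\<bar> \<le> 2 * \<kappa> * M" by (rule Q [OF t])
      qed
      have cc: "continuous_on {a..b} f''" using cf'' sub continuous_on_subset by blast
      have Y4: "Y \<le> Y ^ 4" "Y ^ 2 \<le> Y ^ 4" "1 \<le> Y ^ 3"
        using Y power_increasing [of 1 4 Y] power_increasing [of 2 4 Y] by auto
      show ?thesis
      proof (cases "\<exists>s\<in>{a..b}. \<bar>f' s\<bar> \<ge> M / 2")
        case True
        then obtain s where s: "s \<in> {a..b}" "\<bar>f' s\<bar> \<ge> M / 2" by blast
        have "M / 4 \<le> \<bar>f' t\<bar>" if "t \<in> {a..b}" for t
          using var' [OF s(1) that] s(2) by linarith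
        then have "norm (integral {a..b} (\<lambda>t. ee (f t))) \<le> 1 / (M / 4) + 2 * \<kappa> * M * (b - a) / (M / 4)\<^sup>2"
          using ab M dd cc by (intro osc_first [where f' = f' and f'' = f'']) auto
        also have "2 * \<kappa> * M * (b - a) / (M / 4)\<^sup>2 \<le> 2 * \<kappa> * M * (L / 4) / (M / 4)\<^sup>2"
          using ab \<kappa> M by (intro divide_right_mono mult_left_mono) auto
        also have "2 * \<kappa> * M * (L / 4) / (M / 4)\<^sup>2 = (2 * \<kappa> * L) * (4 / M)"
          using M by (simp add: field_simps power2_eq_square)
        also have "\<dots> \<le> 1 * (4 / M)" using turn M by (intro mult_right_mono) auto
        also have "1 / (M / 4) + 1 * (4 / M) = 8 / M" by simp
        also have "\<dots> \<le> 4 * L / X"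
          using XL X M by (simp add: field_simps)
        also have "\<dots> \<le> 4 * L / Y" using Y4 Y L unfolding YX by (intro divide_left_mono) auto
        also have "\<dots> \<le> 10 * L / Y" using Y L by (intro divide_right_mono) auto
        finally show ?thesis by simp
      next
        case False
        define m where "m = \<kappa> * M / 2"
        have m: "m > 0" using \<kappa> M by (simp add: m_def)
        have "m \<le> \<bar>f'' t\<bar>" if "t \<in> {a..b}" for t
          unfolding m_def using False that sub by (intro big) force+
        then have "norm (integral {a..b} (\<lambda>t. ee (f t)))
           \<le> 2 * w + 2 / (m * w) + 2 * \<kappa> * M * (b - a) / (m * w)\<^sup>2"
          using ab M dd cc m w by (intro osc_second [where f' = f' and f'' = f'']) auto
        also have "2 * \<kappa> * M * (b - a) / (m * w)\<^sup>2 \<le> 2 * \<kappa> * M * (L / 4) / (m * w)\<^sup>2"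
          using ab \<kappa> M by (intro divide_right_mono mult_left_mono) auto
        also have mw: "m * w = Y ^ 3 / (2 * L)"
        proof -
          have "\<kappa> * M * L\<^sup>2 = Y ^ 4" using YX by (simp add: X_def mult_ac)
          then show ?thesis using Y L by (simp add: m_def w_def field_simps power2_eq_square eval_nat_numeral)
        qed
        also have "2 * \<kappa> * M * (L / 4) / (Y ^ 3 / (2 * L))\<^sup>2 = 2 * L * X / (Y ^ 3)\<^sup>2"
          using L Y by (simp add: X_def field_simps power2_eq_square)
        also have "\<dots> = 2 * L / Y\<^sup>2"
          unfolding YX using Y by (simp add: field_simps eval_nat_numeral)
        also have "2 * w + 2 / (Y ^ 3 / (2 * L)) + 2 * L / Y\<^sup>2 = 2 * L / Y + 4 * L / Y ^ 3 + 2 * L / Y\<^sup>2"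
          by (simp add: w_def)
        also have "\<dots> \<le> 2 * L / Y + 4 * L / Y + 2 * L / Y"
          using L Y power_increasing [of 1 3 Y] power_increasing [of 1 2 Y]
          by (intro add_mono divide_left_mono) auto
        also have "\<dots> \<le> 10 * L / Y" using L Y by (simp add: field_simps)
        finally show ?thesis by simp
      qed
    qed
    define I where "I k = integral {0..real k * (L/4)} (\<lambda>t. ee (f t))" for k
    have step: "norm (I k) \<le> real k * (10 * L / Y)" if "k \<le> 4" for k
      using that
    proof (induction k)
      case 0 then show ?case by (simp add: I_def)
    next
      case (Suc k)
      have le: "real k * (L/4) \<le> real (Suc k) * (L/4)" "real (Suc k) * (L/4) \<le> 4 * (L/4)"
        using L Suc.prems by (intro mult_right_mono; simp)+
      have "I (Suc k) = I k + integral {real k * (L/4)..real (Suc k) * (L/4)} (\<lambda>t. ee (f t))"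
        unfolding I_def using L le
        by (intro Henstock_Kurzweil_Integration.integral_combine [symmetric] int) auto
      moreover have "norm (integral {real k * (L/4)..real (Suc k) * (L/4)} (\<lambda>t. ee (f t))) \<le> 10 * L / Y"
        using L le by (intro piece) (auto simp: field_simps)
      ultimately have "norm (I (Suc k)) \<le> real k * (10 * L / Y) + 10 * L / Y"
        using Suc norm_triangle_ineq [of "I k" "integral {real k * (L/4)..real (Suc k) * (L/4)} (\<lambda>t. ee (f t))"]
        by simp
      then show ?case by (simp add: ring_distribs add_divide_distrib)
    qed
    have "norm (integral {0..L} (\<lambda>t. ee (f t))) \<le> 40 * L / Y"
      using step [of 4] by (simp add: I_def)
    then show ?thesis
      using iY unfolding f_def X_def M_def by simp
  qed
qed

text \<open>The supporting lines parallel to the initial tangent have this distance at most, since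
the normal component of \<open>\<gamma>'\<close> starts at 0 and grows at rate less than \<open>2 \<kappa>\<close>.\<close>

lemma width_le:
  fixes \<gamma> \<gamma>' \<gamma>'' :: "real \<Rightarrow> real^2"
  assumes L: "L > 0"
    and d: "\<And>t. t \<in> {0..L} \<Longrightarrow> (\<gamma> has_vector_derivative \<gamma>' t) (at t within {0..L})"
    and d': "\<And>t. t \<in> {0..L} \<Longrightarrow> (\<gamma>' has_vector_derivative \<gamma>'' t) (at t within {0..L})"
    and unit: "\<And>t. t \<in> {0..L} \<Longrightarrow> norm (\<gamma>' t) = 1"
    and \<kappa>: "\<And>t. t \<in> {0..L} \<Longrightarrow> norm (\<gamma>'' t) < 2 * \<kappa>"
  shows "width (\<gamma> ` {0..L}) \<le> 2 * \<kappa> * L\<^sup>2"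
proof -
  define u :: "real^2" where "u = (\<chi> k. if k = 1 then \<gamma>' 0 $ 2 else - \<gamma>' 0 $ 1)"
  have perp: "u \<bullet> \<gamma>' 0 = 0" by (simp add: u_def inner_vec_def sum_2)
  have "u \<bullet> u = \<gamma>' 0 \<bullet> \<gamma>' 0" by (simp add: u_def inner_vec_def sum_2)
  then have nu: "norm u = 1" using unit [of 0] L by (simp add: norm_eq_sqrt_inner)
  define h where "h t = u \<bullet> \<gamma> t" for t
  have dh: "(h has_vector_derivative u \<bullet> \<gamma>' t) (at t within {0..L})" if "t \<in> {0..L}" for t
    unfolding h_def using bounded_linear.has_vector_derivative [OF bounded_linear_inner_right] d that by blast
  have ch: "continuous_on {0..L} h"
    using dh has_vector_derivative_continuous continuous_on_eq_continuous_within by blast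
  have bd: "norm (u \<bullet> \<gamma>' t) \<le> 2 * \<kappa> * L" if t: "t \<in> {0..L}" for t
  proof -
    have "norm (\<gamma>' t - \<gamma>' 0) \<le> 2 * \<kappa> * \<bar>t - 0\<bar>"
      using vector_derivative_bound [of L \<gamma>' \<gamma>'' "2 * \<kappa>" 0 t, OF d'] \<kappa> t L by (force intro: less_imp_le)
    moreover have "u \<bullet> \<gamma>' t = u \<bullet> (\<gamma>' t - \<gamma>' 0)" using perp by (simp add: inner_diff_right)
    moreover have "\<bar>u \<bullet> (\<gamma>' t - \<gamma>' 0)\<bar> \<le> 1 * norm (\<gamma>' t - \<gamma>' 0)"
      using Cauchy_Schwarz_ineq2 [of u "\<gamma>' t - \<gamma>' 0"] nu by simp
    moreover have "0 < 2 * \<kappa>" using \<kappa> [of 0] L norm_ge_zero [of "\<gamma>'' 0"] by (meson atLeastAtMost_iff less_imp_le order.refl order.strict_trans1)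
    then have "2 * \<kappa> * \<bar>t - 0\<bar> \<le> 2 * \<kappa> * L" using t by (intro mult_left_mono) auto
    ultimately show ?thesis by simp
  qed
  obtain s1 where s1: "s1 \<in> {0..L}" "\<And>t. t \<in> {0..L} \<Longrightarrow> h s1 \<le> h t"
    using continuous_attains_inf [OF _ _ ch] L by auto
  obtain s2 where s2: "s2 \<in> {0..L}" "\<And>t. t \<in> {0..L} \<Longrightarrow> h t \<le> h s2"
    using continuous_attains_sup [OF _ _ ch] L by auto
  have "width (\<gamma> ` {0..L}) \<le> h s2 - h s1"
    unfolding width_def
  proof (rule cInf_lower)
    show "h s2 - h s1 \<in> {b - a |a b. \<exists>u. norm u = 1 \<and> (\<forall>x\<in>\<gamma> ` {0..L}. a \<le> u \<bullet> x \<and> u \<bullet> x \<le> b) \<and>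
       (\<exists>x\<in>\<gamma> ` {0..L}. u \<bullet> x = a) \<and> (\<exists>x\<in>\<gamma> ` {0..L}. u \<bullet> x = b)}"
      using s1 s2 nu unfolding h_def by blast
  qed (fastforce intro: bdd_belowI [of _ 0])
  also have "h s2 - h s1 \<le> norm (h s2 - h s1)" by simp
  also have "\<dots> \<le> 2 * \<kappa> * L * \<bar>s2 - s1\<bar>"
    by (rule vector_derivative_bound [OF dh bd s1(1) s2(1)])
  also have "\<dots> \<le> 2 * \<kappa> * L * L"
    using order_trans [OF norm_ge_zero bd [of 0]] s1 s2 L by (intro mult_left_mono) auto
  finally show ?thesis by (simp add: power2_eq_square)
qed

section \<open>Sublevel sets of short exponential sums\<close>

lemma card_int_interval:
  fixes x w :: real assumes "w \<ge> 0"
  shows "finite {h::int. \<bar>of_int h - x\<bar> \<le> w}" "real (card {h::int. \<bar>of_int h - x\<bar> \<le> w}) \<le> 2 * w + 1"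
proof -
  have eq: "{h::int. \<bar>of_int h - x\<bar> \<le> w} = {\<lceil>x - w\<rceil>..\<lfloor>x + w\<rfloor>}"
    by (auto simp: abs_le_iff ceiling_le_iff le_floor_iff)
  show "finite {h::int. \<bar>of_int h - x\<bar> \<le> w}" unfolding eq by simp
  have "real (nat (\<lfloor>x + w\<rfloor> - \<lceil>x - w\<rceil> + 1)) \<le> 2 * w + 1"
    using assms by linarith
  then show "real (card {h::int. \<bar>of_int h - x\<bar> \<le> w}) \<le> 2 * w + 1" unfolding eq by simp
qed

text \<open>These are the translations \<open>h\<close> for which taking differences would destroy the coefficient to be
preserved: \<open>h v / q\<close> is close to one of at most \<open>5 \<bar>v\<bar>\<close> integers, and for each of them \<open>h\<close> lies in
an interval of length \<open>2 \<tau> q / \<bar>v\<bar>\<close>.\<close>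

lemma card_near_resonance:
  fixes v \<tau> :: real and q :: nat
  assumes v: "1 \<le> \<bar>v\<bar>" and q: "q > 0" and \<tau>: "\<tau> \<ge> 0"
  shows "real (card {h \<in> {- int q<..<int q}. norm (ee (of_int h * v / q) - 1) \<le> \<tau>}) \<le> 10 * \<tau> * q + 5 * \<bar>v\<bar>"
proof -
  define H where "H k = {h::int. \<bar>of_int h - k * q / v\<bar> \<le> \<tau> * q / \<bar>v\<bar>}" for k :: int
  define K where "K = {k::int. \<bar>of_int k - 0\<bar> \<le> \<bar>v\<bar> + 1}"
  have w: "0 \<le> \<tau> * q / \<bar>v\<bar>" using \<tau> by simp
  have finK: "finite K" and cK: "real (card K) \<le> 2 * (\<bar>v\<bar> + 1) + 1"
    unfolding K_def by (rule card_int_interval; simp)+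
  have "{h \<in> {- int q<..<int q}. norm (ee (of_int h * v / q) - 1) \<le> \<tau>} \<subseteq> (\<Union>k\<in>K. H k)"
  proof
    fix h assume "h \<in> {h \<in> {- int q<..<int q}. norm (ee (of_int h * v / q) - 1) \<le> \<tau>}"
    then have h: "\<bar>of_int h\<bar> \<le> real q" "norm (ee (of_int h * v / q) - 1) \<le> \<tau>" by auto
    obtain k :: int where k: "\<bar>of_int h * v / q - of_int k\<bar> \<le> norm (ee (of_int h * v / q) - 1) / 3"
      "\<bar>of_int h * v / q - of_int k\<bar> \<le> 1/2"
      using norm_ee_minus_1_ge by blast
    have "\<bar>of_int h * v / q - of_int k\<bar> \<le> \<tau>" 
      by (rule order_trans [OF k(1)]) (use h(2) \<tau> in simp)
    moreover have "of_int h - k * q / v = (of_int h * v / q - of_int k) * (q / v)"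
      using v q by (auto simp: field_simps)
    ultimately have "\<bar>of_int h - k * q / v\<bar> \<le> \<tau> * (q / \<bar>v\<bar>)"
      by (simp only: abs_mult abs_divide abs_of_nat) (intro mult_right_mono, auto)
    then have "h \<in> H k" by (simp add: H_def)
    moreover have "\<bar>of_int h * v / q\<bar> \<le> 1 * \<bar>v\<bar>"
      using h(1) q by (simp add: abs_mult field_simps mult_left_mono)
    then have "\<bar>of_int k - 0\<bar> \<le> \<bar>v\<bar> + 1" using k(2) by linarith
    then have "k \<in> K" by (simp add: K_def)
    ultimately show "h \<in> (\<Union>k\<in>K. H k)" by blast
  qed
  then have "card {h \<in> {- int q<..<int q}. norm (ee (of_int h * v / q) - 1) \<le> \<tau>} \<le> card (\<Union>k\<in>K. H k)"
    using finK card_int_interval(1) [OF w] by (intro card_mono finite_UN_I) (auto simp: H_def)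
  also have "\<dots> \<le> (\<Sum>k\<in>K. card (H k))" by (rule card_UN_le [OF finK])
  finally have "real (card {h \<in> {- int q<..<int q}. norm (ee (of_int h * v / q) - 1) \<le> \<tau>}) \<le> (\<Sum>k\<in>K. real (card (H k)))"
    unfolding of_nat_sum [symmetric] of_nat_le_iff .
  also have "\<dots> \<le> (\<Sum>k\<in>K. 2 * (\<tau> * q / \<bar>v\<bar>) + 1)"
    unfolding H_def using card_int_interval(2) [OF w] by (intro sum_mono)
  also have "\<dots> = real (card K) * (2 * (\<tau> * q / \<bar>v\<bar>) + 1)" by simp
  also have "\<dots> \<le> (5 * \<bar>v\<bar>) * (2 * (\<tau> * q / \<bar>v\<bar>) + 1)"
    using cK v w by (intro mult_right_mono) auto
  also have "\<dots> = 10 * \<tau> * q + 5 * \<bar>v\<bar>" using v by (auto simp: field_simps)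
  finally show ?thesis .
qed

text \<open>Averaging: the cardinalities of \<open>S \<inter> (S - h)\<close> sum up to \<open>(card S)\<^sup>2\<close>, and the excluded translations
account for at most half of this.\<close>

lemma popular_shift:
  fixes S :: "int set" and q :: nat
  assumes S: "S \<subseteq> {0..<int q}" and bad: "finite Z" "2 * card Z \<le> card S" and ne: "S \<noteq> {}"
  shows "\<exists>h\<in>{- int q<..<int q} - Z. real (card S) ^ 2 / (4 * q) \<le> card {j\<in>S. j + h \<in> S}"
proof (rule ccontr)
  assume "\<not> ?thesis"
  then have less: "real (card {j\<in>S. j + h \<in> S}) < real (card S) ^ 2 / (4 * q)" if "h \<in> {- int q<..<int q} - Z" for h
    using that by force
  have fS: "finite S" using S finite_subset by blast
  have q: "q > 0" using S ne by auto
  have cS: "card S > 0" using fS ne by (simp add: card_gt_0_iff)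
  have "card S * card S = card (S \<times> S)" by (simp add: card_cartesian_product)
  also have "S \<times> S = (\<Union>h\<in>{- int q<..<int q}. (\<lambda>j. (j, j + h)) ` {j\<in>S. j + h \<in> S})"
  proof (rule set_eqI)
    fix p :: "int \<times> int"
    obtain x y where p: "p = (x, y)" by force
    show "p \<in> S \<times> S \<longleftrightarrow> p \<in> (\<Union>h\<in>{- int q<..<int q}. (\<lambda>j. (j, j + h)) ` {j\<in>S. j + h \<in> S})"
    proof
      assume "p \<in> S \<times> S"
      then have xy: "x \<in> S" "y \<in> S" by (auto simp: p)
      then have "x \<in> {0..<int q}" "y \<in> {0..<int q}" using S by auto
      then have "y - x \<in> {- int q<..<int q}" by auto
      moreover have "p \<in> (\<lambda>j. (j, j + (y - x))) ` {j\<in>S. j + (y - x) \<in> S}"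
        using xy by (auto simp: p)
      ultimately show "p \<in> (\<Union>h\<in>{- int q<..<int q}. (\<lambda>j. (j, j + h)) ` {j\<in>S. j + h \<in> S})" by blast
    qed (auto simp: p)
  qed
  also have "card \<dots> \<le> (\<Sum>h\<in>{- int q<..<int q}. card ((\<lambda>j. (j, j + h)) ` {j\<in>S. j + h \<in> S}))"
    by (rule card_UN_le) simp
  also have "\<dots> \<le> (\<Sum>h\<in>{- int q<..<int q}. card {j\<in>S. j + h \<in> S})"
    using fS by (intro sum_mono card_image_le) auto
  finally have "real (card S) * real (card S) \<le> (\<Sum>h\<in>{- int q<..<int q}. real (card {j\<in>S. j + h \<in> S}))"
    unfolding of_nat_sum [symmetric] of_nat_mult [symmetric] of_nat_le_iff .
  also have "\<dots> \<le> (\<Sum>h\<in>{- int q<..<int q}. (if h \<in> Z then real (card S) else 0) + real (card S) ^ 2 / (4 * q))"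
  proof (rule sum_mono)
    fix h assume h: "h \<in> {- int q<..<int q}"
    have "card {j\<in>S. j + h \<in> S} \<le> card S" using fS by (intro card_mono) auto
    then have "real (card {j\<in>S. j + h \<in> S}) \<le> card S + real (card S) ^ 2 / (4 * q)"
      by (simp add: add_increasing2)
    moreover have "real (card {j\<in>S. j + h \<in> S}) \<le> 0 + real (card S) ^ 2 / (4 * q)" if "h \<notin> Z"
      using less [of h] h that by simp
    ultimately show "real (card {j\<in>S. j + h \<in> S}) \<le> (if h \<in> Z then real (card S) else 0) + real (card S) ^ 2 / (4 * q)"
      by auto
  qed
  also have "\<dots> = real (card ({- int q<..<int q} \<inter> Z)) * card S + real (2 * q - 1) * (real (card S) ^ 2 / (4 * q))"
  proof -
    have "nat (2 * int q - 1) = 2 * q - Suc 0" by linarith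
    then show ?thesis by (simp add: sum.distrib sum.If_cases)
  qed
  also have "\<dots> \<le> real (card Z) * card S + real (2 * q - 1) * (real (card S) ^ 2 / (4 * q))"
    using bad by (intro add_right_mono mult_right_mono) (auto intro: card_mono)
  also have "\<dots> < (card S / 2) * card S + 2 * q * (real (card S) ^ 2 / (4 * q))"
    using bad cS q by (intro add_le_less_mono mult_right_mono mult_strict_right_mono) auto
  also have "\<dots> = real (card S) * real (card S)" using q by (simp add: power2_eq_square)
  finally show False by simp
qed

text \<open>Induction on the number of frequencies. If the sum \<open>p\<close> is at most \<open>\<theta>\<close> on \<open>S\<close>, then
\<open>p(j + h) - e(n1 h / q) p(j)\<close> is at most \<open>2 \<theta>\<close> on \<open>S \<inter> (S - h)\<close> and does not contain the frequency
\<open>n1\<close>. For a popular and non-resonant \<open>h\<close> the density drops from \<open>\<mu>\<close> to \<open>\<mu>\<^sup>2 / 4\<close> only, and the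
coefficient at \<open>n0\<close> shrinks by a factor \<open>\<mu> / 40\<close> at worst. Squaring the density in every step
is the reason for the exponent \<open>2 ^ r\<close>.\<close>

lemma discrete_sublevel:
  fixes G :: "real set" and b :: "real \<Rightarrow> complex" and q :: nat and S :: "int set" and \<mu> D \<theta> :: real
  assumes "finite G" "n0 \<in> G" "card G \<le> Suc r"
    and "\<And>n. n \<in> G \<Longrightarrow> n \<noteq> n0 \<Longrightarrow> 1 \<le> \<bar>n - n0\<bar> \<and> \<bar>n - n0\<bar> \<le> D"
    and "0 < \<mu>" "\<mu> \<le> 1" "D \<le> (\<mu> / 40) ^ (2 ^ r) * q"
    and "q > 0" "S \<subseteq> {0..<int q}" "\<mu> * q \<le> card S"
    and "\<And>j. j \<in> S \<Longrightarrow> norm (\<Sum>n\<in>G. b n * ee (n * of_int j / q)) \<le> \<theta>"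
  shows "norm (b n0) * (\<mu> / 40) ^ (2 ^ r - 1) \<le> 2 ^ r * \<theta>"
  using assms
proof (induction r arbitrary: G b S \<mu> \<theta>)
  case 0
  have G: "G = {n0}"
    using 0(1,2,3) by (metis One_nat_def card_1_singletonE card_gt_0_iff empty_iff le_SucE le_zero_eq less_nat_zero_code singletonD)
  have "card S > 0" using 0 by (metis gr0I mult_pos_pos not_less of_nat_0 of_nat_0_less_iff)
  then obtain j where "j \<in> S" by (metis card.empty equals0I less_irrefl)
  then show ?case using 0(11) [of j] by (simp add: G norm_mult)
next
  case (Suc r)
  note fG = Suc.prems(1) and n0 = Suc.prems(2) and gap = Suc.prems(4) and \<mu> = Suc.prems(5,6) and D = Suc.prems(7)
    and q = Suc.prems(8) and S = Suc.prems(9,10) and small = Suc.prems(11)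
  define \<mu>' where "\<mu>' = \<mu>\<^sup>2 / 4"
  have \<mu>': "0 < \<mu>'" "\<mu>' \<le> 1" using \<mu> by (auto simp: \<mu>'_def intro: order_trans [OF power_le_one])
  have \<mu>40: "(\<mu> / 40)\<^sup>2 \<le> \<mu>' / 40" by (simp add: \<mu>'_def power2_eq_square)
  have cS: "card S > 0" using \<mu> q S by (metis gr0I mult_pos_pos not_less of_nat_0 of_nat_0_less_iff)
  then have Sne: "S \<noteq> {}" by auto
  have pos: "0 < \<mu> / 40" using \<mu> by simp
  show ?case
  proof (cases "G = {n0}")
    case True
    obtain j where "j \<in> S" using Sne by blast
    then have bn: "norm (b n0) \<le> \<theta>" using small [of j] by (simp add: True norm_mult)
    have "norm (b n0) * (\<mu> / 40) ^ (2 ^ Suc r - 1) \<le> norm (b n0) * 1"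
      using \<mu> by (intro mult_left_mono power_le_one) auto
    also have "\<dots> \<le> 1 * \<theta>" using bn by simp
    also have "\<dots> \<le> 2 ^ Suc r * \<theta>" using order_trans [OF norm_ge_zero bn] one_le_power [of "2::real" "Suc r"]
      by (intro mult_right_mono) auto
    finally show ?thesis .
  next
    case False
    then obtain n1 where n1: "n1 \<in> G" "n1 \<noteq> n0" using n0 by blast
    define v where "v = n0 - n1"
    have v: "1 \<le> \<bar>v\<bar>" "\<bar>v\<bar> \<le> D" using gap [OF n1] by (auto simp: v_def)
    define Z where "Z = {h \<in> {- int q<..<int q}. norm (ee (of_int h * v / q) - 1) \<le> \<mu> / 40}"
    have "real (card Z) \<le> 10 * (\<mu> / 40) * q + 5 * \<bar>v\<bar>"
      unfolding Z_def using v q \<mu> by (intro card_near_resonance) auto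
    also have "\<bar>v\<bar> \<le> (\<mu> / 40) * q"
    proof -
      have "(\<mu> / 40) ^ (2 ^ Suc r) \<le> (\<mu> / 40) ^ 1" using \<mu> by (intro power_decreasing) auto
      then have "(\<mu> / 40) ^ (2 ^ Suc r) * q \<le> (\<mu> / 40) * q" by (intro mult_right_mono) auto
      then show ?thesis using v D by linarith
    qed
    finally have "real (card Z) \<le> \<mu> * q / 2" using \<mu> by simp
    then have cZ: "2 * card Z \<le> card S" using S(2) by linarith
    have fZ: "finite Z" unfolding Z_def by (rule finite_subset [of _ "{- int q<..<int q}"]) auto
    then obtain h where h: "h \<in> {- int q<..<int q}" "h \<notin> Z" "real (card S) ^ 2 / (4 * q) \<le> card {j\<in>S. j + h \<in> S}"
      using popular_shift [OF S(1) fZ cZ Sne] by blast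
    define S' where "S' = {j\<in>S. j + h \<in> S}"
    define b' where "b' n = b n * (ee (n * of_int h / q) - ee (n1 * of_int h / q))" for n
    have b'0: "norm (b n0) * (\<mu> / 40) \<le> norm (b' n0)"
    proof -
      have "n0 * of_int h / q = n1 * of_int h / q + of_int h * v / q" by (simp add: v_def algebra_simps diff_divide_distrib)
      then have "ee (n0 * of_int h / q) - ee (n1 * of_int h / q) = ee (n1 * of_int h / q) * (ee (of_int h * v / q) - 1)"
        by (simp add: ee_add algebra_simps)
      then have "norm (b' n0) = norm (b n0) * norm (ee (of_int h * v / q) - 1)"
        by (simp add: b'_def norm_mult)
      moreover have "\<mu> / 40 \<le> norm (ee (of_int h * v / q) - 1)" using h unfolding Z_def by auto
      ultimately show ?thesis by (simp only:) (intro mult_left_mono, auto)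
    qed
    have "norm (b' n0) * (\<mu>' / 40) ^ (2 ^ r - 1) \<le> 2 ^ r * (2 * \<theta>)"
    proof (rule Suc.IH [where G = "G - {n1}" and S = S'])
      show "finite (G - {n1})" "n0 \<in> G - {n1}" using fG n0 n1 by auto
      show "card (G - {n1}) \<le> Suc r" using Suc.prems(3) fG n1 by simp
      show "1 \<le> \<bar>n - n0\<bar> \<and> \<bar>n - n0\<bar> \<le> D" if "n \<in> G - {n1}" "n \<noteq> n0" for n using gap that by auto
      have "(\<mu> / 40) ^ (2 ^ Suc r) = ((\<mu> / 40)\<^sup>2) ^ (2 ^ r)" by (simp add: power_mult [symmetric])
      also have "\<dots> \<le> (\<mu>' / 40) ^ (2 ^ r)" using \<mu>40 by (intro power_mono) auto
      finally show "D \<le> (\<mu>' / 40) ^ (2 ^ r) * q"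
        using D by (meson mult_right_mono of_nat_0_le_iff order_trans)
      show "S' \<subseteq> {0..<int q}" using S by (auto simp: S'_def)
      have "(\<mu> * q)\<^sup>2 \<le> (real (card S))\<^sup>2" using S \<mu> by (intro power_mono) auto
      then have "(\<mu> * q)\<^sup>2 / (4 * q) \<le> (real (card S))\<^sup>2 / (4 * q)" by (intro divide_right_mono) auto
      then have "(\<mu> * q)\<^sup>2 / (4 * q) \<le> card S'" using h(3) unfolding S'_def by linarith
      moreover have "(\<mu> * q)\<^sup>2 / (4 * q) = \<mu>' * q" using q by (simp add: \<mu>'_def power2_eq_square)
      ultimately show "\<mu>' * q \<le> card S'" by simp
      fix j assume j: "j \<in> S'"
      have "(\<Sum>n\<in>G - {n1}. b' n * ee (n * of_int j / q)) = (\<Sum>n\<in>G. b' n * ee (n * of_int j / q))"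
        using fG n1 by (simp add: sum.remove [of G n1] b'_def)
      also have "\<dots> = (\<Sum>n\<in>G. b n * ee (n * of_int (j + h) / q) - ee (n1 * of_int h / q) * (b n * ee (n * of_int j / q)))"
      proof (intro sum.cong refl)
        fix n
        have "ee (n * of_int (j + h) / q) = ee (n * of_int j / q) * ee (n * of_int h / q)"
          by (simp add: ee_add [symmetric] distrib_left add_divide_distrib)
        then show "b' n * ee (n * of_int j / q) =
            b n * ee (n * of_int (j + h) / q) - ee (n1 * of_int h / q) * (b n * ee (n * of_int j / q))"
          by (simp add: b'_def algebra_simps)
      qed
      also have "\<dots> = (\<Sum>n\<in>G. b n * ee (n * of_int (j + h) / q)) - ee (n1 * of_int h / q) * (\<Sum>n\<in>G. b n * ee (n * of_int j / q))"
        by (simp add: sum_subtractf sum_distrib_left)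
      finally have "norm (\<Sum>n\<in>G - {n1}. b' n * ee (n * of_int j / q)) \<le>
          norm (\<Sum>n\<in>G. b n * ee (n * of_int (j + h) / q)) + norm (ee (n1 * of_int h / q) * (\<Sum>n\<in>G. b n * ee (n * of_int j / q)))"
        by (simp only: norm_triangle_ineq4)
      also have "\<dots> \<le> \<theta> + \<theta>"
        using j small [of "j + h"] small [of j] by (intro add_mono) (auto simp: S'_def norm_mult)
      finally show "norm (\<Sum>n\<in>G - {n1}. b' n * ee (n * of_int j / q)) \<le> 2 * \<theta>" by simp
    qed (use \<mu>' q in auto)
    moreover have "norm (b n0) * (\<mu> / 40) ^ (2 ^ Suc r - 1) \<le> norm (b' n0) * (\<mu>' / 40) ^ (2 ^ r - 1)"
    proof -
      have "(2::nat) ^ Suc r - 1 = 1 + 2 * (2 ^ r - 1)"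
      proof -
        obtain m where "(2::nat) ^ r = Suc m"
          by (metis not0_implies_Suc power_not_zero zero_neq_numeral)
        then show ?thesis by simp
      qed
      then have "(\<mu> / 40) ^ (2 ^ Suc r - 1) = (\<mu> / 40) * ((\<mu> / 40)\<^sup>2) ^ (2 ^ r - 1)"
        by (simp add: power_add power_mult)
      then have "norm (b n0) * (\<mu> / 40) ^ (2 ^ Suc r - 1) = (norm (b n0) * (\<mu> / 40)) * ((\<mu> / 40)\<^sup>2) ^ (2 ^ r - 1)"
        by simp
      also have "\<dots> \<le> norm (b' n0) * (\<mu>' / 40) ^ (2 ^ r - 1)"
        using b'0 \<mu>40 pos by (intro mult_mono power_mono) auto
      finally show ?thesis .
    qed
    ultimately show ?thesis by simp
  qed
qed

section \<open>Real zeros of exponential sums\<close>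

text \<open>The new zeros are kept strictly below \<open>Max Z\<close>, so that in the induction the one found between the
last two elements of \<open>Z\<close> is different from the others.\<close>

lemma rolle_card:
  fixes f f' :: "real \<Rightarrow> real"
  assumes d: "\<And>x. x \<in> {a..b} \<Longrightarrow> (f has_real_derivative f' x) (at x)"
    and Z: "finite Z" "Z \<subseteq> {a..b}" "card Z = Suc n" "\<And>x. x \<in> Z \<Longrightarrow> f x = 0"
  shows "\<exists>W. finite W \<and> card W = n \<and> W \<subseteq> {a..<Max Z} \<and> (\<forall>x\<in>W. f' x = 0)"
  using Z
proof (induction n arbitrary: Z)
  case 0
  then show ?case by (intro exI [of _ "{}"]) auto
next
  case (Suc n)
  define M where "M = Max Z"
  have Zne: "Z \<noteq> {}" using Suc.prems by auto
  have M: "M \<in> Z" using Suc.prems Zne by (simp add: M_def)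
  define Z0 where "Z0 = Z - {M}"
  have Z0: "finite Z0" "Z0 \<subseteq> {a..b}" "card Z0 = Suc n" "\<And>x. x \<in> Z0 \<Longrightarrow> f x = 0"
    using Suc.prems M by (auto simp: Z0_def)
  obtain W where W: "finite W" "card W = n" "W \<subseteq> {a..<Max Z0}" "\<forall>x\<in>W. f' x = 0"
    using Suc.IH [OF Z0] by blast
  have Z0ne: "Z0 \<noteq> {}" using Z0 by auto
  have M0: "Max Z0 \<in> Z0" using Z0 Z0ne by simp
  have less: "Max Z0 < M"
  proof -
    have "Max Z0 \<noteq> M" using M0 by (auto simp: Z0_def)
    moreover have "Max Z0 \<le> M" using M0 Suc.prems by (auto simp: Z0_def M_def)
    ultimately show ?thesis by simp
  qed
  have ab: "a \<le> Max Z0" "M \<le> b" using M0 Z0 M Suc.prems by auto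
  have "\<exists>z>Max Z0. z < M \<and> f M - f (Max Z0) = (M - Max Z0) * f' z"
    using less ab by (intro MVT2 d) auto
  then obtain z where z: "Max Z0 < z" "z < M" "f' z = 0"
    using Suc.prems(4) [OF M] Z0(4) [OF M0] less by auto
  have "z \<notin> W" using W(3) z by auto
  then show ?case
    using W z ab less by (intro exI [of _ "insert z W"]) (auto simp: M_def [symmetric])
qed

text \<open>Rolle's theorem for \<open>D\<^sup>2 + \<omega>\<^sup>2\<close>. With \<open>C\<close> the cosine of frequency \<open>\<omega>\<close> centred at the midpoint,
which is positive on an interval shorter than half a period, the operator factors as
\<open>(1 / C) D C\<^sup>2 D (1 / C)\<close>, and each of the two derivatives loses one zero.\<close>

lemma oscillator_zeros:
  fixes g g' g'' :: "real \<Rightarrow> real"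
  assumes ab: "a \<le> b" and \<omega>: "\<omega> \<ge> 0" "\<omega> * (b - a) < pi"
    and d: "\<And>x. (g has_real_derivative g' x) (at x)"
    and d': "\<And>x. (g' has_real_derivative g'' x) (at x)"
    and Z: "finite Z" "Z \<subseteq> {a..b}" "card Z = n + 2" "\<And>x. x \<in> Z \<Longrightarrow> g x = 0"
  shows "\<exists>W. finite W \<and> card W = n \<and> W \<subseteq> {a..b} \<and> (\<forall>x\<in>W. g'' x + \<omega>\<^sup>2 * g x = 0)"
proof -
  define c where "c = (a + b) / 2"
  define C where "C x = cos (\<omega> * (x - c))" for x
  define S where "S x = sin (\<omega> * (x - c))" for x
  have C: "C x > 0" if "x \<in> {a..b}" for x
  proof -
    have "\<bar>x - c\<bar> \<le> (b - a) / 2" using that by (auto simp: c_def abs_le_iff field_simps)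
    then have "\<omega> * \<bar>x - c\<bar> \<le> \<omega> * ((b - a) / 2)" using \<omega> by (intro mult_left_mono)
    then have "\<bar>\<omega> * (x - c)\<bar> < pi / 2" using \<omega> by (simp add: abs_mult)
    then show ?thesis unfolding C_def by (intro cos_gt_zero_pi) auto
  qed
  have dC: "(C has_real_derivative - \<omega> * S x) (at x)" "(S has_real_derivative \<omega> * C x) (at x)" for x
    unfolding C_def [abs_def] S_def [abs_def] by (auto intro!: derivative_eq_intros)
  define h where "h x = g' x * C x + \<omega> * g x * S x" for x
  have 1: "((\<lambda>x. g x / C x) has_real_derivative h x / (C x)\<^sup>2) (at x)" if "x \<in> {a..b}" for x
    using C [OF that] by (auto intro!: derivative_eq_intros d dC simp: h_def power2_eq_square)
  have "\<exists>W. finite W \<and> card W = Suc n \<and> W \<subseteq> {a..<Max Z} \<and> (\<forall>x\<in>W. h x / (C x)\<^sup>2 = 0)"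
    using Z by (intro rolle_card [OF 1]) auto
  then obtain W where W: "finite W" "card W = Suc n" "W \<subseteq> {a..<Max Z}" "\<And>x. x \<in> W \<Longrightarrow> h x / (C x)\<^sup>2 = 0" by blast
  have "Z \<noteq> {}" using Z by auto
  then have "Max Z \<in> {a..b}" using Z Max_in by blast
  then have Wab: "W \<subseteq> {a..b}" using W(3) by auto
  have h0: "h x = 0" if "x \<in> W" for x
    using W(4) [OF that] C [of x] Wab that by auto
  have 2: "(h has_real_derivative (g'' x + \<omega>\<^sup>2 * g x) * C x) (at x)" for x
    unfolding h_def [abs_def]
    by (auto intro!: derivative_eq_intros d d' dC simp: power2_eq_square algebra_simps)
  have "\<exists>V. finite V \<and> card V = n \<and> V \<subseteq> {a..<Max W} \<and> (\<forall>x\<in>V. (g'' x + \<omega>\<^sup>2 * g x) * C x = 0)"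
    using W Wab h0 by (intro rolle_card [OF 2]) auto
  then obtain V where V: "finite V" "card V = n" "V \<subseteq> {a..<Max W}" "\<And>x. x \<in> V \<Longrightarrow> (g'' x + \<omega>\<^sup>2 * g x) * C x = 0" by blast
  have "W \<noteq> {}" using W by auto
  then have "Max W \<in> {a..b}" using W Wab Max_in by blast
  then have "V \<subseteq> {a..b}" using V(3) by auto
  then show ?thesis using V C by (intro exI [of _ V]) fastforce
qed

text \<open>Applying \<open>D\<^sup>2 + w\<^sup>2\<close> removes the frequency \<open>w\<close>, multiplies the other coefficients by the nonzero factors
\<open>w\<^sup>2 - \<omega>\<^sup>2\<close>, and loses two zeros. Once all other frequencies are known to be absent, two zeros within
less than half a period suffice for the last one.\<close>

lemma real_trig_zeros:
  fixes K :: "real set" and A B :: "real \<Rightarrow> real"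
  assumes "finite K" "\<And>\<omega>. \<omega> \<in> K \<Longrightarrow> 0 \<le> \<omega> \<and> \<omega> * (b - a) < pi" "a \<le> b"
    and "finite Z" "Z \<subseteq> {a..b}" "card Z = 2 * card K"
    and "\<And>y. y \<in> Z \<Longrightarrow> (\<Sum>\<omega>\<in>K. A \<omega> * cos (\<omega> * y) + B \<omega> * sin (\<omega> * y)) = 0"
  shows "\<forall>\<omega>\<in>K. A \<omega> = 0 \<and> (\<omega> \<noteq> 0 \<longrightarrow> B \<omega> = 0)"
  using assms
proof (induction K arbitrary: A B Z rule: finite_induct)
  case empty
  then show ?case by simp
next
  case (insert w K)
  have w: "0 \<le> w" "w * (b - a) < pi" using insert.prems(1) by auto
  define g where "g y = (\<Sum>\<omega>\<in>insert w K. A \<omega> * cos (\<omega> * y) + B \<omega> * sin (\<omega> * y))" for y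
  define g' where "g' y = (\<Sum>\<omega>\<in>insert w K. \<omega> * (B \<omega> * cos (\<omega> * y) - A \<omega> * sin (\<omega> * y)))" for y
  define g'' where "g'' y = (\<Sum>\<omega>\<in>insert w K. - \<omega>\<^sup>2 * (A \<omega> * cos (\<omega> * y) + B \<omega> * sin (\<omega> * y)))" for y
  have d: "(g has_real_derivative g' y) (at y)" for y
    unfolding g_def [abs_def] g'_def by (intro DERIV_sum) (auto intro!: derivative_eq_intros simp: algebra_simps)
  have d': "(g' has_real_derivative g'' y) (at y)" for y
    unfolding g'_def [abs_def] g''_def
    by (intro DERIV_sum) (auto intro!: derivative_eq_intros simp: algebra_simps power2_eq_square)
  have eq: "g'' y + w\<^sup>2 * g y = (\<Sum>\<omega>\<in>K. ((w\<^sup>2 - \<omega>\<^sup>2) * A \<omega>) * cos (\<omega> * y) + ((w\<^sup>2 - \<omega>\<^sup>2) * B \<omega>) * sin (\<omega> * y))" for y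
    using insert.hyps unfolding g_def g''_def
    by (simp add: sum_distrib_left sum.distrib [symmetric] algebra_simps)
  have "\<exists>W. finite W \<and> card W = 2 * card K \<and> W \<subseteq> {a..b} \<and> (\<forall>x\<in>W. g'' x + w\<^sup>2 * g x = 0)"
    using insert.prems insert.hyps by (intro oscillator_zeros [OF _ w d d', of Z]) (auto simp: g_def)
  then obtain W where W: "finite W" "W \<subseteq> {a..b}" "card W = 2 * card K" "\<And>x. x \<in> W \<Longrightarrow> g'' x + w\<^sup>2 * g x = 0"
    by blast
  have "\<forall>\<omega>\<in>K. (w\<^sup>2 - \<omega>\<^sup>2) * A \<omega> = 0 \<and> (\<omega> \<noteq> 0 \<longrightarrow> (w\<^sup>2 - \<omega>\<^sup>2) * B \<omega> = 0)"
    using insert.prems W unfolding eq by (intro insert.IH) auto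
  moreover have "w\<^sup>2 - \<omega>\<^sup>2 \<noteq> 0" if "\<omega> \<in> K" for \<omega>
    using that insert.hyps insert.prems(1) w(1) by (auto simp: power2_eq_iff_nonneg)
  ultimately have K0: "\<forall>\<omega>\<in>K. A \<omega> = 0 \<and> (\<omega> \<noteq> 0 \<longrightarrow> B \<omega> = 0)" by auto
  then have "(\<Sum>\<omega>\<in>K. A \<omega> * cos (\<omega> * y) + B \<omega> * sin (\<omega> * y)) = 0" for y
    by (intro sum.neutral) force
  then have g: "g y = A w * cos (w * y) + B w * sin (w * y)" for y
    using insert.hyps by (simp add: g_def)
  have "2 \<le> card Z" using insert.prems insert.hyps by simp
  then obtain y1 y2 where y: "y1 \<in> Z" "y2 \<in> Z" "y1 < y2"
    by (metis (no_types, lifting) card_2_iff' ex_card linorder_neqE subsetD)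
  have e1: "A w * cos (w * y1) + B w * sin (w * y1) = 0" and e2: "A w * cos (w * y2) + B w * sin (w * y2) = 0"
    using insert.prems(6) [folded g_def] y g [of y1] g [of y2] by simp_all
  have "A w = 0 \<and> (w \<noteq> 0 \<longrightarrow> B w = 0)"
  proof (cases "w = 0")
    case True
    then show ?thesis using e1 by simp
  next
    case False
    have "y1 \<in> {a..b}" "y2 \<in> {a..b}" using y insert.prems(4) by blast+
    then have "y2 - y1 \<le> b - a" by simp
    then have "w * (y2 - y1) \<le> w * (b - a)" using w by (intro mult_left_mono)
    then have "w * (y2 - y1) < pi" using w(2) by linarith
    then have "sin (w * (y2 - y1)) > 0" using w False y by (intro sin_gt_zero) auto
    then have s: "sin (w * y2) * cos (w * y1) - cos (w * y2) * sin (w * y1) \<noteq> 0"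
      by (simp add: right_diff_distrib sin_diff)
    have "B w * (sin (w * y2) * cos (w * y1) - cos (w * y2) * sin (w * y1)) = 0"
      "A w * (sin (w * y2) * cos (w * y1) - cos (w * y2) * sin (w * y1)) = 0"
      using e1 e2 by algebra+
    then show ?thesis using s by simp
  qed
  then show ?case using K0 by simp
qed

text \<open>At a zero both the real and the imaginary part vanish, and each is a real trigonometric sum in which
the frequencies \<open>n\<close> and \<open>- n\<close> are merged. The two together determine the complex coefficients.\<close>

lemma exp_sum_zeros:
  fixes G :: "real set" and c :: "real \<Rightarrow> complex"
  assumes G: "finite G" "\<And>n. n \<in> G \<Longrightarrow> 2 * \<bar>n\<bar> * (b - a) < 1" and ab: "a \<le> b"
    and Z: "finite Z" "Z \<subseteq> {a..b}" "2 * card G \<le> card Z"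
    and zero: "\<And>y. y \<in> Z \<Longrightarrow> (\<Sum>n\<in>G. c n * ee (n * y)) = 0"
    and n: "n \<in> G"
  shows "c n = 0"
proof -
  define K where "K = (\<lambda>n. 2 * pi * \<bar>n\<bar>) ` G"
  have K: "finite K" "card K \<le> card G" using G by (auto simp: K_def card_image_le)
  obtain Z' where Z': "Z' \<subseteq> Z" "card Z' = 2 * card K"
    using Z K by (metis obtain_subset_with_card_n mult_le_mono2 order_trans)
  have fZ': "finite Z'" using Z' Z finite_subset by blast
  have Kb: "0 \<le> \<omega> \<and> \<omega> * (b - a) < pi" if "\<omega> \<in> K" for \<omega>
  proof -
    obtain n where n: "n \<in> G" "\<omega> = 2 * pi * \<bar>n\<bar>" using \<open>\<omega> \<in> K\<close> unfolding K_def by blast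
    have "\<omega> * (b - a) = pi * (2 * \<bar>n\<bar> * (b - a))" using n by simp
    also have "\<dots> < pi * 1" using G(2) [OF n(1)] by (intro mult_strict_left_mono) auto
    finally show ?thesis using n by simp
  qed
  define E where "E \<omega> = {n\<in>G. 2 * pi * \<bar>n\<bar> = \<omega>}" for \<omega>
  have main: "(\<Sum>m\<in>E (2*pi*\<bar>n\<bar>). Re (u * c m)) = 0 \<and>
      (n \<noteq> 0 \<longrightarrow> (\<Sum>m\<in>E (2*pi*\<bar>n\<bar>). - sgn m * Im (u * c m)) = 0)" for u :: complex
  proof -
    have "\<forall>\<omega>\<in>K. (\<Sum>m\<in>E \<omega>. Re (u * c m)) = 0 \<and> (\<omega> \<noteq> 0 \<longrightarrow> (\<Sum>m\<in>E \<omega>. - sgn m * Im (u * c m)) = 0)"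
    proof (rule real_trig_zeros [OF K(1) Kb ab fZ' _ Z'(2)])
      fix y assume y: "y \<in> Z'"
      have "(\<Sum>n\<in>G. c n * ee (n * y)) = 0" using zero y Z' by blast
      then have "0 = Re (u * (\<Sum>n\<in>G. c n * ee (n * y)))" by (simp only:) simp
      also have "\<dots> = (\<Sum>n\<in>G. Re ((u * c n) * ee (n * y)))"
        by (simp add: sum_distrib_left mult.assoc)
      also have "\<dots> = (\<Sum>\<omega>\<in>K. \<Sum>m\<in>E \<omega>. Re ((u * c m) * ee (m * y)))"
        unfolding K_def E_def by (rule sum.image_gen [OF G(1)])
      also have "\<dots> = (\<Sum>\<omega>\<in>K. (\<Sum>m\<in>E \<omega>. Re (u * c m)) * cos (\<omega> * y) + (\<Sum>m\<in>E \<omega>. - sgn m * Im (u * c m)) * sin (\<omega> * y))"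
      proof (intro sum.cong refl)
        fix \<omega>
        have "Re ((u * c m) * ee (m * y)) = Re (u * c m) * cos (\<omega> * y) + (- sgn m * Im (u * c m)) * sin (\<omega> * y)" if "m \<in> E \<omega>" for m
        proof -
          have "cos (2 * pi * (m * y)) = cos (\<omega> * y)" "sin (2 * pi * (m * y)) = sgn m * sin (\<omega> * y)"
            using that by (cases m "0::real" rule: linorder_cases; auto simp: E_def mult.assoc)+
          then show ?thesis by (simp only: times_complex.sel Re_ee Im_ee) simp
        qed
        then have "(\<Sum>m\<in>E \<omega>. Re ((u * c m) * ee (m * y))) =
           (\<Sum>m\<in>E \<omega>. Re (u * c m) * cos (\<omega> * y) + (- sgn m * Im (u * c m)) * sin (\<omega> * y))"
          by (intro sum.cong) auto
        then show "(\<Sum>m\<in>E \<omega>. Re ((u * c m) * ee (m * y))) =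
           (\<Sum>m\<in>E \<omega>. Re (u * c m)) * cos (\<omega> * y) + (\<Sum>m\<in>E \<omega>. - sgn m * Im (u * c m)) * sin (\<omega> * y)"
          by (simp only: sum.distrib sum_distrib_right)
      qed
      finally show "(\<Sum>\<omega>\<in>K. (\<Sum>m\<in>E \<omega>. Re (u * c m)) * cos (\<omega> * y) + (\<Sum>m\<in>E \<omega>. - sgn m * Im (u * c m)) * sin (\<omega> * y)) = 0"
        by simp
    qed (use Z Z' in auto)
    moreover have "2 * pi * \<bar>n\<bar> \<in> K" using n by (simp add: K_def)
    ultimately show ?thesis by fastforce
  qed
  have r: "(\<Sum>m\<in>E (2*pi*\<bar>n\<bar>). Re (c m)) = 0" "(\<Sum>m\<in>E (2*pi*\<bar>n\<bar>). Im (c m)) = 0"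
    "n \<noteq> 0 \<longrightarrow> (\<Sum>m\<in>E (2*pi*\<bar>n\<bar>). sgn m * Im (c m)) = 0" "n \<noteq> 0 \<longrightarrow> (\<Sum>m\<in>E (2*pi*\<bar>n\<bar>). sgn m * Re (c m)) = 0"
    using main [of 1] main [of \<i>] by (simp_all add: sum_negf)
  show ?thesis
  proof (cases "n = 0 \<or> - n \<notin> G")
    case True
    then have "E (2*pi*\<bar>n\<bar>) = {n}" using n by (auto simp: E_def abs_eq_iff)
    then show ?thesis using r by (simp add: complex_eq_iff)
  next
    case False
    then have "E (2*pi*\<bar>n\<bar>) = {n, - n}" "n \<noteq> - n" "sgn n = 1 \<or> sgn n = -1" using n
      by (auto simp: E_def abs_eq_iff sgn_if)
    then show ?thesis using r False by (auto simp: complex_eq_iff)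
  qed
qed

section \<open>Lattice points on circles\<close>

lemma int_lattice_add: "x \<in> int_lattice \<Longrightarrow> y \<in> int_lattice \<Longrightarrow> x + y \<in> int_lattice"
  and int_lattice_diff: "x \<in> int_lattice \<Longrightarrow> y \<in> int_lattice \<Longrightarrow> x - y \<in> int_lattice"
  and int_lattice_uminus: "x \<in> int_lattice \<Longrightarrow> - x \<in> int_lattice"
  by (auto simp: int_lattice_def)

lemma lattice_circleD:
  assumes "\<xi> \<in> lattice_circle E"
  shows "\<xi> \<in> int_lattice" "\<xi> $ k \<in> \<int>" "(norm \<xi>)\<^sup>2 = E"
  using assms by (auto simp: lattice_circle_def int_lattice_def)

lemma norm_sq_2: "(norm x)\<^sup>2 = (x$1)\<^sup>2 + (x$2)\<^sup>2" for x :: "real^2"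
  unfolding power2_norm_eq_inner by (simp add: inner_vec_def sum_2 power2_eq_square)

lemma finite_lattice_circle: "finite (lattice_circle E)"
proof -
  define m where "m = \<lceil>E\<rceil>"
  have "lattice_circle E \<subseteq> (\<lambda>(k, l). vector [of_int k, of_int l]) ` ({- m..m} \<times> {- m..m})"
  proof
    fix \<xi> assume \<xi>: "\<xi> \<in> lattice_circle E"
    obtain k l :: int where kl: "\<xi>$1 = of_int k" "\<xi>$2 = of_int l"
      using lattice_circleD(2) [OF \<xi>] by (metis Ints_cases)
    have E: "of_int (k\<^sup>2 + l\<^sup>2) = E" using lattice_circleD(3) [OF \<xi>] by (simp add: norm_sq_2 kl)
    have "\<bar>z\<bar> \<le> z\<^sup>2" for z :: int
      using mult_left_mono [of 1 "\<bar>z\<bar>" "\<bar>z\<bar>"] by (cases "z = 0") (auto simp: power2_eq_square)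
    from this [of k] this [of l] have "\<bar>k\<bar> \<le> k\<^sup>2 + l\<^sup>2" "\<bar>l\<bar> \<le> k\<^sup>2 + l\<^sup>2" by (smt (verit) zero_le_power2)+
    moreover have "k\<^sup>2 + l\<^sup>2 \<le> m" unfolding m_def using E by (metis ceiling_of_int order_refl)
    ultimately have "k \<in> {- m..m}" "l \<in> {- m..m}" by auto
    moreover have "\<xi> = vector [of_int k, of_int l]" by (simp add: vec_eq_iff forall_2 kl)
    ultimately show "\<xi> \<in> (\<lambda>(k, l). vector [of_int k, of_int l]) ` ({- m..m} \<times> {- m..m})" by force
  qed
  then show ?thesis by (rule finite_subset) simp
qed

lemma circle_point:
  assumes "(norm (\<xi> :: real^2))\<^sup>2 = r\<^sup>2" "r > 0"
  obtains \<theta> where "0 \<le> \<theta>" "\<theta> < 2 * pi" "\<xi> = vector [r * cos \<theta>, r * sin \<theta>]"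
proof -
  have "(\<xi>$1 / r)\<^sup>2 + (\<xi>$2 / r)\<^sup>2 = 1"
    using assms by (simp add: norm_sq_2 power_divide add_divide_distrib [symmetric])
  then obtain \<theta> where "0 \<le> \<theta>" "\<theta> < 2 * pi" "\<xi>$1 / r = cos \<theta>" "\<xi>$2 / r = sin \<theta>"
    using sincos_total_2pi by metis
  then show ?thesis
    using assms(2) by (intro that [of \<theta>]) (auto simp: vec_eq_iff forall_2 field_simps)
qed

lemma circle_arc_lattice_subset:
  assumes "r > 0" shows "circle_arc r s t \<inter> int_lattice \<subseteq> lattice_circle (r\<^sup>2)"
proof -
  have "(r * cos \<theta>)\<^sup>2 + (r * sin \<theta>)\<^sup>2 = r\<^sup>2" for \<theta>
  proof -
    have "(r * cos \<theta>)\<^sup>2 + (r * sin \<theta>)\<^sup>2 = r\<^sup>2 * ((cos \<theta>)\<^sup>2 + (sin \<theta>)\<^sup>2)"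
      by (simp only: power_mult_distrib distrib_left)
    then show ?thesis by simp
  qed
  then have "(norm (vector [r * cos \<theta>, r * sin \<theta>] :: real^2))\<^sup>2 = r\<^sup>2" for \<theta>
    by (simp only: norm_sq_2 vector_2)
  then show ?thesis unfolding circle_arc_def lattice_circle_def by blast
qed

lemma cg_arc:
  assumes cg: cilleruelo_granville and e: "0 < e" "e < 1"
  obtains B :: real where "B > 0"
    "\<And>r s t. 0 < r \<Longrightarrow> r\<^sup>2 \<in> \<int> \<Longrightarrow> s \<le> t \<Longrightarrow> r * (t - s) < r powr (1 - e) \<Longrightarrow>
      real (card (circle_arc r s t \<inter> int_lattice)) \<le> B"
proof -
  from cg [unfolded cilleruelo_granville_def, rule_format, OF conjI [OF e]]
  show ?thesis by (elim exE conjE) (rule that, assumption, simp)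
qed

text \<open>The circle is covered by \<open>O(r powr e)\<close> arcs to which the conjecture applies.\<close>

lemma cg_total:
  assumes cg: cilleruelo_granville and e: "0 < e" "e < 1"
  shows "\<exists>C>0. \<forall>r\<ge>1. r\<^sup>2 \<in> \<int> \<longrightarrow> real (card (lattice_circle (r\<^sup>2))) \<le> C * r powr e"
proof -
  obtain B where B: "B > 0" "\<And>r s t. 0 < r \<Longrightarrow> r\<^sup>2 \<in> \<int> \<Longrightarrow> s \<le> t \<Longrightarrow> r * (t - s) < r powr (1 - e) \<Longrightarrow>
      real (card (circle_arc r s t \<inter> int_lattice)) \<le> B"
    using cg_arc [OF cg e] by metis
  have "real (card (lattice_circle (r\<^sup>2))) \<le> (8 * B) * r powr e" if r: "r \<ge> 1" "r\<^sup>2 \<in> \<int>" for r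
  proof -
    define K where "K = nat \<lfloor>2 * pi * r powr e\<rfloor> + 1"
    have rp: "1 \<le> r powr e" using r e by (simp add: ge_one_powr_ge_zero)
    have K: "2 * pi * r powr e < K" "K \<le> 2 * pi * r powr e + 1" "0 < K"
      unfolding K_def by (linarith | (simp, linarith))+
    define I where "I k = circle_arc r (2 * pi * real k / K) (2 * pi * real (Suc k) / K) \<inter> int_lattice" for k
    have "lattice_circle (r\<^sup>2) \<subseteq> (\<Union>k<K. I k)"
    proof
      fix \<xi> assume \<xi>: "\<xi> \<in> lattice_circle (r\<^sup>2)"
      obtain \<theta> where \<theta>: "0 \<le> \<theta>" "\<theta> < 2 * pi" "\<xi> = vector [r * cos \<theta>, r * sin \<theta>]"
        using circle_point [of \<xi> r] lattice_circleD(3) [OF \<xi>] r by auto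
      define k where "k = nat \<lfloor>\<theta> * K / (2 * pi)\<rfloor>"
      have "0 \<le> \<theta> * K / (2 * pi)" using \<theta> by simp
      then have k: "real k \<le> \<theta> * K / (2 * pi)" "\<theta> * K / (2 * pi) < real (Suc k)"
        unfolding k_def by linarith+
      have "\<theta> * K / (2 * pi) < K" using \<theta> K by (simp add: field_simps)
      then have "k < K" using k by linarith
      moreover have "2 * pi * real k / K \<le> \<theta>" "\<theta> \<le> 2 * pi * real (Suc k) / K"
        using k K(3) by (simp_all add: field_simps)
      then have "\<xi> \<in> I k" unfolding I_def circle_arc_def using \<theta> lattice_circleD(1) [OF \<xi>] by auto
      ultimately show "\<xi> \<in> (\<Union>k<K. I k)" by blast
    qed
    moreover have finI: "finite (I k)" for k
      unfolding I_def using finite_subset [OF circle_arc_lattice_subset [of r] finite_lattice_circle] r by simp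
    ultimately have "card (lattice_circle (r\<^sup>2)) \<le> card (\<Union>k<K. I k)"
      using finI by (intro card_mono finite_UN_I) auto
    also have "\<dots> \<le> (\<Sum>k<K. card (I k))" by (rule card_UN_le) simp
    finally have "real (card (lattice_circle (r\<^sup>2))) \<le> (\<Sum>k<K. real (card (I k)))"
      unfolding of_nat_sum [symmetric] of_nat_le_iff .
    also have "\<dots> \<le> (\<Sum>k<K. B)"
    proof (intro sum_mono)
      fix k
      have "r * (2 * pi * real (Suc k) / K - 2 * pi * real k / K) = r * (2 * pi / K)"
        by (simp add: diff_divide_distrib [symmetric] algebra_simps)
      also have "\<dots> < r * (1 / r powr e)"
        using K r rp by (intro mult_strict_left_mono) (simp_all add: field_simps)
      also have "\<dots> = r powr (1 - e)" using r by (simp add: powr_diff)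
      finally show "real (card (I k)) \<le> B" unfolding I_def using r K(3)
        by (intro B) (auto intro!: divide_right_mono)
    qed
    also have "\<dots> = K * B" by simp
    also have "\<dots> \<le> (2 * pi * r powr e + 1) * B" using K B by (intro mult_right_mono) auto
    also have "2 * pi * r powr e + 1 \<le> 8 * r powr e"
    proof -
      have "2 * pi * r powr e \<le> 7 * r powr e" using pi_approx by (intro mult_right_mono) auto
      then show ?thesis using rp by linarith
    qed
    finally show ?thesis using B by (simp add: mult_right_mono mult_ac)
  qed
  then show ?thesis using B by (intro exI [of _ "8 * B"]) auto
qed

text \<open>A chord of length \<open>d\<close> spans an arc of length at most \<open>3 d\<close>, so that the points within distance \<open>d\<close> lie
on an arc of length \<open>6 d\<close>.\<close>

lemma cg_close:
  assumes cg: cilleruelo_granville and e: "0 < e" "e < 1"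
  shows "\<exists>B::nat. \<forall>r>0. \<forall>d\<ge>0. \<forall>\<xi>\<^sub>0\<in>lattice_circle (r\<^sup>2). r\<^sup>2 \<in> \<int> \<longrightarrow> 6 * d < r powr (1 - e) \<longrightarrow>
     card {\<xi> \<in> lattice_circle (r\<^sup>2). norm (\<xi> - \<xi>\<^sub>0) \<le> d} \<le> B"
proof -
  obtain B where B: "B > 0" "\<And>r s t. 0 < r \<Longrightarrow> r\<^sup>2 \<in> \<int> \<Longrightarrow> s \<le> t \<Longrightarrow> r * (t - s) < r powr (1 - e) \<Longrightarrow>
      real (card (circle_arc r s t \<inter> int_lattice)) \<le> B"
    using cg_arc [OF cg e] by metis
  have "card {\<xi> \<in> lattice_circle (r\<^sup>2). norm (\<xi> - \<xi>\<^sub>0) \<le> d} \<le> nat \<lceil>B\<rceil>"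
    if r: "r > 0" "d \<ge> 0" "\<xi>\<^sub>0 \<in> lattice_circle (r\<^sup>2)" "r\<^sup>2 \<in> \<int>" "6 * d < r powr (1 - e)" for r d \<xi>\<^sub>0
  proof -
    obtain \<theta>\<^sub>0 where \<theta>\<^sub>0: "\<xi>\<^sub>0 = vector [r * cos \<theta>\<^sub>0, r * sin \<theta>\<^sub>0]"
      using circle_point [of \<xi>\<^sub>0 r] lattice_circleD(3) [OF r(3)] r by metis
    have "{\<xi> \<in> lattice_circle (r\<^sup>2). norm (\<xi> - \<xi>\<^sub>0) \<le> d} \<subseteq> circle_arc r (\<theta>\<^sub>0 - 3 * d / r) (\<theta>\<^sub>0 + 3 * d / r) \<inter> int_lattice"
    proof
      fix \<xi> assume "\<xi> \<in> {\<xi> \<in> lattice_circle (r\<^sup>2). norm (\<xi> - \<xi>\<^sub>0) \<le> d}"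
      then have \<xi>: "\<xi> \<in> lattice_circle (r\<^sup>2)" "norm (\<xi> - \<xi>\<^sub>0) \<le> d" by auto
      obtain \<theta> where \<theta>: "\<xi> = vector [r * cos \<theta>, r * sin \<theta>]"
        using circle_point [of \<xi> r] lattice_circleD(3) [OF \<xi>(1)] r by metis
      define x where "x = (\<theta> - \<theta>\<^sub>0) / (2 * pi)"
      have "(norm (\<xi> - \<xi>\<^sub>0))\<^sup>2 = r\<^sup>2 * ((cos \<theta> - cos \<theta>\<^sub>0)\<^sup>2 + (sin \<theta> - sin \<theta>\<^sub>0)\<^sup>2)"
        unfolding norm_sq_2 \<theta> \<theta>\<^sub>0
        by (simp only: vector_minus_component vector_2 right_diff_distrib [symmetric] power_mult_distrib distrib_left)
      also have "(cos \<theta> - cos \<theta>\<^sub>0)\<^sup>2 + (sin \<theta> - sin \<theta>\<^sub>0)\<^sup>2 = (norm (ee (\<theta> / (2*pi)) - ee (\<theta>\<^sub>0 / (2*pi))))\<^sup>2"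
        by (simp add: cmod_power2 Re_ee Im_ee)
      also have "ee (\<theta> / (2*pi)) - ee (\<theta>\<^sub>0 / (2*pi)) = ee (\<theta>\<^sub>0 / (2*pi)) * (ee x - 1)"
        unfolding right_diff_distrib ee_add [symmetric] x_def by (simp add: add_divide_distrib [symmetric])
      finally have "(norm (\<xi> - \<xi>\<^sub>0))\<^sup>2 = (r * norm (ee x - 1))\<^sup>2" by (simp add: norm_mult power_mult_distrib)
      then have n: "norm (\<xi> - \<xi>\<^sub>0) = r * norm (ee x - 1)" using r by (simp add: power2_eq_iff_nonneg)
      obtain k :: int where k: "\<bar>x - of_int k\<bar> \<le> norm (ee x - 1) / 3" using norm_ee_minus_1_ge by blast
      have "norm (ee x - 1) \<le> d / r" using n \<xi>(2) r by (simp add: field_simps)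
      then have "norm (ee x - 1) / 3 \<le> d / r / 3" by (intro divide_right_mono) auto
      with k have "\<bar>x - of_int k\<bar> \<le> d / r / 3" by (rule order_trans)
      moreover have "2 * pi \<le> 9" using pi_less_4 by linarith
      ultimately have "2 * pi * \<bar>x - of_int k\<bar> \<le> 9 * (d / r / 3)"
        by (intro mult_mono) auto
      moreover have "2 * pi * \<bar>x - of_int k\<bar> = \<bar>(\<theta> - 2 * pi * of_int k) - \<theta>\<^sub>0\<bar>"
      proof -
        have "(\<theta> - 2 * pi * of_int k) - \<theta>\<^sub>0 = 2 * pi * (x - of_int k)" by (simp add: x_def field_simps)
        then show ?thesis by (simp add: abs_mult)
      qed
      ultimately have "\<bar>(\<theta> - 2 * pi * of_int k) - \<theta>\<^sub>0\<bar> \<le> 3 * d / r" by simp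
      then have "\<theta> - 2 * pi * of_int k \<in> {\<theta>\<^sub>0 - 3 * d / r..\<theta>\<^sub>0 + 3 * d / r}" unfolding atLeastAtMost_iff by linarith
      moreover have "cos (\<theta> - 2 * pi * of_int k) = cos \<theta>" "sin (\<theta> - 2 * pi * of_int k) = sin \<theta>"
        using cos_int_2pin [of k] sin_int_2pin [of k] by (simp_all add: cos_diff sin_diff)
      ultimately show "\<xi> \<in> circle_arc r (\<theta>\<^sub>0 - 3 * d / r) (\<theta>\<^sub>0 + 3 * d / r) \<inter> int_lattice"
        using \<theta> lattice_circleD(1) [OF \<xi>(1)] unfolding circle_arc_def
        by (intro IntI image_eqI [of _ _ "\<theta> - 2 * pi * of_int k"]) simp_all
    qed
    then have "card {\<xi> \<in> lattice_circle (r\<^sup>2). norm (\<xi> - \<xi>\<^sub>0) \<le> d} \<le> card (circle_arc r (\<theta>\<^sub>0 - 3 * d / r) (\<theta>\<^sub>0 + 3 * d / r) \<inter> int_lattice)"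
      using finite_subset [OF circle_arc_lattice_subset [OF r(1)] finite_lattice_circle] by (intro card_mono)
    moreover have "real (card (circle_arc r (\<theta>\<^sub>0 - 3 * d / r) (\<theta>\<^sub>0 + 3 * d / r) \<inter> int_lattice)) \<le> B"
      using r by (intro B) (auto simp: field_simps)
    ultimately show ?thesis by linarith
  qed
  then show ?thesis by blast
qed

text \<open>If each of the rings \<open>k d \<le> norm (\<xi> - \<xi>\<^sub>0) < (k + 1) d\<close> with \<open>1 \<le> k \<le> B\<close> contained a point of \<open>F\<close>, then these
points together with \<open>\<xi>\<^sub>0\<close> would be too many. The points inside an empty ring form \<open>J\<close>.\<close>

lemma isolated_cluster:
  fixes F :: "'a::real_normed_vector set" and B :: nat
  assumes F: "finite F" "\<xi>\<^sub>0 \<in> F" and d: "d > 0"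
    and few: "card {\<xi>\<in>F. norm (\<xi> - \<xi>\<^sub>0) \<le> (real B + 1) * d} \<le> B"
  obtains J where "J \<subseteq> F" "\<xi>\<^sub>0 \<in> J" "card J \<le> B" "\<And>\<xi>. \<xi> \<in> J \<Longrightarrow> norm (\<xi> - \<xi>\<^sub>0) \<le> real B * d"
    "\<And>\<xi> \<eta>. \<xi> \<in> J \<Longrightarrow> \<eta> \<in> F - J \<Longrightarrow> d \<le> norm (\<xi> - \<eta>)"
proof -
  define R where "R k = {\<xi>\<in>F. real k * d \<le> norm (\<xi> - \<xi>\<^sub>0) \<and> norm (\<xi> - \<xi>\<^sub>0) < (real k + 1) * d}" for k :: nat
  have "\<exists>k\<in>{1..B}. R k = {}"
  proof (rule ccontr)
    assume "\<not> ?thesis"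
    then have "\<forall>k\<in>{1..B}. \<exists>\<xi>. \<xi> \<in> R k" by blast
    then obtain f where f: "\<And>k. k \<in> {1..B} \<Longrightarrow> f k \<in> R k" by metis
    have ring_less: False if "k \<in> {1..B}" "l \<in> {1..B}" "k < l" "f k = f l" for k l
    proof -
      have "real l * d < (real k + 1) * d" using f [OF that(1)] f [OF that(2)] that(4) by (auto simp: R_def)
      then have "real l < real k + 1" using d by simp
      then show False using that(3) by linarith
    qed
    have inj: "inj_on f {1..B}"
      by (rule linorder_inj_onI) (use ring_less in auto)
    have ne: "\<xi>\<^sub>0 \<notin> f ` {1..B}"
    proof
      assume "\<xi>\<^sub>0 \<in> f ` {1..B}"
      then obtain k where "k \<in> {1..B}" "f k = \<xi>\<^sub>0" by auto
      then show False using f [of k] d by (auto simp: R_def zero_less_mult_iff mult_le_0_iff)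
    qed
    have sub: "insert \<xi>\<^sub>0 (f ` {1..B}) \<subseteq> {\<xi>\<in>F. norm (\<xi> - \<xi>\<^sub>0) \<le> (real B + 1) * d}"
    proof -
      have "norm (f k - \<xi>\<^sub>0) \<le> (real B + 1) * d \<and> f k \<in> F" if "k \<in> {1..B}" for k
      proof -
        have "(real k + 1) * d \<le> (real B + 1) * d" using that d by (intro mult_right_mono) auto
        then show ?thesis using f [OF that] by (auto simp: R_def)
      qed
      then show ?thesis using F d by auto
    qed
    then have "card (insert \<xi>\<^sub>0 (f ` {1..B})) \<le> B"
      using few card_mono [OF _ sub] F by simp
    moreover have "card (insert \<xi>\<^sub>0 (f ` {1..B})) = Suc B" using ne card_image [OF inj] by simp
    ultimately show False by simp
  qed
  then obtain k where k: "k \<in> {1..B}" "R k = {}" by blast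
  define J where "J = {\<xi>\<in>F. norm (\<xi> - \<xi>\<^sub>0) < real k * d}"
  have kB: "real k * d \<le> real B * d" using k d by (intro mult_right_mono) auto
  show ?thesis
  proof
    show "J \<subseteq> F" "\<xi>\<^sub>0 \<in> J" using F k d by (auto simp: J_def)
    have "J \<subseteq> {\<xi>\<in>F. norm (\<xi> - \<xi>\<^sub>0) \<le> (real B + 1) * d}"
      unfolding J_def distrib_right
    proof (intro Collect_mono impI conjI; elim conjE)
      fix \<xi> assume "norm (\<xi> - \<xi>\<^sub>0) < real k * d"
      then show "norm (\<xi> - \<xi>\<^sub>0) \<le> real B * d + 1 * d" using kB d by linarith
    qed
    then have "card J \<le> card {\<xi>\<in>F. norm (\<xi> - \<xi>\<^sub>0) \<le> (real B + 1) * d}"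
      using F by (intro card_mono) auto
    then show "card J \<le> B" using few by simp
    show "norm (\<xi> - \<xi>\<^sub>0) \<le> real B * d" if "\<xi> \<in> J" for \<xi> using that kB by (auto simp: J_def)
    show "d \<le> norm (\<xi> - \<eta>)" if "\<xi> \<in> J" "\<eta> \<in> F - J" for \<xi> \<eta>
    proof -
      have 1: "norm (\<xi> - \<xi>\<^sub>0) < real k * d" "real k * d \<le> norm (\<eta> - \<xi>\<^sub>0)" using that by (auto simp: J_def)
      then have "(real k + 1) * d \<le> norm (\<eta> - \<xi>\<^sub>0)" using k(2) that by (force simp: R_def)
      moreover have "norm (\<eta> - \<xi>\<^sub>0) \<le> norm (\<xi> - \<eta>) + norm (\<xi> - \<xi>\<^sub>0)"
        using norm_triangle_ineq4 [of "\<xi> - \<xi>\<^sub>0" "\<xi> - \<eta>"] by simp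
      ultimately show ?thesis using 1 by (simp add: algebra_simps)
    qed
  qed
qed

section \<open>Restriction to coordinate lines\<close>

definition trig :: "(real^2) set \<Rightarrow> (real^2 \<Rightarrow> complex) \<Rightarrow> real^2 \<Rightarrow> complex" where
  "trig J a x = (\<Sum>\<xi>\<in>J. a \<xi> * ee (x \<bullet> \<xi>))"

definition line_pt :: "2 \<Rightarrow> real \<Rightarrow> real \<Rightarrow> real^2" where
  "line_pt i s y = (\<chi> k. if k = i then s else y)"

text \<open>On the line \<open>x $ i = s\<close> an exponential sum becomes a sum in one variable, where the frequencies with
the same \<open>j\<close>-th component \<open>n\<close> are merged; this is the resulting coefficient of \<open>e(n y)\<close>.\<close>

definition line_coeff :: "2 \<Rightarrow> 2 \<Rightarrow> (real^2) set \<Rightarrow> (real^2 \<Rightarrow> complex) \<Rightarrow> real \<Rightarrow> real \<Rightarrow> complex" where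
  "line_coeff i j J a n s = (\<Sum>\<xi>\<in>{\<xi>\<in>J. \<xi> $ j = n}. a \<xi> * ee (s * \<xi> $ i))"

lemma UNIV_2_distinct: "i \<noteq> j \<Longrightarrow> (UNIV :: 2 set) = {i, j}"
  using exhaust_2 [of i] exhaust_2 [of j] by (auto simp: UNIV_2)

lemma vec2_eq_iff: "i \<noteq> j \<Longrightarrow> x = y \<longleftrightarrow> x $ i = y $ i \<and> x $ j = y $ j" for x y :: "'a ^ 2"
  using UNIV_2_distinct [of i j] by (auto simp: vec_eq_iff)

lemma inner_2_distinct: "i \<noteq> j \<Longrightarrow> x \<bullet> y = x $ i * y $ i + x $ j * y $ j" for x y :: "real ^ 2"
  by (simp add: inner_vec_def UNIV_2_distinct)

lemma line_pt_nth: "line_pt i s y $ i = s" "i \<noteq> j \<Longrightarrow> line_pt i s y $ j = y"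
  by (auto simp: line_pt_def)

lemma trig_line_pt:
  assumes "i \<noteq> j" "finite J"
  shows "trig J a (line_pt i s y) = (\<Sum>n\<in>(\<lambda>\<xi>. \<xi> $ j) ` J. line_coeff i j J a n s * ee (n * y))"
proof -
  have "trig J a (line_pt i s y) = (\<Sum>\<xi>\<in>J. a \<xi> * ee (s * \<xi> $ i) * ee (\<xi> $ j * y))"
    using assms unfolding trig_def
    by (intro sum.cong refl) (simp add: inner_2_distinct [OF assms(1)] line_pt_nth ee_add mult_ac)
  also have "\<dots> = (\<Sum>n\<in>(\<lambda>\<xi>. \<xi> $ j) ` J. \<Sum>\<xi>\<in>{\<xi>\<in>J. \<xi> $ j = n}. a \<xi> * ee (s * \<xi> $ i) * ee (\<xi> $ j * y))"
    by (rule sum.image_gen [OF assms(2)])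
  also have "\<dots> = (\<Sum>n\<in>(\<lambda>\<xi>. \<xi> $ j) ` J. line_coeff i j J a n s * ee (n * y))"
    unfolding line_coeff_def sum_distrib_right by (intro sum.cong refl) auto
  finally show ?thesis .
qed

lemma trig_periodic:
  assumes "J \<subseteq> int_lattice" "z \<in> int_lattice" shows "trig J a (x + z) = trig J a x"
  unfolding trig_def
proof (intro sum.cong refl)
  fix \<xi> assume "\<xi> \<in> J"
  then have "\<xi> $ k \<in> \<int>" "z $ k \<in> \<int>" for k using assms by (auto simp: int_lattice_def)
  then have "z \<bullet> \<xi> \<in> \<int>" unfolding inner_vec_def by (auto intro!: Ints_sum Ints_mult)
  then show "a \<xi> * ee ((x + z) \<bullet> \<xi>) = a \<xi> * ee (x \<bullet> \<xi>)"
    by (simp add: inner_add_left ee_add ee_int)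
qed

text \<open>The continuous analogue of the count of near-resonant translations. The range \<open>{-1..2}\<close> is a
neighbourhood of the unit interval which contains the projection of any arc of length at most 1
that starts over the unit interval.\<close>

lemma resonant_set_measure:
  fixes v s0 \<tau> :: real
  assumes v: "1 \<le> \<bar>v\<bar>" and s0: "s0 \<in> {-1..2}" and \<tau>: "0 < \<tau>" "\<tau> \<le> 1"
    and S: "S \<in> sets lborel" "\<And>s. s \<in> S \<Longrightarrow> s \<in> {-1..2} \<and> (\<exists>k::int. \<bar>v * (s - s0) - k\<bar> \<le> \<tau>)"
  shows "emeasure lborel S \<le> ennreal (18 * \<tau>)"
proof -
  define K where "K = {k::int. \<bar>of_int k - 0\<bar> \<le> 3 * \<bar>v\<bar> + 1}"
  define c where "c k = s0 + real_of_int k / v" for k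
  have finK: "finite K" and cK: "real (card K) \<le> 2 * (3 * \<bar>v\<bar> + 1) + 1"
    unfolding K_def by (rule card_int_interval; simp)+
  have "S \<subseteq> (\<Union>k\<in>K. {c k - \<tau> / \<bar>v\<bar>..c k + \<tau> / \<bar>v\<bar>})"
  proof
    fix s assume "s \<in> S"
    then obtain k :: int where s: "s \<in> {-1..2}" and k: "\<bar>v * (s - s0) - k\<bar> \<le> \<tau>" using S(2) by blast
    have "\<bar>s - s0\<bar> \<le> 3" using s s0 unfolding atLeastAtMost_iff by linarith
    then have "\<bar>v * (s - s0)\<bar> \<le> \<bar>v\<bar> * 3" unfolding abs_mult by (intro mult_left_mono) auto
    then have "\<bar>of_int k - 0\<bar> \<le> 3 * \<bar>v\<bar> + 1" using k \<tau> by linarith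
    then have "k \<in> K" by (simp add: K_def)
    moreover have "s - c k = (v * (s - s0) - k) / v" using v by (auto simp: c_def field_simps)
    then have "\<bar>s - c k\<bar> = \<bar>v * (s - s0) - k\<bar> / \<bar>v\<bar>" by (simp only: abs_divide)
    then have "\<bar>s - c k\<bar> \<le> \<tau> / \<bar>v\<bar>" using k by (simp add: divide_right_mono)
    then have "s \<in> {c k - \<tau> / \<bar>v\<bar>..c k + \<tau> / \<bar>v\<bar>}" unfolding atLeastAtMost_iff by linarith
    ultimately show "s \<in> (\<Union>k\<in>K. {c k - \<tau> / \<bar>v\<bar>..c k + \<tau> / \<bar>v\<bar>})" by blast
  qed
  then have "emeasure lborel S \<le> emeasure lborel (\<Union>k\<in>K. {c k - \<tau> / \<bar>v\<bar>..c k + \<tau> / \<bar>v\<bar>})"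
    using finK by (intro emeasure_mono) auto
  also have "\<dots> \<le> (\<Sum>k\<in>K. emeasure lborel {c k - \<tau> / \<bar>v\<bar>..c k + \<tau> / \<bar>v\<bar>})"
    using finK by (intro emeasure_subadditive_finite) auto
  also have "\<dots> = (\<Sum>k\<in>K. ennreal (2 * (\<tau> / \<bar>v\<bar>)))"
    using \<tau> by (intro sum.cong refl) (simp add: algebra_simps)
  also have "\<dots> = ennreal (card K * (2 * (\<tau> / \<bar>v\<bar>)))"
    using \<tau> by (simp add: ennreal_of_nat_eq_real_of_nat flip: ennreal_mult)
  also have "\<dots> \<le> ennreal (18 * \<tau>)"
  proof (rule ennreal_leI)
    have "card K * (2 * (\<tau> / \<bar>v\<bar>)) \<le> (9 * \<bar>v\<bar>) * (2 * (\<tau> / \<bar>v\<bar>))"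
      using cK v \<tau> by (intro mult_right_mono) auto
    also have "\<dots> = 18 * \<tau>" using v by auto
    finally show "card K * (2 * (\<tau> / \<bar>v\<bar>)) \<le> 18 * \<tau>" .
  qed
  finally show ?thesis .
qed

lemma continuous_on_line_coeff: "continuous_on S (line_coeff i j J a n)"
  unfolding line_coeff_def by (intro continuous_intros)

text \<open>On a circle the only frequency that can be merged with \<open>\<xi>\<^sub>0\<close> is its mirror image, so the coefficient
has modulus \<open>A\<close> or the form \<open>\<bar>a e(2 m s) + a'\<bar>\<close> with an integer \<open>m \<noteq> 0\<close>. If it is small at \<open>s\<close> and
\<open>s0\<close>, then \<open>2 m (s - s0)\<close> is close to an integer.\<close>

lemma line_coeff_small:
  assumes ij: "i \<noteq> j" and J: "J \<subseteq> lattice_circle E" "\<xi>\<^sub>0 \<in> J" and A: "norm (a \<xi>\<^sub>0) = A" "A > 0"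
    and \<tau>: "0 < \<tau>" "\<tau> < 1"
  defines "S \<equiv> {s \<in> {-1..2}. norm (line_coeff i j J a (\<xi>\<^sub>0 $ j) s) \<le> \<tau> * A}"
  shows "S \<in> sets lborel" "emeasure lborel S \<le> ennreal (18 * \<tau>)"
proof -
  define C where "C = line_coeff i j J a (\<xi>\<^sub>0 $ j)"
  have "S = {-1..2} \<inter> {s. norm (line_coeff i j J a (\<xi>\<^sub>0 $ j) s) \<le> \<tau> * A}" by (auto simp: S_def)
  then have "closed S"
    by (simp only:) (intro closed_Int closed_atLeastAtMost closed_Collect_le continuous_intros continuous_on_line_coeff)
  then show S: "S \<in> sets lborel" by simp
  define m where "m = \<xi>\<^sub>0 $ i"
  \<comment> \<open>The mirror image of \<open>\<xi>\<^sub>0\<close>.\<close>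
  define \<xi>' where "\<xi>' = line_pt i (- m) (\<xi>\<^sub>0 $ j)"
  have other: "\<xi> = \<xi>\<^sub>0 \<or> \<xi> = \<xi>'" if "\<xi> \<in> J" "\<xi> $ j = \<xi>\<^sub>0 $ j" for \<xi>
  proof -
    have "\<xi> \<bullet> \<xi> = \<xi>\<^sub>0 \<bullet> \<xi>\<^sub>0"
      using lattice_circleD(3) [OF subsetD [OF J(1) that(1)]] lattice_circleD(3) [OF subsetD [OF J(1) J(2)]]
      by (simp add: power2_norm_eq_inner)
    then have "(\<xi> $ i)\<^sup>2 = m\<^sup>2" using that(2) by (simp add: inner_2_distinct [OF ij] m_def power2_eq_square)
    then have "\<xi> $ i = m \<or> \<xi> $ i = - m" by (simp add: power2_eq_iff)
    then show ?thesis using that(2) ij by (auto simp: vec2_eq_iff [OF ij] m_def \<xi>'_def line_pt_nth)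
  qed
  show "emeasure lborel S \<le> ennreal (18 * \<tau>)"
  proof (cases "\<xi>' \<in> J \<and> \<xi>' \<noteq> \<xi>\<^sub>0")
    case False
    then have "{\<xi>\<in>J. \<xi> $ j = \<xi>\<^sub>0 $ j} = {\<xi>\<^sub>0}" using other J by auto
    then have "norm (C s) = A" for s using A by (simp add: C_def line_coeff_def norm_mult)
    moreover have "\<tau> * A < A" using A \<tau> by simp
    ultimately have "S = {}" unfolding S_def C_def [symmetric] by auto
    then show ?thesis by simp
  next
    case True
    then have set: "{\<xi>\<in>J. \<xi> $ j = \<xi>\<^sub>0 $ j} = {\<xi>\<^sub>0, \<xi>'}" using other J ij by (auto simp: \<xi>'_def line_pt_nth)
    have C: "C s * ee (s * m) = a \<xi>\<^sub>0 * ee (2 * m * s) + a \<xi>'" for s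
    proof -
      have "C s = a \<xi>\<^sub>0 * ee (s * m) + a \<xi>' * ee (- (s * m))"
      proof -
        have "\<xi>' $ i = - m" by (simp add: \<xi>'_def line_pt_nth)
        moreover have "\<xi>\<^sub>0 \<noteq> \<xi>'" using True by blast
        ultimately show ?thesis unfolding C_def line_coeff_def set by (simp add: m_def)
      qed
      moreover have "ee (s * m) * ee (s * m) = ee (2 * m * s)" "ee (- (s * m)) * ee (s * m) = 1"
        unfolding ee_add [symmetric] by (simp_all add: algebra_simps)
      ultimately show ?thesis by (simp add: distrib_right mult.assoc)
    qed
    have m0: "m \<noteq> 0" using True ij by (auto simp: \<xi>'_def m_def vec2_eq_iff [OF ij] line_pt_nth)
    moreover have "m \<in> \<int>" using lattice_circleD(2) [of \<xi>\<^sub>0 E i] J by (auto simp: m_def)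
    ultimately have m1: "1 \<le> \<bar>2 * m\<bar>" using Ints_nonzero_abs_ge1 [of m] by simp
    show ?thesis
    proof (cases "S = {}")
      case False
      then obtain s0 where s0: "s0 \<in> S" by blast
      show ?thesis
      proof (rule resonant_set_measure [OF m1 _ \<tau>(1) _ S])
        show "s0 \<in> {-1..2}" using s0 by (auto simp: S_def)
        fix s assume s: "s \<in> S"
        have nC: "norm (a \<xi>\<^sub>0 * ee (2 * m * t) + a \<xi>') \<le> \<tau> * A" if "t \<in> S" for t
          using that C [of t, symmetric] by (simp add: norm_mult S_def C_def)
        have "ee (2 * m * s) - ee (2 * m * s0) = ee (2 * m * s0) * (ee (2 * m * (s - s0)) - 1)"
          unfolding right_diff_distrib ee_add [symmetric] by (simp add: algebra_simps)
        then have "A * norm (ee (2 * m * (s - s0)) - 1) = norm (a \<xi>\<^sub>0 * (ee (2 * m * s) - ee (2 * m * s0)))"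
          by (simp add: norm_mult A)
        also have "a \<xi>\<^sub>0 * (ee (2 * m * s) - ee (2 * m * s0)) =
            (a \<xi>\<^sub>0 * ee (2 * m * s) + a \<xi>') - (a \<xi>\<^sub>0 * ee (2 * m * s0) + a \<xi>')" by (simp add: algebra_simps)
        also have "norm \<dots> \<le> \<tau> * A + \<tau> * A"
          using nC [OF s] nC [OF s0] by (intro order_trans [OF norm_triangle_ineq4] add_mono)
        also have "\<dots> = A * (2 * \<tau>)" by simp
        finally have le: "norm (ee (2 * m * (s - s0)) - 1) \<le> 2 * \<tau>" using A by (simp only: mult_le_cancel_left_pos)
        obtain k :: int where k: "\<bar>2 * m * (s - s0) - k\<bar> \<le> norm (ee (2 * m * (s - s0)) - 1) / 3"
          using norm_ee_minus_1_ge by blast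
        have "\<bar>2 * m * (s - s0) - k\<bar> \<le> \<tau>"
          by (rule order_trans [OF k]) (use le \<tau> in simp)
        then show "s \<in> {-1..2} \<and> (\<exists>k::int. \<bar>2 * m * (s - s0) - k\<bar> \<le> \<tau>)" using s by (auto simp: S_def)
      qed (use \<tau> in auto)
    qed simp
  qed
qed

text \<open>For these lines the eigenfunction could vanish identically, and there would be no count of zeros.\<close>

lemma line_coeff_zero_null:
  assumes ij: "i \<noteq> j" and J: "J \<subseteq> lattice_circle E" "\<xi>\<^sub>0 \<in> J" and A: "a \<xi>\<^sub>0 \<noteq> 0"
  shows "{s \<in> {-1..2}. line_coeff i j J a (\<xi>\<^sub>0 $ j) s = 0} \<in> null_sets lborel"
proof -
  define S where "S \<tau> = {s \<in> {-1..2}. norm (line_coeff i j J a (\<xi>\<^sub>0 $ j) s) \<le> \<tau> * norm (a \<xi>\<^sub>0)}" for \<tau>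
  define N where "N = {s \<in> {-1..2}. line_coeff i j J a (\<xi>\<^sub>0 $ j) s = 0}"
  have "N = {-1..2} \<inter> {s. line_coeff i j J a (\<xi>\<^sub>0 $ j) s = 0}" by (auto simp: N_def)
  then have "closed N"
    by (simp only:) (intro closed_Int closed_atLeastAtMost closed_Collect_eq continuous_intros continuous_on_line_coeff)
  then have N: "N \<in> sets lborel" by simp
  have nA: "norm (a \<xi>\<^sub>0) > 0" using A by simp
  have le: "emeasure lborel N \<le> ennreal (18 * \<tau>)" if "0 < \<tau>" "\<tau> < 1" for \<tau>
  proof -
    note S = line_coeff_small [where a = a, OF ij J refl nA that, folded S_def]
    have "N \<subseteq> S \<tau>" using that by (simp add: S_def N_def Collect_mono)
    then have "emeasure lborel N \<le> emeasure lborel (S \<tau>)" using S(1) by (rule emeasure_mono)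
    also have "\<dots> \<le> ennreal (18 * \<tau>)" by (rule S(2))
    finally show ?thesis .
  qed
  have "emeasure lborel N = 0"
  proof (rule ccontr)
    assume "\<not> ?thesis"
    moreover have fin: "emeasure lborel N \<noteq> \<infinity>" using le [of "1/2"] by (auto simp: top_unique)
    ultimately obtain x where x: "emeasure lborel N = ennreal x" "x > 0"
      by (cases "emeasure lborel N") (auto simp: less_le)
    define \<tau> where "\<tau> = min (1/2) (x / 36)"
    have \<tau>: "0 < \<tau>" "\<tau> < 1" "18 * \<tau> < x" using x by (auto simp: \<tau>_def min_def)
    show False using le [OF \<tau>(1,2)] \<tau> x by (simp add: ennreal_le_iff)
  qed
  then show ?thesis using N unfolding N_def by auto
qed

lemma line_zeros_short:
  assumes ij: "i \<noteq> j" and F: "finite F" "F \<subseteq> lattice_circle (lam\<^sup>2)" "\<xi>\<^sub>0 \<in> F" and lam: "lam > 0"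
    and nz: "line_coeff i j F a (\<xi>\<^sub>0 $ j) s \<noteq> 0" and uv: "u \<le> v" "2 * lam * (v - u) < 1"
  shows "finite {y \<in> {u..v}. trig F a (line_pt i s y) = 0}" "card {y \<in> {u..v}. trig F a (line_pt i s y) = 0} \<le> 2 * card F"
proof -
  define G where "G = (\<lambda>\<xi>. \<xi> $ j) ` F"
  define Y where "Y = {y \<in> {u..v}. trig F a (line_pt i s y) = 0}"
  have G: "finite G" "card G \<le> card F" using F by (auto simp: G_def card_image_le)
  have Gb: "2 * \<bar>n\<bar> * (v - u) < 1" if n: "n \<in> G" for n
  proof -
    obtain \<xi> where \<xi>: "\<xi> \<in> F" "n = \<xi> $ j" using n by (auto simp: G_def)
    have "norm \<xi> = lam" using lattice_circleD(3) [of \<xi> "lam\<^sup>2"] F \<xi> lam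
      by (metis norm_ge_zero less_imp_le power2_eq_iff_nonneg subsetD)
    then have "\<bar>n\<bar> \<le> lam" using component_le_norm_cart [of \<xi> j] \<xi> by simp
    then have "2 * \<bar>n\<bar> * (v - u) \<le> 2 * lam * (v - u)" using uv by (intro mult_right_mono) auto
    then show ?thesis using uv by simp
  qed
  have no: "\<not> (finite Z \<and> Z \<subseteq> Y \<and> card Z = 2 * card G)" for Z
  proof
    assume Z: "finite Z \<and> Z \<subseteq> Y \<and> card Z = 2 * card G"
    have "line_coeff i j F a (\<xi>\<^sub>0 $ j) s = 0"
    proof (rule exp_sum_zeros [OF G(1) Gb uv(1), of Z "\<lambda>n. line_coeff i j F a n s"])
      fix y assume "y \<in> Z"
      then show "(\<Sum>n\<in>G. line_coeff i j F a n s * ee (n * y)) = 0"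
        using Z trig_line_pt [OF ij F(1), of a s y] by (auto simp: Y_def G_def)
    qed (use Z F in \<open>auto simp: Y_def G_def\<close>)
    then show False using nz by simp
  qed
  have "finite Y" using no infinite_arbitrarily_large by metis
  moreover have "card Y \<le> 2 * card G"
    using no obtain_subset_with_card_n [of "2 * card G" Y] calculation finite_subset by (metis nat_le_linear)
  ultimately show "finite {y \<in> {u..v}. trig F a (line_pt i s y) = 0}" "card {y \<in> {u..v}. trig F a (line_pt i s y) = 0} \<le> 2 * card F"
    using G unfolding Y_def by auto
qed

section \<open>Zeros on a line, and the mean square over an arc\<close>

text \<open>Dividing by \<open>e(x \<bullet> \<xi>\<^sub>0)\<close> does not change the modulus and leaves only frequencies of size at most \<open>D\<close>.\<close>

lemma trig_norm_lipschitz: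
  fixes A D :: real
  assumes J: "finite J" "\<And>\<xi>. \<xi> \<in> J \<Longrightarrow> norm (a \<xi>) \<le> A" "\<And>\<xi>. \<xi> \<in> J \<Longrightarrow> norm (\<xi> - \<xi>\<^sub>0) \<le> D"
  shows "norm (trig J a x) \<le> norm (trig J a y) + 7 * card J * A * D * norm (x - y)"
proof -
  define T where "T x = (\<Sum>\<xi>\<in>J. a \<xi> * ee (x \<bullet> (\<xi> - \<xi>\<^sub>0)))" for x
  have nT: "norm (T x) = norm (trig J a x)" for x
  proof -
    have "trig J a x = ee (x \<bullet> \<xi>\<^sub>0) * T x"
      unfolding trig_def T_def sum_distrib_left
      by (intro sum.cong refl) (simp add: mult.left_commute flip: ee_add, simp add: inner_diff_right)
    then show ?thesis by (simp add: norm_mult)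
  qed
  have "norm (T x - T y) \<le> (\<Sum>\<xi>\<in>J. A * (7 * (D * norm (x - y))))"
    unfolding T_def sum_subtractf [symmetric]
  proof (rule sum_norm_le)
    fix \<xi> assume \<xi>: "\<xi> \<in> J"
    have "x \<bullet> (\<xi> - \<xi>\<^sub>0) = y \<bullet> (\<xi> - \<xi>\<^sub>0) + (x - y) \<bullet> (\<xi> - \<xi>\<^sub>0)" by (simp add: inner_diff_left)
    then have "a \<xi> * ee (x \<bullet> (\<xi> - \<xi>\<^sub>0)) - a \<xi> * ee (y \<bullet> (\<xi> - \<xi>\<^sub>0)) =
        a \<xi> * (ee (y \<bullet> (\<xi> - \<xi>\<^sub>0)) * (ee ((x - y) \<bullet> (\<xi> - \<xi>\<^sub>0)) - 1))"
      by (simp only: ee_add) (simp add: algebra_simps)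
    then have "norm (a \<xi> * ee (x \<bullet> (\<xi> - \<xi>\<^sub>0)) - a \<xi> * ee (y \<bullet> (\<xi> - \<xi>\<^sub>0))) =
        norm (a \<xi>) * norm (ee ((x - y) \<bullet> (\<xi> - \<xi>\<^sub>0)) - 1)"
      by (simp add: norm_mult)
    also have "\<dots> \<le> A * (7 * (D * norm (x - y)))"
    proof (intro mult_mono)
      have "norm (ee ((x - y) \<bullet> (\<xi> - \<xi>\<^sub>0)) - 1) \<le> 7 * \<bar>(x - y) \<bullet> (\<xi> - \<xi>\<^sub>0)\<bar>" by (rule norm_ee_minus_1_le)
      also have "\<bar>(x - y) \<bullet> (\<xi> - \<xi>\<^sub>0)\<bar> \<le> norm (x - y) * norm (\<xi> - \<xi>\<^sub>0)" by (rule Cauchy_Schwarz_ineq2)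
      also have "\<dots> \<le> norm (x - y) * D" using J(3) [OF \<xi>] by (intro mult_left_mono) auto
      finally show "norm (ee ((x - y) \<bullet> (\<xi> - \<xi>\<^sub>0)) - 1) \<le> 7 * (D * norm (x - y))" by (simp add: mult.commute)
      show "0 \<le> A" using J(2) [OF \<xi>] by (rule order_trans [OF norm_ge_zero])
    qed (use J(2) [OF \<xi>] in auto)
    finally show "norm (a \<xi> * ee (x \<bullet> (\<xi> - \<xi>\<^sub>0)) - a \<xi> * ee (y \<bullet> (\<xi> - \<xi>\<^sub>0))) \<le> A * (7 * (D * norm (x - y)))" .
  qed
  then have "norm (T x - T y) \<le> 7 * card J * A * D * norm (x - y)" by (simp add: mult_ac)
  then show ?thesis using norm_triangle_ineq2 [of "T x" "T y"] unfolding nT by linarith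
qed

lemma norm_line_pt_diff:
  assumes "i \<noteq> j" shows "norm (line_pt i s y - line_pt i s z) = \<bar>y - z\<bar>"
  using assms by (simp add: norm_eq_sqrt_inner inner_2_distinct [OF assms] line_pt_nth flip: power2_eq_square)

text \<open>Here \<open>trig F a\<close> is the eigenfunction and \<open>trig J a\<close> the cluster. The unit segment is cut into \<open>q\<close>
cells; a cell with a zero in \<open>W\<close> has a small value of the cluster at its left end point. All cells may
be of this kind, but if the coefficient at \<open>\<xi>\<^sub>0\<close> on this line is not small, only a proportion \<open>\<mu>\<close> is.\<close>

lemma line_zero_count:
  fixes a :: "real^2 \<Rightarrow> complex" and q r :: nat and \<mu> \<tau> D h A lam s :: real
  assumes ij: "i \<noteq> j" and F: "finite F" "F \<subseteq> lattice_circle (lam\<^sup>2)" and J: "J \<subseteq> F" "\<xi>\<^sub>0 \<in> J"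
    and A: "norm (a \<xi>\<^sub>0) = A" "A > 0" "\<And>\<xi>. \<xi> \<in> J \<Longrightarrow> norm (a \<xi>) \<le> A"
    and r: "card J \<le> Suc r" and D: "\<And>\<xi>. \<xi> \<in> J \<Longrightarrow> norm (\<xi> - \<xi>\<^sub>0) \<le> D"
    and q: "0 < lam" "2 * lam < q" and D\<mu>: "D \<le> (\<mu> / 40) ^ (2 ^ r) * q" and \<mu>: "0 < \<mu>" "\<mu> \<le> 1"
    and main: "2 ^ r * (h + 7 * Suc r * D / q) < \<tau> * (\<mu> / 40) ^ (2 ^ r - 1)"
    and nz: "line_coeff i j F a (\<xi>\<^sub>0 $ j) s \<noteq> 0"
  defines "W \<equiv> {y \<in> {0..<1}. trig F a (line_pt i s y) = 0 \<and> norm (trig J a (line_pt i s y)) \<le> h * A}"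
  shows "finite W" "card W \<le> 2 * card F * q"
    and "\<tau> * A < norm (line_coeff i j J a (\<xi>\<^sub>0 $ j) s) \<Longrightarrow> card W \<le> 2 * card F * (\<mu> * q)"
proof -
  have q0: "q > 0" using q by (cases q) auto
  have fJ: "finite J" using J F finite_subset by blast
  have D0: "D \<ge> 0" using D [OF J(2)] by simp
  define \<theta> where "\<theta> = (h + 7 * Suc r * D / q) * A"
  define S where "S = {m \<in> {0..<int q}. norm (trig J a (line_pt i s (real_of_int m / q))) \<le> \<theta>}"
  define Y where "Y m = {y \<in> {of_int m / q..(of_int m + 1) / q}. trig F a (line_pt i s y) = 0}" for m :: int
  have SS: "S \<subseteq> {0..<int q}" by (auto simp: S_def)
  have fS: "finite S" using SS finite_subset by blast
  have Y: "finite (Y m)" "card (Y m) \<le> 2 * card F" for m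
  proof -
    have "(of_int m + 1) / q - of_int m / q = 1 / q" by (simp add: diff_divide_distrib [symmetric])
    then have "2 * lam * ((of_int m + 1) / q - of_int m / q) < 1" using q q0 by simp
    moreover have "of_int m / q \<le> (of_int m + 1) / q" by (intro divide_right_mono) auto
    ultimately show "finite (Y m)" "card (Y m) \<le> 2 * card F"
      unfolding Y_def using line_zeros_short [OF ij F(1,2) _ q(1) nz] J by blast+
  qed
  have sub: "W \<subseteq> (\<Union>m\<in>S. Y m)"
  proof
    fix y assume y: "y \<in> W"
    define m where "m = \<lfloor>y * q\<rfloor>"
    have m: "of_int m \<le> y * q" "y * q < of_int m + 1" by (auto simp: m_def)
    have "0 \<le> y * q" "y * q < q" using y q0 by (auto simp: W_def)
    then have mq: "m \<in> {0..<int q}" unfolding m_def by (auto simp: floor_less_iff)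
    have my: "real_of_int m / q \<le> y" "y \<le> (real_of_int m + 1) / q"
      using m q0 by (simp_all add: field_simps)
    then have my1: "\<bar>real_of_int m / q - y\<bar> \<le> 1 / q" by (simp add: add_divide_distrib)
    have "norm (trig J a (line_pt i s (real_of_int m / q))) \<le>
        norm (trig J a (line_pt i s y)) + 7 * card J * A * D * \<bar>real_of_int m / q - y\<bar>"
      using trig_norm_lipschitz [OF fJ A(3) D, where x = "line_pt i s (real_of_int m / q)" and y = "line_pt i s y"]
      unfolding norm_line_pt_diff [OF ij] by simp
    also have "\<dots> \<le> h * A + 7 * Suc r * A * D * (1 / q)"
      using y my1 r A D0 by (intro add_mono mult_mono) (auto simp: W_def)
    also have "\<dots> = \<theta>" by (simp add: \<theta>_def algebra_simps add_divide_distrib)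
    finally have "m \<in> S" using mq by (simp add: S_def)
    moreover have "y \<in> Y m" using y my by (auto simp: Y_def W_def)
    ultimately show "y \<in> (\<Union>m\<in>S. Y m)" by blast
  qed
  show "finite W" by (rule finite_subset [OF sub]) (use fS Y in auto)
  have "card W \<le> card (\<Union>m\<in>S. Y m)" using sub fS Y by (intro card_mono) auto
  also have "\<dots> \<le> (\<Sum>m\<in>S. card (Y m))" by (rule card_UN_le [OF fS])
  also have "\<dots> \<le> (\<Sum>m\<in>S. 2 * card F)" using Y by (intro sum_mono)
  finally have cW: "card W \<le> 2 * card F * card S" by (simp add: mult.commute)
  have cS: "card S \<le> q" using card_mono [OF _ SS] by simp
  show "card W \<le> 2 * card F * q" using cW cS by (meson mult_le_mono2 order_trans)
  assume big: "\<tau> * A < norm (line_coeff i j J a (\<xi>\<^sub>0 $ j) s)"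
  have "card S \<le> \<mu> * q"
  proof (rule ccontr)
    assume "\<not> ?thesis"
    then have less: "\<mu> * q \<le> card S" by simp
    define G where "G = (\<lambda>\<xi>. \<xi> $ j) ` J"
    have "norm (line_coeff i j J a (\<xi>\<^sub>0 $ j) s) * (\<mu> / 40) ^ (2 ^ r - 1) \<le> 2 ^ r * \<theta>"
    proof (rule discrete_sublevel [OF _ _ _ _ \<mu> D\<mu> q0 SS less, where b = "\<lambda>n. line_coeff i j J a n s" and G = G])
      show "finite G" "\<xi>\<^sub>0 $ j \<in> G" using fJ J by (auto simp: G_def)
      show "card G \<le> Suc r" unfolding G_def using card_image_le [OF fJ] r order_trans by blast
      show "1 \<le> \<bar>n - \<xi>\<^sub>0 $ j\<bar> \<and> \<bar>n - \<xi>\<^sub>0 $ j\<bar> \<le> D" if n: "n \<in> G" "n \<noteq> \<xi>\<^sub>0 $ j" for n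
      proof -
        obtain \<xi> where \<xi>: "\<xi> \<in> J" "n = \<xi> $ j" using n by (auto simp: G_def)
        have "\<xi> \<in> lattice_circle (lam\<^sup>2)" "\<xi>\<^sub>0 \<in> lattice_circle (lam\<^sup>2)" using \<xi> J F by auto
        then have "n - \<xi>\<^sub>0 $ j \<in> \<int>" using \<xi> lattice_circleD(2) by auto
        then have "1 \<le> \<bar>n - \<xi>\<^sub>0 $ j\<bar>" using n(2) by (intro Ints_nonzero_abs_ge1) auto
        moreover have "\<bar>n - \<xi>\<^sub>0 $ j\<bar> \<le> D"
          using component_le_norm_cart [of "\<xi> - \<xi>\<^sub>0" j] D [OF \<xi>(1)] \<xi> by simp
        ultimately show ?thesis by simp
      qed
      fix m assume "m \<in> S"
      then show "norm (\<Sum>n\<in>G. line_coeff i j J a n s * ee (n * of_int m / q)) \<le> \<theta>"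
        using trig_line_pt [OF ij fJ, of a s "real_of_int m / q"] by (simp add: S_def G_def)
    qed
    also have "2 ^ r * \<theta> = (2 ^ r * (h + 7 * Suc r * D / q)) * A" by (simp add: \<theta>_def)
    also have "\<dots> < (\<tau> * (\<mu> / 40) ^ (2 ^ r - 1)) * A" using main A by (intro mult_strict_right_mono)
    also have "\<dots> = (\<tau> * A) * (\<mu> / 40) ^ (2 ^ r - 1)" by simp
    also have "\<dots> \<le> norm (line_coeff i j J a (\<xi>\<^sub>0 $ j) s) * (\<mu> / 40) ^ (2 ^ r - 1)"
      using big \<mu> by (intro mult_right_mono) auto
    finally show False by simp
  qed
  then have "real (2 * card F) * card S \<le> 2 * card F * (\<mu> * q)" by (simp add: mult_left_mono)
  then show "card W \<le> 2 * card F * (\<mu> * q)" using cW by (metis of_nat_le_iff of_nat_mult order_trans)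
qed

lemma regular_arcE:
  assumes "regular_arc_lift \<gamma> L C"
  obtains \<gamma>' \<gamma>'' \<kappa> where "0 < L" "L < 1" "C = torus_proj ` \<gamma> ` {0..L}"
    "\<And>t. t \<in> {0..L} \<Longrightarrow> (\<gamma> has_vector_derivative \<gamma>' t) (at t within {0..L})"
    "\<And>t. t \<in> {0..L} \<Longrightarrow> (\<gamma>' has_vector_derivative \<gamma>'' t) (at t within {0..L})"
    "continuous_on {0..L} \<gamma>''" "\<And>t. t \<in> {0..L} \<Longrightarrow> norm (\<gamma>' t) = 1" "\<kappa> > 0"
    "\<And>t. t \<in> {0..L} \<Longrightarrow> \<kappa> < norm (\<gamma>'' t)" "\<And>t. t \<in> {0..L} \<Longrightarrow> norm (\<gamma>'' t) < 2 * \<kappa>" "2 * \<kappa> * L < 1"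
  using assms unfolding regular_arc_lift_def by (elim conjE exE) (rule that; blast)

lemma regular_arc_continuous: "regular_arc_lift \<gamma> L C \<Longrightarrow> continuous_on {0..L} \<gamma>"
  by (erule regular_arcE) (metis has_vector_derivative_continuous continuous_on_eq_continuous_within)

text \<open>The curvature is eliminated in favour of the width, by \<open>width \<le> 2 \<kappa> L\<^sup>2\<close>.\<close>

lemma regular_arc_oscillation:
  assumes reg: "regular_arc_lift \<gamma> L C" and w: "0 < w" "w < width (\<gamma> ` {0..L})"
    and d: "0 < d" "d \<le> norm \<eta>"
  shows "norm (integral {0..L} (\<lambda>t. ee (\<gamma> t \<bullet> \<eta>))) \<le> 40 * L * (w * d / 2) powr (-1/4)"
proof (rule regular_arcE [OF reg])
  fix \<gamma>' \<gamma>'' \<kappa>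
  assume L: "0 < L" and der: "\<And>t. t \<in> {0..L} \<Longrightarrow> (\<gamma> has_vector_derivative \<gamma>' t) (at t within {0..L})"
    "\<And>t. t \<in> {0..L} \<Longrightarrow> (\<gamma>' has_vector_derivative \<gamma>'' t) (at t within {0..L})"
    and cont: "continuous_on {0..L} \<gamma>''" and unit: "\<And>t. t \<in> {0..L} \<Longrightarrow> norm (\<gamma>' t) = 1"
    and \<kappa>: "\<kappa> > 0" "\<And>t. t \<in> {0..L} \<Longrightarrow> \<kappa> < norm (\<gamma>'' t)" "\<And>t. t \<in> {0..L} \<Longrightarrow> norm (\<gamma>'' t) < 2 * \<kappa>"
    and turn: "2 * \<kappa> * L < 1"
  have "width (\<gamma> ` {0..L}) \<le> 2 * \<kappa> * L\<^sup>2" by (rule width_le [OF L der unit \<kappa>(3)])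
  then have "w / 2 \<le> \<kappa> * L\<^sup>2" using w by linarith
  then have "(w / 2) * d \<le> (\<kappa> * L\<^sup>2) * norm \<eta>" using w d \<kappa> by (intro mult_mono) auto
  then have "(\<kappa> * L\<^sup>2 * norm \<eta>) powr (-1/4) \<le> (w * d / 2) powr (-1/4)"
    using w d by (intro powr_mono2') auto
  then have "40 * L * (\<kappa> * L\<^sup>2 * norm \<eta>) powr (-1/4) \<le> 40 * L * (w * d / 2) powr (-1/4)"
    using L by (intro mult_left_mono) auto
  moreover have "\<eta> \<noteq> 0" using d by auto
  then have "norm (integral {0..L} (\<lambda>t. ee (\<gamma> t \<bullet> \<eta>))) \<le> 40 * L * (\<kappa> * L\<^sup>2 * norm \<eta>) powr (-1/4)"
    using L der cont unit \<kappa> turn by (intro arc_oscillation [where \<gamma>' = \<gamma>' and \<gamma>'' = \<gamma>''])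
  ultimately show ?thesis by linarith
qed

text \<open>On the arc the cluster equals minus the rest of the sum. Hence its square modulus is, up to sign,
a sum of products of a frequency of \<open>J\<close> with one outside \<open>J\<close>, all of which oscillate; there are no
diagonal terms.\<close>

lemma cluster_mean_square:
  fixes A d w :: real
  assumes reg: "regular_arc_lift \<gamma> L C" and w: "0 < w" "w < width (\<gamma> ` {0..L})"
    and F: "finite F" "J \<subseteq> F" and A: "A \<ge> 0" "\<And>\<xi>. \<xi> \<in> F \<Longrightarrow> norm (a \<xi>) \<le> A"
    and zero: "\<And>t. t \<in> {0..L} \<Longrightarrow> trig F a (\<gamma> t) = 0"
    and d: "0 < d" "\<And>\<xi> \<eta>. \<xi> \<in> J \<Longrightarrow> \<eta> \<in> F - J \<Longrightarrow> d \<le> norm (\<xi> - \<eta>)"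
  shows "integral {0..L} (\<lambda>t. (norm (trig J a (\<gamma> t)))\<^sup>2)
     \<le> card F * card J * A\<^sup>2 * (40 * L * (w * d / 2) powr (-1/4))"
proof -
  have L: "L > 0" using reg by (simp add: regular_arc_lift_def)
  have c\<gamma>: "continuous_on {0..L} \<gamma>" by (rule regular_arc_continuous [OF reg])
  have fJ: "finite J" "finite (F - J)" using F finite_subset by auto
  define Q where "Q = 40 * L * (w * d / 2) powr (-1/4)"
  have Q0: "Q \<ge> 0" using L by (simp add: Q_def)
  define g where "g \<eta> \<xi> t = (a \<eta> * cnj (a \<xi>)) * ee (\<gamma> t \<bullet> (\<eta> - \<xi>))" for \<eta> \<xi> t
  have int: "g \<eta> \<xi> integrable_on {0..L}" for \<eta> \<xi>
    unfolding g_def by (intro integrable_continuous_interval continuous_intros c\<gamma>)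
  have expand: "of_real ((norm (trig J a (\<gamma> t)))\<^sup>2) = - (\<Sum>\<eta>\<in>F - J. \<Sum>\<xi>\<in>J. g \<eta> \<xi> t)" if t: "t \<in> {0..L}" for t
  proof -
    have "trig F a (\<gamma> t) = trig (F - J) a (\<gamma> t) + trig J a (\<gamma> t)"
      unfolding trig_def by (rule sum.subset_diff [OF F(2,1)])
    then have "trig J a (\<gamma> t) = - trig (F - J) a (\<gamma> t)" using zero [OF t] by (simp add: eq_neg_iff_add_eq_0 add.commute)
    then have "of_real ((norm (trig J a (\<gamma> t)))\<^sup>2) = - (trig (F - J) a (\<gamma> t) * cnj (trig J a (\<gamma> t)))"
      using complex_norm_square [of "trig J a (\<gamma> t)"] by (metis mult_minus_left)
    also have "trig (F - J) a (\<gamma> t) * cnj (trig J a (\<gamma> t)) = (\<Sum>\<eta>\<in>F - J. \<Sum>\<xi>\<in>J. g \<eta> \<xi> t)"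
      unfolding trig_def cnj_sum sum_product g_def
      by (intro sum.cong refl) (simp add: inner_diff_right ee_diff mult_ac)
    finally show ?thesis .
  qed
  have int2: "(\<lambda>t. (norm (trig J a (\<gamma> t)))\<^sup>2) integrable_on {0..L}"
    unfolding trig_def by (intro integrable_continuous_interval continuous_intros c\<gamma>)
  have "of_real (integral {0..L} (\<lambda>t. (norm (trig J a (\<gamma> t)))\<^sup>2)) =
      integral {0..L} (\<lambda>t. complex_of_real ((norm (trig J a (\<gamma> t)))\<^sup>2))"
    by (rule integral_linear [OF int2 bounded_linear_of_real, unfolded o_def, symmetric])
  also have "\<dots> = integral {0..L} (\<lambda>t. - (\<Sum>\<eta>\<in>F - J. \<Sum>\<xi>\<in>J. g \<eta> \<xi> t))"
    by (rule integral_cong) (rule expand)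
  also have "\<dots> = - (\<Sum>\<eta>\<in>F - J. \<Sum>\<xi>\<in>J. integral {0..L} (g \<eta> \<xi>))"
    using fJ int by (simp add: integral_sum integrable_sum)
  finally have eq: "of_real (integral {0..L} (\<lambda>t. (norm (trig J a (\<gamma> t)))\<^sup>2)) = - (\<Sum>\<eta>\<in>F - J. \<Sum>\<xi>\<in>J. integral {0..L} (g \<eta> \<xi>))" .
  have "norm (complex_of_real (integral {0..L} (\<lambda>t. (norm (trig J a (\<gamma> t)))\<^sup>2))) \<le> (\<Sum>\<eta>\<in>F - J. \<Sum>\<xi>\<in>J. A\<^sup>2 * Q)"
    unfolding eq norm_minus_cancel
  proof (intro sum_norm_le)
    fix \<eta> \<xi> assume \<eta>: "\<eta> \<in> F - J" and \<xi>: "\<xi> \<in> J"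
    have "integral {0..L} (g \<eta> \<xi>) = (a \<eta> * cnj (a \<xi>)) * integral {0..L} (\<lambda>t. ee (\<gamma> t \<bullet> (\<eta> - \<xi>)))"
      unfolding g_def by simp
    then have "norm (integral {0..L} (g \<eta> \<xi>)) = (norm (a \<eta>) * norm (a \<xi>)) * norm (integral {0..L} (\<lambda>t. ee (\<gamma> t \<bullet> (\<eta> - \<xi>))))"
      by (simp add: norm_mult)
    also have "\<dots> \<le> (A * A) * Q"
    proof (intro mult_mono)
      show "norm (integral {0..L} (\<lambda>t. ee (\<gamma> t \<bullet> (\<eta> - \<xi>)))) \<le> Q"
        unfolding Q_def using d(2) [OF \<xi> \<eta>] by (intro regular_arc_oscillation [OF reg w d(1)]) (simp add: norm_minus_commute)
    qed (use A \<eta> \<xi> F in auto)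
    finally show "norm (integral {0..L} (g \<eta> \<xi>)) \<le> A\<^sup>2 * Q" by (simp add: power2_eq_square)
  qed
  also have "\<dots> = card (F - J) * card J * (A\<^sup>2 * Q)" by simp
  also have "\<dots> \<le> card F * card J * (A\<^sup>2 * Q)"
    using card_mono [of F "F - J"] F Q0 by (intro mult_right_mono) (auto intro!: mult_right_mono)
  finally have "\<bar>integral {0..L} (\<lambda>t. (norm (trig J a (\<gamma> t)))\<^sup>2)\<bar> \<le> card F * card J * (A\<^sup>2 * Q)"
    by (simp only: norm_of_real)
  then show ?thesis unfolding Q_def by (simp add: mult.assoc)
qed

lemma cluster_small_half:
  fixes A d w h :: real
  assumes reg: "regular_arc_lift \<gamma> L C" and w: "0 < w" "w < width (\<gamma> ` {0..L})"
    and F: "finite F" "J \<subseteq> F" and A: "A > 0" "\<And>\<xi>. \<xi> \<in> F \<Longrightarrow> norm (a \<xi>) \<le> A"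
    and zero: "\<And>t. t \<in> {0..L} \<Longrightarrow> trig F a (\<gamma> t) = 0"
    and d: "0 < d" "\<And>\<xi> \<eta>. \<xi> \<in> J \<Longrightarrow> \<eta> \<in> F - J \<Longrightarrow> d \<le> norm (\<xi> - \<eta>)"
    and h: "0 < h" "card F * card J * (40 * (w * d / 2) powr (-1/4)) \<le> h\<^sup>2 / 2"
  defines "T \<equiv> {t \<in> {0..L}. norm (trig J a (\<gamma> t)) \<le> h * A}"
  shows "compact T" "L / 2 \<le> measure lebesgue T"
proof -
  have L: "L > 0" using reg by (simp add: regular_arc_lift_def)
  have c\<gamma>: "continuous_on {0..L} \<gamma>" by (rule regular_arc_continuous [OF reg])
  have ct: "continuous_on {0..L} (\<lambda>t. norm (trig J a (\<gamma> t)))"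
    unfolding trig_def by (intro continuous_intros c\<gamma>)
  have "closedin (top_of_set {0..L}) ({0..L} \<inter> (\<lambda>t. norm (trig J a (\<gamma> t))) -` {..h * A})"
    by (rule continuous_closedin_preimage [OF ct closed_atMost])
  then have "closed ({0..L} \<inter> (\<lambda>t. norm (trig J a (\<gamma> t))) -` {..h * A})"
    by (rule closedin_closed_trans) simp
  moreover have Teq: "T = {0..L} \<inter> (\<lambda>t. norm (trig J a (\<gamma> t))) -` {..h * A}" by (auto simp: T_def)
  ultimately show cT: "compact T"
    by (auto intro: bounded_subset [OF bounded_closed_interval] simp: compact_eq_bounded_closed)
  have TL: "T \<subseteq> {0..L}" by (auto simp: T_def)
  have iT: "(indicator T :: real \<Rightarrow> real) integrable_on {0..L}" "integral {0..L} (indicator T :: real \<Rightarrow> real) = measure lebesgue T"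
    using lmeasurable_compact [OF cT] TL by (auto simp: integrable_on_indicator integral_indicator Int_absorb2)
  have int1: "(\<lambda>t. (h * A)\<^sup>2 * (1 - indicator T t)) integrable_on {0..L}"
    using iT by (intro integrable_on_mult_right integrable_diff) auto
  have "(h * A)\<^sup>2 * (L - measure lebesgue T) = integral {0..L} (\<lambda>t. (h * A)\<^sup>2 * (1 - indicator T t))"
  proof -
    have "integral {0..L} (\<lambda>t. 1 - indicat_real T t) = integral {0..L} (\<lambda>t. 1) - integral {0..L} (indicat_real T)"
      using iT by (intro integral_diff) auto
    then show ?thesis using iT L by simp
  qed
  also have "\<dots> \<le> integral {0..L} (\<lambda>t. (norm (trig J a (\<gamma> t)))\<^sup>2)"
  proof (rule integral_le [OF int1])
    show "(\<lambda>t. (norm (trig J a (\<gamma> t)))\<^sup>2) integrable_on {0..L}"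
      by (intro integrable_continuous_interval continuous_intros ct)
    fix t assume "t \<in> {0..L}"
    then show "(h * A)\<^sup>2 * (1 - indicator T t) \<le> (norm (trig J a (\<gamma> t)))\<^sup>2"
      using h A by (cases "t \<in> T") (auto simp: T_def intro!: power_mono)
  qed
  also have "\<dots> \<le> card F * card J * A\<^sup>2 * (40 * L * (w * d / 2) powr (-1/4))"
    using A by (intro cluster_mean_square [OF reg w F _ _ zero d]) auto
  also have "\<dots> = (card F * card J * (40 * (w * d / 2) powr (-1/4))) * (L * A\<^sup>2)" by simp
  also have "\<dots> \<le> (h\<^sup>2 / 2) * (L * A\<^sup>2)" using h L by (intro mult_right_mono) auto
  also have "\<dots> = (h * A)\<^sup>2 * (L / 2)" by (simp add: power_mult_distrib)
  finally have "L - measure lebesgue T \<le> L / 2" using h A by (simp add: mult_le_cancel_left_pos)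
  then show "L / 2 \<le> measure lebesgue T" by simp
qed

section \<open>Lengths from intersections with lines\<close>

lemma measure_le_projection:
  fixes g g' :: "real \<Rightarrow> real"
  assumes d: "\<And>t. t \<in> {a..b} \<Longrightarrow> (g has_real_derivative g' t) (at t within {a..b})"
    and steep: "\<And>t. t \<in> {a..b} \<Longrightarrow> 1/4 \<le> \<bar>g' t\<bar>"
    and T: "compact T" "T \<subseteq> {a..b}"
  shows "compact (g ` T)" "measure lebesgue T \<le> 4 * measure lebesgue (g ` T)"
proof -
  have cg: "continuous_on {a..b} g"
    using d has_field_derivative_imp_has_derivative has_derivative_continuous_on
    by (metis (no_types, lifting) DERIV_continuous continuous_on_eq_continuous_within)
  then show cgT: "compact (g ` T)" using T by (intro compact_continuous_image) (auto intro: continuous_on_subset)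
  have less: "g s \<noteq> g t" if "s \<in> {a..b}" "t \<in> {a..b}" "s < t" for s t
  proof -
    have "\<And>x. s \<le> x \<Longrightarrow> x \<le> t \<Longrightarrow> (g has_derivative (*) (g' x)) (at x within {s..t})"
      using d that unfolding has_field_derivative_def
      by (metis (full_types) atLeastAtMost_iff atLeastatMost_subset_iff has_derivative_subset order_trans)
    from mvt_simple [OF that(3) this] obtain z where z: "z \<in> {s<..<t}" "g t - g s = g' z * (t - s)" by blast
    moreover have "g' z \<noteq> 0" using steep [of z] z that by auto
    ultimately show ?thesis using that by auto
  qed
  have inj: "inj_on g T"
  proof (rule linorder_inj_onI)
    show "g x \<noteq> g y" if "x < y" "x \<in> T" "y \<in> T" for x y
      using less [of x y] that subsetD [OF T(2)] by simp
  qed auto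
  have T': "T \<in> lmeasurable" "g ` T \<in> lmeasurable" using T cgT lmeasurable_compact by auto
  have "(\<lambda>x. \<bar>g' x\<bar> * 1) absolutely_integrable_on T \<and> integral T (\<lambda>x. \<bar>g' x\<bar> * 1) = measure lebesgue (g ` T)
     \<longleftrightarrow> (\<lambda>x. 1::real) absolutely_integrable_on (g ` T) \<and> integral (g ` T) (\<lambda>x. 1) = measure lebesgue (g ` T)"
  proof (rule has_absolute_integral_change_of_variables_1' [where f = "\<lambda>x. 1"])
    show "(g has_real_derivative g' x) (at x within T)" if "x \<in> T" for x
      using d T that by (meson DERIV_subset subsetD)
  qed (use T' inj in auto)
  moreover have "(\<lambda>x. 1::real) absolutely_integrable_on (g ` T)" using T' by (simp add: absolutely_integrable_on_const)
  moreover have "integral (g ` T) (\<lambda>x. 1) = measure lebesgue (g ` T)" using T' by (simp add: lmeasure_integral)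
  ultimately have ai: "(\<lambda>x. \<bar>g' x\<bar>) absolutely_integrable_on T" "integral T (\<lambda>x. \<bar>g' x\<bar>) = measure lebesgue (g ` T)"
    by auto
  have "measure lebesgue T * (1/4) = integral T (\<lambda>x. 1 * (1/4))"
    using T' by (subst integral_mult_left) (simp_all add: lmeasure_integral)
  also have "\<dots> \<le> integral T (\<lambda>x. \<bar>g' x\<bar>)"
    using T T' steep ai by (intro integral_le) (auto simp: integrable_on_const set_lebesgue_integral_eq_integral)
  finally show "measure lebesgue T \<le> 4 * measure lebesgue (g ` T)" using ai by simp
qed

text \<open>A form of Crofton's formula. Each arc is translated by an integer in direction \<open>i\<close> so that it projects
into \<open>{-1..2}\<close>. As the arcs are disjoint modulo the lattice, the number of them that project to a
point \<open>s\<close> is at most the number of points of \<open>Z\<close>, modulo 1, on the line over \<open>s\<close>. This number is at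
most \<open>K0\<close>, except over \<open>Bad\<close>, where it is at most \<open>K1\<close>, and over the null set \<open>N\<close>.\<close>

lemma crofton_bound:
  fixes \<F> :: "'c set" and \<gamma> \<gamma>' :: "'c \<Rightarrow> real \<Rightarrow> real^2" and a b :: "'c \<Rightarrow> real" and Z :: "(real^2) set"
    and K0 K1 m :: real
  assumes ij: "i \<noteq> j" and fin: "finite \<F>"
    and ab: "\<And>c. c \<in> \<F> \<Longrightarrow> a c \<le> b c \<and> b c - a c \<le> 1"
    and d: "\<And>c t. c \<in> \<F> \<Longrightarrow> t \<in> {a c..b c} \<Longrightarrow> (\<gamma> c has_vector_derivative \<gamma>' c t) (at t within {a c..b c})"
    and speed: "\<And>c t. c \<in> \<F> \<Longrightarrow> t \<in> {a c..b c} \<Longrightarrow> norm (\<gamma>' c t) \<le> 1"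
    and steep: "\<And>c t. c \<in> \<F> \<Longrightarrow> t \<in> {a c..b c} \<Longrightarrow> 1/4 \<le> \<bar>\<gamma>' c t $ i\<bar>"
    and T: "\<And>c. c \<in> \<F> \<Longrightarrow> compact (T c) \<and> T c \<subseteq> {a c..b c}"
    and Z: "\<And>c t. c \<in> \<F> \<Longrightarrow> t \<in> T c \<Longrightarrow> \<gamma> c t \<in> Z" "\<And>x z. x \<in> Z \<Longrightarrow> z \<in> int_lattice \<Longrightarrow> x + z \<in> Z"
    and disj: "\<And>c c' t t'. c \<in> \<F> \<Longrightarrow> c' \<in> \<F> \<Longrightarrow> t \<in> T c \<Longrightarrow> t' \<in> T c' \<Longrightarrow> \<gamma> c t - \<gamma> c' t' \<in> int_lattice \<Longrightarrow> c = c'"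
    and N: "N \<in> null_sets lborel" and Bad: "Bad \<in> sets lborel" "emeasure lborel Bad \<le> ennreal m" and K: "0 \<le> K0" "0 \<le> K1" "0 \<le> m"
    and all: "\<And>s. s \<in> {-1..2} - N \<Longrightarrow> finite {y \<in> {0..<1}. line_pt i s y \<in> Z} \<and> card {y \<in> {0..<1}. line_pt i s y \<in> Z} \<le> K1"
    and good: "\<And>s. s \<in> {-1..2} - N \<Longrightarrow> s \<notin> Bad \<Longrightarrow> card {y \<in> {0..<1}. line_pt i s y \<in> Z} \<le> K0"
  shows "(\<Sum>c\<in>\<F>. measure lebesgue (T c)) \<le> 4 * (3 * K0 + K1 * m)"
proof -
  define n where "n c = real_of_int \<lfloor>\<gamma> c (a c) $ i\<rfloor>" for c
  define g where "g c t = \<gamma> c t $ i - n c" for c t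
  define U where "U c = g c ` T c" for c
  have dg: "(g c has_real_derivative \<gamma>' c t $ i) (at t within {a c..b c})" if "c \<in> \<F>" "t \<in> {a c..b c}" for c t
    using bounded_linear.has_vector_derivative [OF bounded_linear_vec_nth d [OF that], of i]
    unfolding g_def has_real_derivative_iff_has_vector_derivative [symmetric]
    by (auto intro!: derivative_eq_intros)
  have cU: "compact (U c)" and mU: "measure lebesgue (T c) \<le> 4 * measure lebesgue (U c)" if "c \<in> \<F>" for c
    unfolding U_def using measure_le_projection [OF dg [OF that] steep [OF that], of "T c"] T [OF that] by auto
  have Urange: "U c \<subseteq> {-1..2}" if c: "c \<in> \<F>" for c
  proof
    fix s assume "s \<in> U c"
    then obtain t where t: "t \<in> T c" "s = g c t" by (auto simp: U_def)
    have tt: "t \<in> {a c..b c}" using t T [OF c] by auto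
    have "norm (g c t - g c (a c)) \<le> 1 * norm (t - a c)"
    proof (rule field_differentiable_bound [where S = "{a c..b c}" and f' = "\<lambda>t. \<gamma>' c t $ i"])
      show "norm (\<gamma>' c u $ i) \<le> 1" if "u \<in> {a c..b c}" for u
        using component_le_norm_cart [of "\<gamma>' c u" i] speed [OF c that] by simp
    qed (use dg c tt in auto)
    also have "\<dots> \<le> 1" using tt ab [OF c] by simp
    finally have "\<bar>g c t - g c (a c)\<bar> \<le> 1" by simp
    moreover have "0 \<le> g c (a c)" "g c (a c) \<le> 1" unfolding g_def n_def by linarith+
    ultimately show "s \<in> {-1..2}" unfolding t atLeastAtMost_iff by linarith
  qed
  have count: "card {c\<in>\<F>. s \<in> U c} \<le> card {y \<in> {0..<1}. line_pt i s y \<in> Z}" if s: "s \<in> {-1..2} - N" for s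
  proof -
    have "\<forall>c\<in>{c\<in>\<F>. s \<in> U c}. \<exists>t. t \<in> T c \<and> s = g c t" by (auto simp: U_def)
    then obtain \<tau> where \<tau>: "\<And>c. c \<in> {c\<in>\<F>. s \<in> U c} \<Longrightarrow> \<tau> c \<in> T c \<and> s = g c (\<tau> c)" by metis
    define y where "y c = \<gamma> c (\<tau> c) $ j" for c
    \<comment> \<open>The representative of the point with \<open>i\<close>-th coordinate \<open>s\<close> and \<open>j\<close>-th coordinate in \<open>{0..<1}\<close>
    differs from it by the lattice vector \<open>z c\<close>.\<close>
    define z where "z c = line_pt i (n c) (of_int \<lfloor>y c\<rfloor>)" for c
    have zl: "z c \<in> int_lattice" for c by (auto simp: int_lattice_def z_def line_pt_def n_def)
    have eq: "\<gamma> c (\<tau> c) = line_pt i s (frac (y c)) + z c" if "c \<in> {c\<in>\<F>. s \<in> U c}" for c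
      using \<tau> [OF that] ij by (simp add: vec2_eq_iff [OF ij] line_pt_nth z_def g_def y_def frac_def)
    have inj: "inj_on (\<lambda>c. frac (y c)) {c\<in>\<F>. s \<in> U c}"
    proof (rule inj_onI)
      fix c c' assume c: "c \<in> {c\<in>\<F>. s \<in> U c}" "c' \<in> {c\<in>\<F>. s \<in> U c}" and f: "frac (y c) = frac (y c')"
      have "\<gamma> c (\<tau> c) - \<gamma> c' (\<tau> c') = z c - z c'" using eq [OF c(1)] eq [OF c(2)] f by simp
      then have "\<gamma> c (\<tau> c) - \<gamma> c' (\<tau> c') \<in> int_lattice" using int_lattice_diff zl by simp
      then show "c = c'" using disj c \<tau> [OF c(1)] \<tau> [OF c(2)] by blast
    qed
    have "(\<lambda>c. frac (y c)) ` {c\<in>\<F>. s \<in> U c} \<subseteq> {y \<in> {0..<1}. line_pt i s y \<in> Z}"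
    proof (rule image_subsetI)
      fix c assume c: "c \<in> {c\<in>\<F>. s \<in> U c}"
      have "\<gamma> c (\<tau> c) \<in> Z" using Z(1) \<tau> [OF c] c by blast
      then have "\<gamma> c (\<tau> c) + - z c \<in> Z" using Z(2) int_lattice_uminus zl by blast
      then have "line_pt i s (frac (y c)) \<in> Z" using eq [OF c] by simp
      then show "frac (y c) \<in> {y \<in> {0..<1}. line_pt i s y \<in> Z}" by (simp add: frac_lt_1)
    qed
    then show ?thesis using all [OF s] card_inj_on_le [OF inj] by blast
  qed
  have pointwise: "(\<Sum>c\<in>\<F>. indicator (U c) s) \<le> ennreal K0 * indicator {-1..2} s + ennreal K1 * indicator Bad s" if s: "s \<notin> N" for s
  proof (cases "s \<in> {-1..2}")
    case True
    have sum: "(\<Sum>c\<in>\<F>. indicator (U c) s) = ennreal (card {c\<in>\<F>. s \<in> U c})"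
      using fin by (simp add: indicator_def sum.If_cases Int_def ennreal_of_nat_eq_real_of_nat of_bool_def)
    have c: "real (card {c\<in>\<F>. s \<in> U c}) \<le> card {y \<in> {0..<1}. line_pt i s y \<in> Z}" using count True s by simp
    show ?thesis
    proof (cases "s \<in> Bad")
      case False
      then have "real (card {c\<in>\<F>. s \<in> U c}) \<le> K0" using good [of s] c True s by auto
      then show ?thesis unfolding sum using True False by (simp add: ennreal_leI)
    next
      case b: True
      then have "real (card {c\<in>\<F>. s \<in> U c}) \<le> K1" using all [of s] c True s by auto
      then have "ennreal (card {c\<in>\<F>. s \<in> U c}) \<le> ennreal K0 + ennreal K1"
        using K by (simp add: ennreal_leI flip: ennreal_plus)
      then show ?thesis unfolding sum using True b by simp
    qed
  next
    case False
    then have "(\<Sum>c\<in>\<F>. indicator (U c) s) = (0::ennreal)"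
    proof (intro sum.neutral ballI)
      fix c assume "c \<in> \<F>"
      then have "s \<notin> U c" using Urange False by blast
      then show "indicator (U c) s = (0::ennreal)" by simp
    qed
    then show ?thesis by simp
  qed
  have Us: "U c \<in> sets borel" if "c \<in> \<F>" for c using cU [OF that] by (simp add: borel_compact)
  have "ennreal (\<Sum>c\<in>\<F>. measure lebesgue (U c)) = (\<Sum>c\<in>\<F>. emeasure lborel (U c))"
  proof -
    have "ennreal (measure lebesgue (U c)) = emeasure lborel (U c)" if "c \<in> \<F>" for c
      using emeasure_bounded_finite [OF compact_imp_bounded [OF cU [OF that]]] Us [OF that]
      by (subst emeasure_eq_ennreal_measure) (auto simp: measure_completion)
    then show ?thesis by (simp flip: sum_ennreal)
  qed
  also have "\<dots> = (\<Sum>c\<in>\<F>. \<integral>\<^sup>+ s. indicator (U c) s \<partial>lborel)"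
    using Us by (intro sum.cong refl) simp
  also have "\<dots> = (\<integral>\<^sup>+ s. (\<Sum>c\<in>\<F>. indicator (U c) s) \<partial>lborel)"
    using Us by (intro nn_integral_sum [symmetric]) simp
  also have "\<dots> \<le> (\<integral>\<^sup>+ s. ennreal K0 * indicator {-1..2} s + ennreal K1 * indicator Bad s \<partial>lborel)"
  proof (rule nn_integral_mono_AE)
    show "AE s in lborel. (\<Sum>c\<in>\<F>. indicator (U c) s) \<le> ennreal K0 * indicator {-1..2} s + ennreal K1 * indicator Bad s"
      using AE_not_in [OF N] by eventually_elim (rule pointwise)
  qed
  also have "\<dots> = ennreal K0 * emeasure lborel {-1..2::real} + ennreal K1 * emeasure lborel Bad"
    using Bad by (simp add: nn_integral_add nn_integral_cmult)
  also have "\<dots> \<le> ennreal K0 * ennreal 3 + ennreal K1 * ennreal m"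
    using Bad by (intro add_mono mult_left_mono) auto
  also have "\<dots> = ennreal (3 * K0 + K1 * m)"
    using K by (simp add: ennreal_mult mult.commute)
  finally have "(\<Sum>c\<in>\<F>. measure lebesgue (U c)) \<le> 3 * K0 + K1 * m"
    using K by (subst (asm) ennreal_le_iff) auto
  moreover have "(\<Sum>c\<in>\<F>. measure lebesgue (T c)) \<le> (\<Sum>c\<in>\<F>. 4 * measure lebesgue (U c))"
    by (intro sum_mono mU)
  ultimately show ?thesis by (simp flip: sum_distrib_left)
qed

section \<open>The sum over the arcs for fixed parameters\<close>

lemma torus_proj_eqI: assumes "x - y \<in> int_lattice" shows "torus_proj x = torus_proj y"
proof -
  have "z - y = (z - x) + (x - y)" "z - x = (z - y) - (x - y)" for z by simp_all
  then show ?thesis unfolding torus_proj_def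
    using assms int_lattice_add int_lattice_diff by (metis (no_types, lifting))
qed

lemma torus_proj_eqD: assumes "torus_proj x = torus_proj y" shows "x - y \<in> int_lattice"
proof -
  have "x \<in> torus_proj x" by (simp add: torus_proj_def int_lattice_def)
  then show ?thesis unfolding assms by (simp add: torus_proj_def)
qed

lemma unit_vector_component:
  assumes "norm (v :: real^2) = 1" shows "\<exists>i. 1/2 \<le> \<bar>v $ i\<bar>"
proof (rule ccontr)
  assume "\<not> ?thesis"
  then have lt: "\<bar>v $ i\<bar> \<le> 1/2" for i by (simp add: not_le less_imp_le)
  have "(v $ i)\<^sup>2 \<le> (1/2)\<^sup>2" for i using lt [of i] by (intro abs_le_square_iff [THEN iffD1]) simp
  from this [of 1] this [of 2] show False
    using norm_sq_2 [of v] assms by (simp add: power2_eq_square)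
qed

text \<open>At least half of each arc consists of zeros at which the cluster is small. Quarters of arcs are
grouped according to a coordinate that changes at speed at least \<open>1/4\<close> on them, which is possible
since the tangent turns by at most \<open>1/4\<close>, and each of the eight groups is
projected to that coordinate.\<close>

lemma arc_sum_bound:
  fixes a :: "real^2 \<Rightarrow> complex" and q r :: nat and \<mu> \<tau> D d h A lam w :: real
    and \<F> :: "(real^2) set set set" and \<gamma> :: "(real^2) set set \<Rightarrow> real \<Rightarrow> real^2" and L :: "(real^2) set set \<Rightarrow> real"
  defines "F \<equiv> lattice_circle (lam\<^sup>2)"
  assumes \<phi>: "\<And>x. complex_of_real (\<phi> x) = trig F a x"
    and J: "J \<subseteq> F" "\<xi>\<^sub>0 \<in> J" "card J \<le> Suc r" "\<And>\<xi>. \<xi> \<in> J \<Longrightarrow> norm (\<xi> - \<xi>\<^sub>0) \<le> D"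
    and sep: "0 < d" "\<And>\<xi> \<eta>. \<xi> \<in> J \<Longrightarrow> \<eta> \<in> F - J \<Longrightarrow> d \<le> norm (\<xi> - \<eta>)"
    and A: "norm (a \<xi>\<^sub>0) = A" "A > 0" "\<And>\<xi>. \<xi> \<in> F \<Longrightarrow> norm (a \<xi>) \<le> A"
    and q: "0 < lam" "2 * lam < q" and D\<mu>: "D \<le> (\<mu> / 40) ^ (2 ^ r) * q" and \<mu>: "0 < \<mu>" "\<mu> \<le> 1"
    and main: "2 ^ r * (h + 7 * Suc r * D / q) < \<tau> * (\<mu> / 40) ^ (2 ^ r - 1)"
    and \<tau>: "0 < \<tau>" "\<tau> < 1" and h: "0 < h" "card F * card J * (40 * (w * d / 2) powr (-1/4)) \<le> h\<^sup>2 / 2" and w: "0 < w"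
    and fin: "finite \<F>" and disj: "pairwise disjnt \<F>"
    and arcs: "\<And>C. C \<in> \<F> \<Longrightarrow> regular_arc_lift (\<gamma> C) (L C) C \<and> C \<subseteq> nodal_set \<phi> \<and> w < width (\<gamma> C ` {0..L C})"
  shows "(\<Sum>C\<in>\<F>. L C) \<le> 64 * (3 * (2 * real (card F) * (\<mu> * real q)) + (2 * real (card F) * real q) * (18 * \<tau>))"
proof -
  have F: "finite F" "F \<subseteq> lattice_circle (lam\<^sup>2)" "F \<subseteq> int_lattice"
    unfolding F_def using finite_lattice_circle lattice_circleD(1) by auto
  define Z where "Z = {x. trig F a x = 0 \<and> norm (trig J a x) \<le> h * A}"
  define B where "B = 3 * (2 * real (card F) * (\<mu> * real q)) + (2 * real (card F) * real q) * (18 * \<tau>)"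
  have zero: "trig F a (\<gamma> C t) = 0" if C: "C \<in> \<F>" and t: "t \<in> {0..L C}" for C t
  proof -
    have "torus_proj (\<gamma> C t) \<in> C" using arcs [OF C] t by (auto simp: regular_arc_lift_def)
    then obtain x where x: "\<phi> x = 0" "torus_proj (\<gamma> C t) = torus_proj x"
      using arcs [OF C] unfolding nodal_set_def by blast
    have "trig F a (x + (\<gamma> C t - x)) = trig F a x"
      by (rule trig_periodic [OF F(3) torus_proj_eqD [OF x(2)]])
    then show ?thesis using x(1) \<phi> [of x] by simp
  qed
  define T where "T C = {t \<in> {0..L C}. norm (trig J a (\<gamma> C t)) \<le> h * A}" for C
  have T: "compact (T C)" "L C \<le> 2 * measure lebesgue (T C)" if C: "C \<in> \<F>" for C
  proof -
    have reg: "regular_arc_lift (\<gamma> C) (L C) C" and wd: "w < width (\<gamma> C ` {0..L C})"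
      using arcs [OF C] by blast+
    note half = cluster_small_half [where \<gamma> = "\<gamma> C" and L = "L C" and a = a,
        OF reg w wd F(1) J(1) A(2,3) zero [OF C] sep h, folded T_def]
    show "compact (T C)" by (rule half(1))
    show "L C \<le> 2 * measure lebesgue (T C)" using half(2) by simp
  qed
  have L: "0 < L C" "L C < 1" if "C \<in> \<F>" for C
    using arcs [OF that] by (auto simp: regular_arc_lift_def)
  define P where "P k C = {real k * (L C / 4)..real (Suc k) * (L C / 4)}" for k :: nat and C
  have P: "P k C \<subseteq> {0..L C}" if "C \<in> \<F>" "k < 4" for k C
  proof -
    have "real (Suc k) * (L C / 4) \<le> 4 * (L C / 4)"
      using L(1) [OF that(1)] that(2) by (intro mult_right_mono) auto
    moreover have "0 \<le> real k * (L C / 4)" using L(1) [OF that(1)] by simp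
    ultimately show ?thesis unfolding P_def by auto
  qed
  have "\<forall>C\<in>\<F>. \<exists>\<gamma>'. (\<forall>t\<in>{0..L C}. (\<gamma> C has_vector_derivative \<gamma>' t) (at t within {0..L C}) \<and> norm (\<gamma>' t) = 1) \<and>
      (\<forall>k<4. \<exists>i. \<forall>t\<in>P k C. 1/4 \<le> \<bar>\<gamma>' t $ i\<bar>)"
  proof
    fix C assume C: "C \<in> \<F>"
    from arcs [OF C] have reg: "regular_arc_lift (\<gamma> C) (L C) C" by blast
    obtain \<gamma>' \<gamma>'' \<kappa> where der: "\<And>t. t \<in> {0..L C} \<Longrightarrow> (\<gamma> C has_vector_derivative \<gamma>' t) (at t within {0..L C})"
      "\<And>t. t \<in> {0..L C} \<Longrightarrow> (\<gamma>' has_vector_derivative \<gamma>'' t) (at t within {0..L C})"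
      and unit: "\<And>t. t \<in> {0..L C} \<Longrightarrow> norm (\<gamma>' t) = 1" and \<kappa>: "\<kappa> > 0"
      "\<And>t. t \<in> {0..L C} \<Longrightarrow> norm (\<gamma>'' t) < 2 * \<kappa>" and turn: "2 * \<kappa> * L C < 1"
      by (rule regular_arcE [OF reg]) blast
    have "\<exists>i. \<forall>t\<in>P k C. 1/4 \<le> \<bar>\<gamma>' t $ i\<bar>" if k: "k < 4" for k
    proof -
      define t0 where "t0 = real k * (L C / 4)"
      have t0: "t0 \<in> P k C" using L [OF C] by (simp add: P_def t0_def)
      obtain i where i: "1/2 \<le> \<bar>\<gamma>' t0 $ i\<bar>" using unit_vector_component unit P [OF C k] t0 by blast
      have "1/4 \<le> \<bar>\<gamma>' t $ i\<bar>" if t: "t \<in> P k C" for t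
      proof -
        have "norm (\<gamma>' t - \<gamma>' t0) \<le> 2 * \<kappa> * \<bar>t - t0\<bar>"
          using vector_derivative_bound [of "L C" \<gamma>' \<gamma>'' "2 * \<kappa>" t0 t, OF der(2)] \<kappa> t t0 P [OF C k]
          by (meson less_imp_le subsetD)
        also have "\<dots> \<le> 2 * \<kappa> * (L C / 4)"
        proof (rule mult_left_mono)
          show "\<bar>t - t0\<bar> \<le> L C / 4" using t by (auto simp: P_def t0_def field_simps)
        qed (use \<kappa> in auto)
        also have "\<dots> \<le> 1/4" using turn by simp
        finally have "\<bar>(\<gamma>' t - \<gamma>' t0) $ i\<bar> \<le> 1/4" using component_le_norm_cart [of "\<gamma>' t - \<gamma>' t0" i] by linarith
        then have "\<bar>\<gamma>' t $ i - \<gamma>' t0 $ i\<bar> \<le> 1/4" by simp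
        then show ?thesis using i by linarith
      qed
      then show ?thesis by blast
    qed
    then show "\<exists>\<gamma>'. (\<forall>t\<in>{0..L C}. (\<gamma> C has_vector_derivative \<gamma>' t) (at t within {0..L C}) \<and> norm (\<gamma>' t) = 1) \<and>
      (\<forall>k<4. \<exists>i. \<forall>t\<in>P k C. 1/4 \<le> \<bar>\<gamma>' t $ i\<bar>)"
      using der(1) unit by blast
  qed
  then obtain \<gamma>' where \<gamma>': "\<And>C. C \<in> \<F> \<Longrightarrow>
      (\<forall>t\<in>{0..L C}. (\<gamma> C has_vector_derivative \<gamma>' C t) (at t within {0..L C}) \<and> norm (\<gamma>' C t) = 1) \<and>
      (\<forall>k<4. \<exists>i. \<forall>t\<in>P k C. 1/4 \<le> \<bar>\<gamma>' C t $ i\<bar>)"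
    by (metis (no_types, lifting))
  define \<G> where "\<G> k i = {C\<in>\<F>. \<forall>t\<in>P k C. 1/4 \<le> \<bar>\<gamma>' C t $ i\<bar>}" for k i
  have crofton: "(\<Sum>C\<in>\<G> k i. measure lebesgue (T C \<inter> P k C)) \<le> 4 * B" if k: "k < 4" for k i
  proof -
    obtain j where ij: "i \<noteq> j" by (metis zero_neq_one)
    define N where "N = {s \<in> {-1..2}. line_coeff i j F a (\<xi>\<^sub>0 $ j) s = 0}"
    define S where "S = {s \<in> {-1..2}. norm (line_coeff i j J a (\<xi>\<^sub>0 $ j) s) \<le> \<tau> * A}"
    have \<xi>F: "\<xi>\<^sub>0 \<in> F" using J by blast
    have JF: "J \<subseteq> lattice_circle (lam\<^sup>2)" using J F by blast
    have GF: "C \<in> \<F>" if "C \<in> \<G> k i" for C using that by (simp add: \<G>_def)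
    have "a \<xi>\<^sub>0 \<noteq> 0" using A by auto
    then have N: "N \<in> null_sets lborel"
      unfolding N_def by (rule line_coeff_zero_null [OF ij F(2) \<xi>F])
    note S = line_coeff_small [where a = a, OF ij JF J(2) A(1,2) \<tau>, folded S_def]
    have Zset: "{y \<in> {0..<1}. line_pt i s y \<in> Z} = {y \<in> {0..<1}. trig F a (line_pt i s y) = 0 \<and> norm (trig J a (line_pt i s y)) \<le> h * A}" for s
      by (simp add: Z_def)
    have JA: "norm (a \<xi>) \<le> A" if "\<xi> \<in> J" for \<xi> using A(3) J(1) that by blast
    have nz: "line_coeff i j F a (\<xi>\<^sub>0 $ j) s \<noteq> 0" if "s \<in> {-1..2} - N" for s
      using that by (auto simp: N_def)
    note count = line_zero_count [OF ij F(1,2) J(1,2) A(1,2) JA J(3,4) q D\<mu> \<mu> main nz, folded Zset]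
    show ?thesis
      unfolding B_def
    proof (rule crofton_bound [OF ij, where Z = Z and N = N and Bad = S and \<gamma> = \<gamma> and \<gamma>' = \<gamma>' and
          a = "\<lambda>C. real k * (L C / 4)" and b = "\<lambda>C. real (Suc k) * (L C / 4)"])
      show "finite (\<G> k i)" using fin by (simp add: \<G>_def)
      show "real k * (L C / 4) \<le> real (Suc k) * (L C / 4) \<and> real (Suc k) * (L C / 4) - real k * (L C / 4) \<le> 1"
        if "C \<in> \<G> k i" for C
        using L [OF GF [OF that]] by (simp add: field_simps)
      fix C t assume C: "C \<in> \<G> k i" and t: "t \<in> {real k * (L C / 4)..real (Suc k) * (L C / 4)}"
      have tP: "t \<in> P k C" using t by (simp add: P_def)
      have t0: "t \<in> {0..L C}" using P [OF GF [OF C] k] tP by blast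
      show "(\<gamma> C has_vector_derivative \<gamma>' C t) (at t within {real k * (L C / 4)..real (Suc k) * (L C / 4)})"
        using \<gamma>' [OF GF [OF C]] t0 P [OF GF [OF C] k] unfolding P_def
        by (blast intro: has_vector_derivative_within_subset)
      show "norm (\<gamma>' C t) \<le> 1" using \<gamma>' [OF GF [OF C]] t0 by auto
      show "1/4 \<le> \<bar>\<gamma>' C t $ i\<bar>" using C tP by (auto simp: \<G>_def)
    next
      fix C assume C: "C \<in> \<G> k i"
      show "compact (T C \<inter> P k C) \<and> T C \<inter> P k C \<subseteq> {real k * (L C / 4)..real (Suc k) * (L C / 4)}"
        using T(1) [OF GF [OF C]] by (auto simp: P_def intro: compact_Int_closed)
      fix t assume "t \<in> T C \<inter> P k C"
      then show "\<gamma> C t \<in> Z" using zero [OF GF [OF C]] by (auto simp: T_def Z_def)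
    next
      fix x z assume "x \<in> Z" "z \<in> int_lattice"
      then show "x + z \<in> Z" using F(3) J(1) by (auto simp: Z_def trig_periodic)
    next
      fix C C' t t' assume C: "C \<in> \<G> k i" "C' \<in> \<G> k i" and t: "t \<in> T C \<inter> P k C" "t' \<in> T C' \<inter> P k C'"
        and lat: "\<gamma> C t - \<gamma> C' t' \<in> int_lattice"
      have "torus_proj (\<gamma> C t) \<in> C" "torus_proj (\<gamma> C' t') \<in> C'"
        using arcs [OF GF [OF C(1)]] arcs [OF GF [OF C(2)]] t by (auto simp: regular_arc_lift_def T_def)
      then have "\<not> disjnt C C'" using torus_proj_eqI [OF lat] by (auto simp: disjnt_def)
      then show "C = C'" using disj GF C unfolding pairwise_def by blast
    next
      show "N \<in> null_sets lborel" "S \<in> sets lborel" "emeasure lborel S \<le> ennreal (18 * \<tau>)"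
        using N S by auto
      fix s assume s: "s \<in> {-1..2} - N"
      have "card {y \<in> {0..<1}. line_pt i s y \<in> Z} \<le> 2 * card F * q"
        by (rule count(2) [OF _ _ s])
      then have "real (card {y \<in> {0..<1}. line_pt i s y \<in> Z}) \<le> real (2 * card F * q)"
        by (rule of_nat_mono)
      moreover have "finite {y \<in> {0..<1}. line_pt i s y \<in> Z}"
        by (rule count(1) [OF _ _ s])
      ultimately show "finite {y \<in> {0..<1}. line_pt i s y \<in> Z} \<and> card {y \<in> {0..<1}. line_pt i s y \<in> Z} \<le> 2 * real (card F) * real q"
        by simp
      assume "s \<notin> S"
      have big: "\<tau> * A < norm (line_coeff i j J a (\<xi>\<^sub>0 $ j) s)" using s \<open>s \<notin> S\<close> by (auto simp: S_def)
      have "card {y \<in> {0..<1}. line_pt i s y \<in> Z} \<le> real (2 * card F) * (\<mu> * real q)"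
        by (rule count(3) [OF _ _ s big])
      then show "card {y \<in> {0..<1}. line_pt i s y \<in> Z} \<le> 2 * real (card F) * (\<mu> * real q)" by simp
    qed (use \<mu> \<tau> in auto)
  qed
  have piece: "measure lebesgue (T C) \<le> (\<Sum>k<4. \<Sum>i\<in>UNIV. if C \<in> \<G> k i then measure lebesgue (T C \<inter> P k C) else 0)" if C: "C \<in> \<F>" for C
  proof -
    have sub: "T C \<subseteq> (\<Union>k<4. T C \<inter> P k C)"
    proof
      fix t assume t: "t \<in> T C"
      then have "t \<in> {0..L C}" by (auto simp: T_def)
      then have "t \<in> P 0 C \<or> t \<in> P 1 C \<or> t \<in> P 2 C \<or> t \<in> P 3 C"
        by (auto simp: P_def)
      then show "t \<in> (\<Union>k<4. T C \<inter> P k C)" using t by auto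
    qed
    have lm: "T C \<inter> P k C \<in> lmeasurable" for k
      using T(1) [OF C] by (intro lmeasurable_compact compact_Int_closed) (auto simp: P_def)
    have un: "(\<Union>k<4. T C \<inter> P k C) \<in> lmeasurable"
      by (rule fmeasurable.finite_UN) (use lm in blast)+
    have "measure lebesgue (T C) \<le> measure lebesgue (\<Union>k<4. T C \<inter> P k C)"
      by (rule measure_mono_fmeasurable [OF sub fmeasurableD [OF lmeasurable_compact [OF T(1) [OF C]]] un])
    also have "\<dots> \<le> (\<Sum>k<4. measure lebesgue (T C \<inter> P k C))"
      using lm by (intro measure_UNION_le) auto
    also have "\<dots> \<le> (\<Sum>k<4. \<Sum>i\<in>UNIV. if C \<in> \<G> k i then measure lebesgue (T C \<inter> P k C) else 0)"
    proof (rule sum_mono)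
      fix k :: nat assume "k \<in> {..<4}"
      then obtain i where i: "C \<in> \<G> k i" using \<gamma>' [OF C] C unfolding \<G>_def by blast
      have "measure lebesgue (T C \<inter> P k C) = (\<Sum>i'\<in>{i}. if C \<in> \<G> k i' then measure lebesgue (T C \<inter> P k C) else 0)"
        using i by simp
      also have "\<dots> \<le> (\<Sum>i\<in>UNIV. if C \<in> \<G> k i then measure lebesgue (T C \<inter> P k C) else 0)"
        by (rule sum_mono2) auto
      finally show "measure lebesgue (T C \<inter> P k C) \<le> (\<Sum>i\<in>UNIV. if C \<in> \<G> k i then measure lebesgue (T C \<inter> P k C) else 0)" .
    qed
    finally show ?thesis .
  qed
  have "(\<Sum>C\<in>\<F>. L C) \<le> (\<Sum>C\<in>\<F>. 2 * measure lebesgue (T C))" using T by (intro sum_mono)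
  also have "\<dots> = 2 * (\<Sum>C\<in>\<F>. measure lebesgue (T C))" by (simp add: sum_distrib_left)
  also have "(\<Sum>C\<in>\<F>. measure lebesgue (T C)) \<le>
      (\<Sum>C\<in>\<F>. \<Sum>k<4. \<Sum>i\<in>UNIV. if C \<in> \<G> k i then measure lebesgue (T C \<inter> P k C) else 0)"
    by (intro sum_mono piece)
  also have "\<dots> = (\<Sum>k<4. \<Sum>i\<in>UNIV. \<Sum>C\<in>\<F>. if C \<in> \<G> k i then measure lebesgue (T C \<inter> P k C) else 0)"
    by (subst sum.swap, intro sum.cong refl, rule sum.swap)
  also have "\<dots> = (\<Sum>k<4. \<Sum>i\<in>UNIV. \<Sum>C\<in>\<G> k i. measure lebesgue (T C \<inter> P k C))"
  proof -
    have "\<G> k i = {C\<in>\<F>. C \<in> \<G> k i}" for k i by (auto simp: \<G>_def)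
    then have "(\<Sum>C\<in>\<F>. if C \<in> \<G> k i then measure lebesgue (T C \<inter> P k C) else 0) =
        (\<Sum>C\<in>\<G> k i. measure lebesgue (T C \<inter> P k C))" for k i
      using sum.inter_filter [OF fin, of "\<lambda>C. measure lebesgue (T C \<inter> P k C)" "\<lambda>C. C \<in> \<G> k i"] by simp
    then show ?thesis by (simp only:)
  qed
  also have "\<dots> \<le> (\<Sum>k<(4::nat). \<Sum>i\<in>(UNIV::2 set). 4 * B)"
    by (intro sum_mono crofton) auto
  also have "\<dots> = 32 * B" by simp
  finally show ?thesis unfolding B_def by simp
qed

section \<open>Choice of parameters\<close>

lemma eventually_powr_less:
  fixes K x y :: real assumes "x < y"
  shows "eventually (\<lambda>l. K * l powr x < l powr y) at_top"
proof -
  have "((\<lambda>l::real. K * l powr (x - y)) \<longlongrightarrow> K * 0) at_top"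
    using assms by (intro tendsto_intros tendsto_neg_powr filterlim_ident) auto
  then have "eventually (\<lambda>l. K * l powr (x - y) < 1) at_top"
    by (intro order_tendstoD(2)) auto
  then show ?thesis using eventually_gt_at_top [of 0]
    by eventually_elim (simp add: powr_diff divide_less_eq)
qed

lemma torus_eigenfunction_trig:
  assumes "torus_eigenfunction E \<phi>"
  obtains a A \<xi>\<^sub>0 where "\<And>x. complex_of_real (\<phi> x) = trig (lattice_circle E) a x"
    "\<xi>\<^sub>0 \<in> lattice_circle E" "norm (a \<xi>\<^sub>0) = A" "A > 0" "\<And>\<xi>. \<xi> \<in> lattice_circle E \<Longrightarrow> norm (a \<xi>) \<le> A" "E \<in> \<int>"
proof -
  let ?F = "lattice_circle E"
  obtain a x0 where a: "\<And>x. complex_of_real (\<phi> x) =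
      (\<Sum>\<xi>\<in>?F. a \<xi> * exp (2 * of_real pi * \<i> * of_real (x \<bullet> \<xi>)))" and x0: "\<phi> x0 \<noteq> 0"
    using assms unfolding torus_eigenfunction_def by blast
  have \<phi>: "complex_of_real (\<phi> x) = trig ?F a x" for x
    unfolding a trig_def ee_def by (intro sum.cong refl) (simp add: mult_ac)
  have "\<exists>\<xi>\<in>?F. a \<xi> \<noteq> 0"
  proof (rule ccontr)
    assume "\<not> ?thesis"
    then have "trig ?F a x0 = 0" unfolding trig_def by (intro sum.neutral) auto
    then show False using \<phi> [of x0] x0 by simp
  qed
  then obtain \<xi>1 where \<xi>1: "\<xi>1 \<in> ?F" "a \<xi>1 \<noteq> 0" by blast
  define A where "A = Max ((\<lambda>\<xi>. norm (a \<xi>)) ` ?F)"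
  have fin: "finite ((\<lambda>\<xi>. norm (a \<xi>)) ` ?F)" "(\<lambda>\<xi>. norm (a \<xi>)) ` ?F \<noteq> {}"
    using finite_lattice_circle \<xi>1 by auto
  obtain \<xi>\<^sub>0 where \<xi>\<^sub>0: "\<xi>\<^sub>0 \<in> ?F" "norm (a \<xi>\<^sub>0) = A" using Max_in [OF fin] unfolding A_def by auto
  have le: "norm (a \<xi>) \<le> A" if "\<xi> \<in> ?F" for \<xi> unfolding A_def using fin that by (intro Max_ge) auto
  have "0 < norm (a \<xi>1)" using \<xi>1 by simp
  then have Apos: "A > 0" using le [OF \<xi>1(1)] by linarith
  have EZ: "E \<in> \<int>"
    using lattice_circleD(2,3) [OF \<xi>1(1)] norm_sq_2 [of \<xi>1] by (metis Ints_add Ints_power)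
  show ?thesis by (rule that [OF \<phi> \<xi>\<^sub>0 Apos le EZ])
qed

theorem mainTheorem5:
  fixes \<epsilon> :: real
  assumes "cilleruelo_granville" and "\<epsilon> > 0"
  shows "\<exists>\<delta>>0. \<exists>\<Lambda>>0. \<forall>lam>\<Lambda>. \<forall>\<phi>. torus_eigenfunction (lam\<^sup>2) \<phi> \<longrightarrow>
           (\<forall>(\<C> :: (real^2) set set set) (\<gamma> :: (real^2) set set \<Rightarrow> real \<Rightarrow> real^2)
              (L :: (real^2) set set \<Rightarrow> real).
              pairwise disjnt \<C> \<and>
              (\<forall>C\<in>\<C>. regular_arc_lift (\<gamma> C) (L C) C \<and> C \<subseteq> nodal_set \<phi> \<and>
                      width (\<gamma> C ` {0..L C}) > lam powr (- 1 + \<epsilon>)) \<longrightarrow>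
              L summable_on \<C> \<and> (\<Sum>\<^sub>\<infinity>C\<in>\<C>. L C) < lam powr (1 - \<delta>))"
proof -
  note cg = assms(1)
  \<comment> \<open>A smaller \<open>\<epsilon>\<close> weakens the assumption on the width, so \<open>\<epsilon>\<close> may be taken at most \<open>1/2\<close>.\<close>
  define e where "e = min \<epsilon> (1/2)"
  have e: "0 < e" "e \<le> 1/2" "e \<le> \<epsilon>" using assms(2) by (auto simp: e_def)
  have "0 < e/4" "e/4 < 1" using e by auto
  from cg_close [OF cg this] obtain r :: nat where
    r: "\<forall>\<rho>>0. \<forall>d\<ge>0. \<forall>\<xi>\<^sub>0\<in>lattice_circle (\<rho>\<^sup>2). \<rho>\<^sup>2 \<in> \<int> \<longrightarrow> 6 * d < \<rho> powr (1 - e/4) \<longrightarrow>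
       card {\<xi> \<in> lattice_circle (\<rho>\<^sup>2). norm (\<xi> - \<xi>\<^sub>0) \<le> d} \<le> r" ..
  \<comment> \<open>The saving in the density: \<open>\<mu> = \<lambda> powr (- c)\<close> is chosen so large that \<open>\<mu> ^ (2 ^ r)\<close>, which the
  count of small values costs, is only \<open>\<lambda> powr (- e/256)\<close>.\<close>
  define c where "c = e / (256 * 2 ^ r)"
  have c: "0 < c" "c * 2 ^ r = e / 256" using e by (simp_all add: c_def)
  have ce: "c \<le> e / 256"
    unfolding c_def using e by (intro divide_left_mono) auto
  obtain CN :: real where CN: "CN > 0" "\<And>\<rho>. \<rho> \<ge> 1 \<Longrightarrow> \<rho>\<^sup>2 \<in> \<int> \<Longrightarrow> real (card (lattice_circle (\<rho>\<^sup>2))) \<le> CN * \<rho> powr (c/2)"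
  proof -
    have "0 < c/2" "c/2 < 1" using c ce e by auto
    from cg_total [OF cg this] show ?thesis using that by blast
  qed
  define M where "M = (40::real) ^ (2 ^ r)"
  have M: "M \<ge> 1" by (simp add: M_def)
  define K where "K = 2 ^ r * (1 + 7 * real (Suc r) * real r)"
  \<comment> \<open>In this order: the ring argument stays within the range of the conjecture; the mean square beats
  the threshold \<open>h\<close>; the two hypotheses of the count of small values; the final comparison.\<close>
  have "eventually (\<lambda>l. 6 * (real r + 1) * l powr (1 - e/2) < l powr (1 - e/4) \<and>
      160 * CN * real r * l powr (c/2 - e/8) < l powr (- e/32) \<and>
      real r * M * l powr (1 - e/2) < l powr (1 - e/256) \<and>
      K * M * l powr (- e/64) < l powr (- e/128 - e/256) \<and>
      8064 * CN * l powr (1 - c/2) < l powr (1 - c/4) \<and> 1 < l) at_top"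
    using e c ce by (intro eventually_conj eventually_powr_less eventually_gt_at_top) auto
  then obtain \<Lambda>0 where \<Lambda>0: "\<And>l. l \<ge> \<Lambda>0 \<Longrightarrow> 6 * (real r + 1) * l powr (1 - e/2) < l powr (1 - e/4) \<and>
      160 * CN * real r * l powr (c/2 - e/8) < l powr (- e/32) \<and>
      real r * M * l powr (1 - e/2) < l powr (1 - e/256) \<and>
      K * M * l powr (- e/64) < l powr (- e/128 - e/256) \<and>
      8064 * CN * l powr (1 - c/2) < l powr (1 - c/4) \<and> 1 < l"
    unfolding eventually_at_top_linorder by blast
  have bound: "(\<Sum>C\<in>\<F>. L C) \<le> 8064 * CN * lam powr (1 - c/2)"
    if lam: "lam > max \<Lambda>0 1" and eig: "torus_eigenfunction (lam\<^sup>2) \<phi>"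
      and fin: "finite \<F>" and disj: "pairwise disjnt \<F>"
      and arcs: "\<forall>C\<in>\<F>. regular_arc_lift (\<gamma> C) (L C) C \<and> C \<subseteq> nodal_set \<phi> \<and> width (\<gamma> C ` {0..L C}) > lam powr (- 1 + \<epsilon>)"
    for lam \<phi> and \<F> :: "(real^2) set set set" and \<gamma> :: "(real^2) set set \<Rightarrow> real \<Rightarrow> real^2" and L :: "(real^2) set set \<Rightarrow> real"
  proof -
    define F where "F = lattice_circle (lam\<^sup>2)"
    obtain a A \<xi>\<^sub>0 where \<phi>: "\<And>x. complex_of_real (\<phi> x) = trig F a x"
      and \<xi>\<^sub>0: "\<xi>\<^sub>0 \<in> F" and A: "norm (a \<xi>\<^sub>0) = A" "A > 0" "\<And>\<xi>. \<xi> \<in> F \<Longrightarrow> norm (a \<xi>) \<le> A" and int: "lam\<^sup>2 \<in> \<int>"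
      using torus_eigenfunction_trig [OF eig] unfolding F_def by metis
    have l1: "lam > 1" using lam by simp
    have big: "6 * (real r + 1) * lam powr (1 - e/2) < lam powr (1 - e/4)"
      "160 * CN * real r * lam powr (c/2 - e/8) < lam powr (- e/32)"
      "real r * M * lam powr (1 - e/2) < lam powr (1 - e/256)"
      "K * M * lam powr (- e/64) < lam powr (- e/128 - e/256)"
      using \<Lambda>0 [of lam] lam by auto
    define d where "d = lam powr (1 - e/2)"
    have d: "d > 0" using l1 by (simp add: d_def)
    have few: "card {\<xi>\<in>F. norm (\<xi> - \<xi>\<^sub>0) \<le> (real r + 1) * d} \<le> r"
      unfolding F_def using l1 d big(1) \<xi>\<^sub>0 int by (intro r [rule_format]) (auto simp: F_def d_def algebra_simps)
    have finF: "finite F" unfolding F_def by (rule finite_lattice_circle)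
    obtain J where J: "J \<subseteq> F" "\<xi>\<^sub>0 \<in> J" "card J \<le> r" "\<And>\<xi>. \<xi> \<in> J \<Longrightarrow> norm (\<xi> - \<xi>\<^sub>0) \<le> real r * d"
      and sep: "\<And>\<xi> \<eta>. \<xi> \<in> J \<Longrightarrow> \<eta> \<in> F - J \<Longrightarrow> d \<le> norm (\<xi> - \<eta>)"
      by (rule isolated_cluster [OF finF \<xi>\<^sub>0 d few]) (rule that)
    define N where "N = real (card F)"
    have N: "0 \<le> N" "N \<le> CN * lam powr (c/2)" using CN(2) [of lam] l1 int by (auto simp: N_def F_def)
    define q where "q = nat \<lfloor>2 * lam\<rfloor> + 1"
    have q: "2 * lam < q" "q \<le> 3 * lam" unfolding q_def using l1 by linarith+
    \<comment> \<open>The threshold \<open>h\<close> for the cluster is much smaller than the threshold \<open>\<tau>\<close> for the line coefficients.\<close>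
    define h where "h = lam powr (- e/64)"
    define \<tau> where "\<tau> = lam powr (- e/128)"
    define \<mu> where "\<mu> = lam powr (- c)"
    define w where "w = lam powr (- 1 + e)"
    have pos: "0 < h" "0 < \<tau>" "0 < \<mu>" "0 < w" using l1 by (auto simp: h_def \<tau>_def \<mu>_def w_def)
    have \<tau>1: "\<tau> < 1" and \<mu>1: "\<mu> \<le> 1" using l1 e c by (auto simp: \<tau>_def \<mu>_def powr_less_one powr_le1 powr_mono less_imp_le)
    have \<mu>pow: "(\<mu> / 40) ^ (2 ^ r) = lam powr (- e/256) / M"
    proof -
      have "\<mu> ^ (2 ^ r) = lam powr (- c * 2 ^ r)"
        unfolding \<mu>_def using l1 by (simp add: powr_powr flip: powr_realpow)
      also have "- c * 2 ^ r = - e/256" using c(2) by simp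
      finally show ?thesis by (simp add: power_divide M_def)
    qed
    have D\<mu>: "real r * d \<le> (\<mu> / 40) ^ (2 ^ r) * q"
    proof -
      have "real r * d * M \<le> lam powr (- e/256) * lam"
      proof -
        have "lam powr (1 - e/256) = lam powr (- e/256) * lam" using l1 by (simp add: powr_diff powr_minus_divide)
        then show ?thesis using big(3) by (simp add: d_def mult_ac)
      qed
      also have "\<dots> \<le> lam powr (- e/256) * q" using q l1 by (intro mult_left_mono) auto
      finally show ?thesis unfolding \<mu>pow using M by (simp add: field_simps)
    qed
    have main: "2 ^ r * (h + 7 * Suc r * (real r * d) / q) < \<tau> * (\<mu> / 40) ^ (2 ^ r - 1)"
    proof -
      have "d / q \<le> d / lam" using d q l1 by (intro divide_left_mono) auto
      also have "\<dots> = lam powr (- e/2)" using l1 by (simp add: d_def powr_diff powr_minus_divide)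
      also have "\<dots> \<le> h" unfolding h_def using l1 e by (intro powr_mono) auto
      finally have "7 * real (Suc r) * real r * (d / q) \<le> 7 * real (Suc r) * real r * h" by (intro mult_left_mono) auto
      then have "h + 7 * Suc r * (real r * d) / q \<le> (1 + 7 * real (Suc r) * real r) * h"
        by (simp add: algebra_simps add_divide_distrib)
      then have "2 ^ r * (h + 7 * Suc r * (real r * d) / q) \<le> K * h"
        unfolding K_def mult.assoc by (intro mult_left_mono) auto
      also have "\<dots> < lam powr (- e/128 - e/256) / M" using big(4) M by (simp add: h_def field_simps)
      also have "\<dots> = \<tau> * (\<mu> / 40) ^ (2 ^ r)" unfolding \<mu>pow \<tau>_def by (simp add: powr_add [symmetric])
      also have "\<dots> \<le> \<tau> * (\<mu> / 40) ^ (2 ^ r - 1)"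
        using pos \<mu>1 by (intro mult_left_mono power_decreasing) auto
      finally show ?thesis .
    qed
    have small: "card F * card J * (40 * (w * d / 2) powr (-1/4)) \<le> h\<^sup>2 / 2"
    proof -
      have wd: "w * d = lam powr (e/2)" unfolding w_def d_def powr_add [symmetric] by simp
      have "(w * d / 2) powr (-1/4) = lam powr (- e/8) * 2 powr (1/4)"
        unfolding wd using l1 by (simp add: powr_divide powr_powr powr_minus_divide)
      also have "\<dots> \<le> lam powr (- e/8) * 2"
        using powr_mono [of "1/4" 1 "2::real"] by (intro mult_left_mono) auto
      finally have X: "40 * (w * d / 2) powr (-1/4) \<le> 80 * lam powr (- e/8)" by simp
      have "N * card J * (40 * (w * d / 2) powr (-1/4)) \<le> (CN * lam powr (c/2)) * real r * (80 * lam powr (- e/8))"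
        using N J(3) CN(1) by (intro mult_mono [OF mult_mono X]) auto
      also have "\<dots> = 160 * CN * real r * lam powr (c/2 - e/8) / 2"
        by (simp add: powr_diff powr_minus_divide)
      also have "\<dots> \<le> lam powr (- e/32) / 2" using big(2) by simp
      also have "\<dots> = h\<^sup>2 / 2" using l1 by (simp add: h_def powr_powr flip: powr_realpow)
      finally show ?thesis by (simp add: N_def)
    qed
    have w\<epsilon>: "w \<le> lam powr (- 1 + \<epsilon>)" unfolding w_def using l1 e by (intro powr_mono) auto
    have "(\<Sum>C\<in>\<F>. L C) \<le> 64 * (3 * (2 * real (card F) * (\<mu> * real q)) + (2 * real (card F) * real q) * (18 * \<tau>))"
    proof (rule arc_sum_bound [where lam = lam and \<phi> = \<phi> and \<gamma> = \<gamma> and a = a and J = J and \<xi>\<^sub>0 = \<xi>\<^sub>0 and d = d and h = h and A = A and w = w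
          and r = r and D = "real r * d", folded F_def])
      show "regular_arc_lift (\<gamma> C) (L C) C \<and> C \<subseteq> nodal_set \<phi> \<and> w < width (\<gamma> C ` {0..L C})" if "C \<in> \<F>" for C
        using arcs that w\<epsilon> by force
    qed (use \<phi> J sep A d l1 q D\<mu> pos \<mu>1 main \<tau>1 small fin disj in \<open>simp_all\<close>)
    also have "\<dots> = 64 * (N * q) * (6 * \<mu> + 36 * \<tau>)" by (simp add: N_def algebra_simps)
    also have "\<dots> \<le> 64 * ((CN * lam powr (c/2)) * (3 * lam)) * (42 * \<mu>)"
    proof -
      have "\<tau> \<le> \<mu>" unfolding \<tau>_def \<mu>_def using l1 ce c(1) by (intro powr_mono) auto
      then show ?thesis using N q pos CN l1 by (intro mult_mono mult_left_mono) auto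
    qed
    also have "\<dots> = 8064 * CN * (lam powr (c/2) * lam powr 1 * lam powr (- c))" using l1 by (simp add: \<mu>_def)
    also have "lam powr (c/2) * lam powr 1 * lam powr (- c) = lam powr (1 - c/2)"
      unfolding powr_add [symmetric] by simp
    finally show ?thesis .
  qed
  show ?thesis
  proof (rule exI [of _ "c/4"], rule conjI, goal_cases)
    case 1
    show ?case using c by simp
  next
    case 2
    show ?case
    proof (rule exI [of _ "max \<Lambda>0 1"], intro conjI allI impI)
      show "0 < max \<Lambda>0 1" by simp
      fix lam \<phi> and \<C> :: "(real^2) set set set" and \<gamma> :: "(real^2) set set \<Rightarrow> real \<Rightarrow> real^2" and L :: "(real^2) set set \<Rightarrow> real"
      assume lam: "lam > max \<Lambda>0 1" and eig: "torus_eigenfunction (lam\<^sup>2) \<phi>"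
      assume *: "pairwise disjnt \<C> \<and> (\<forall>C\<in>\<C>. regular_arc_lift (\<gamma> C) (L C) C \<and> C \<subseteq> nodal_set \<phi> \<and>
                        width (\<gamma> C ` {0..L C}) > lam powr (- 1 + \<epsilon>))"
      have fin: "sum L \<F> \<le> 8064 * CN * lam powr (1 - c/2)" if "finite \<F>" "\<F> \<subseteq> \<C>" for \<F>
        using * that by (intro bound [OF lam eig]) (auto intro: pairwise_subset)
      have pos: "0 \<le> L C" if "C \<in> \<C>" for C using * that by (auto simp: regular_arc_lift_def)
      show sum: "L summable_on \<C>"
        by (rule nonneg_bdd_above_summable_on [OF pos]) (use fin in \<open>auto intro!: bdd_aboveI2\<close>)
      have "(\<Sum>\<^sub>\<infinity>C\<in>\<C>. L C) \<le> 8064 * CN * lam powr (1 - c/2)"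
        by (rule infsum_le_finite_sums [OF sum fin])
      also have "\<dots> < lam powr (1 - c/4)" using \<Lambda>0 [of lam] lam by auto
      finally show "(\<Sum>\<^sub>\<infinity>C\<in>\<C>. L C) < lam powr (1 - c/4)" .
    qed
  qed
qed

end
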